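(* The function $\tilde W(\xi_1,\xi_2)$ is analytic (i.e. can be analytically continued from its initial domain of analyticity) in the domain $(H^-\setminus\{-k_1\})\times\hat H^+$. In the vicinity of $\{-k_1\}\times\hat H^+$ it can be represented as $$\tilde W(\xi_1,\xi_2)=\frac{1}{\xi_1+k_1}\,\frac{i\,\gamma(k_1,\xi_2)\,\gamma(k_1,k_2)}{\xi_2+k_2}+O\big((\xi_1+k_1)^0\big).$$ The function $\tilde W$ is analytic on the boundary elements $\mathbb{R}\times\hat H^+$, $P\times\hat H^+$ and $(H^-\setminus\{-k_1\})\times\mathbb{R}$, and continuous on the boundary element $P\times\mathbb{R}$.
   Context: Parameters: $k^2=1+i\epsilon$ with $\epsilon>0$ small and $k$ close to $1$; $k_1,k_2\in\mathbb{C}$ have positive real parts and small positive imaginary parts; $\kappa=\tfrac14\min(\epsilon/2,\mathrm{Im}(k_1),\mathrm{Im}(k_2))$. Quarter-plane problem: $u^{\rm in}=\exp\{i(k_1x_1+k_2x_2-\sqrt{k^2-k_1^2-k_2^2}\,x_3)\}$ and $u^{\rm t}=u^{\rm in}+u$. The scattered field $u$ is even in $x_3$, smooth for $x_3>0$, continuous as $x_3\to0^+$, and satisfies: $\Delta u+k^2u=0$ off the quarter-plane $\{x_3=0,x_1>0,x_2>0\}$; $u(x_1,x_2,0)=-e^{i(k_1x_1+k_2x_2)}$ if $x_1>0$ and $x_2>0$; $\partial u/\partial x_3(x_1,x_2,0)=0$ if $x_1<0$ or $x_2<0$; $u\to0$ as $r=(x_1^2+x_2^2+x_3^2)^{1/2}\to\infty$;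 edge conditions: there are functions $e_1,e_2$ with $|u^{\rm t}|<e_1(x_1)(x_2^2+x_3^2)^{1/4}$ as $x_2^2+x_3^2\to0$ for fixed $x_1>0$, and $|u^{\rm t}|<e_2(x_2)(x_1^2+x_3^2)^{1/4}$ as $x_1^2+x_3^2\to0$ for fixed $x_2>0$; vertex condition: $|u^{\rm t}|<c(\theta,\varphi)r^{\lambda}$ as $r\to0$ for some function $c$ of the spherical angles and some $\lambda>-1/2$. Standing assumption (exponential decay): there is $C_\epsilon$ with $|u(x_1,x_2,0^+)|<C_\epsilon\exp\{-4\kappa\sqrt{x_1^2+x_2^2}\}$ as $\sqrt{x_1^2+x_2^2}\to\infty$. Spectral functions: $\mathfrak{F}[\phi](\xi_1,\xi_2)=\iint_{\mathbb{R}^2}\phi(x_1,x_2)e^{i(\xi_1x_1+\xi_2x_2)}dx_1dx_2$; $\tilde U=\mathfrak{F}[u(\cdot,\cdot,0^+)]$, $\tilde W=\mathfrak{F}[\partial u/\partial x_3(\cdot,\cdot,0^+)]$. With $\tilde K(\xi_1,\xi_2)=(k^2-\xi_1^2-\xi_2^2)^{-1/2}$ (square root close to positive real for real $\xi_1,\xi_2$ with $\xi_1^2+\xi_2^2<1$, and with positive imaginary part for all real $\xi_1,\xi_2$) the functional equation $\tilde K\tilde W=i\tilde U$ holds. $\tilde W$ is initially analytic for $\mathrm{Im}(\xi_1)>-2\kappa$, $\mathrm{Im}(\xi_2)>-2\kappa$. The function $\tilde U'=\tilde U-\frac{1}{(\xi_1+k_1)(\xi_2+k_2)}$ is 3/4-based,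 i.e. its inverse Fourier transform vanishes for $x_1>0,x_2>0$. Growth conditions satisfied by $\tilde W$: there are functions $E_1,E_2$ with $|\tilde W|<E_1(\xi_1)|\xi_2|^{-1/2}$ as $|\xi_2|\to\infty$, $\mathrm{Im}(\xi_2)>0$, and $|\tilde W|<E_2(\xi_2)|\xi_1|^{-1/2}$ as $|\xi_1|\to\infty$, $\mathrm{Im}(\xi_1)>0$; and there are $\lambda>-1/2$ and a function $C(\beta,\psi_1,\psi_2)$, $0<\beta<\pi/2$, $0<\psi_{1,2}<\pi$, with $|\tilde W(\xi_1,\xi_2)|<C(\beta,\psi_1,\psi_2)\Lambda^{-1-\lambda}$ for $\xi_1=\Lambda e^{i\psi_1}\cos\beta$, $\xi_2=\Lambda e^{i\psi_2}\sin\beta$, $\Lambda$ large real. The function $\gamma(\xi_1,\xi_2)=\sqrt{\sqrt{k^2-\xi_1^2}+\xi_2}$, where on the physical sheet the square roots are the arithmetic ones (positive for positive real argument), the inner root having positive imaginary part for real $\xi_1$ and being continued analytically to $\mathbb{C}\setminus(h^+\cup h^-)$. Domains: $h^{\pm}$ is the curve $\{\pm\sqrt{k^2-\tau^2}:\tau\in\mathbb{R}\}$ (root with positive imaginary part), going from $\pm k$ to $\pm i\infty$. $H^+$ and $H^-$ are the open upper and lower half-planes cut along $h^+$ and $h^-$ respectively; $\hat H^+$ is the open upper half-plane (not cut). $P$ is the contour going from $-i\infty$ to $-k$ along the right shore of the cut $h^-$ and back to $-i\infty$ along its left shore (right/left with respect to $h^-$ directed from $-k$ to $-i\infty$); points on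 different shores are regarded as different boundary points, so the boundary of $H^-$ is $\mathbb{R}\cup P$. Boundary notions, for the domain $B_1\times B_2$ with $B_1=H^-$, $B_2=\hat H^+$ (minus the polar set): analyticity at a point of $(\partial B_1\times B_2)\cup(B_1\times\partial B_2)$ means that the function can be analytically continued to a small polydisc centred at that point; continuity at a point of $\partial B_1\times\partial B_2$ means that the function tends to one common limit along every continuous path ending at the point and going in $(B_1\times B_2)\cup(\partial B_1\times B_2)\cup(B_1\times\partial B_2)$.
   Formalization: At the tip -k of P, where continuation to a polydisc in ξ1 is impossible because W̃ branches there, analyticity on P×Ĥ⁺ is stated in the local coordinate √(k²-ξ1²); k1 is assumed not to lie on h⁺, so that γ(k1,·) is defined and -k1 lies in H⁻. *)

theory Defs
  imports "HOL-Analysis.Analysis" "HOL-Library.Landau_Symbols"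
begin

subsection \<open>Differentiability\<close>

definition partial :: "'a::euclidean_space \<Rightarrow> ('a \<Rightarrow> complex) \<Rightarrow> 'a \<Rightarrow> complex" where
  "partial v f x = frechet_derivative f (at x) v"

definition laplacian :: "('a::euclidean_space \<Rightarrow> complex) \<Rightarrow> 'a \<Rightarrow> complex" where
  "laplacian f x = (\<Sum>v\<in>Basis. partial v (partial v f) x)"

text \<open>The class \<open>C\<^sup>n\<close>; meant for open sets only.\<close>

primrec Ck_on :: "nat \<Rightarrow> 'a::euclidean_space set \<Rightarrow> ('a \<Rightarrow> complex) \<Rightarrow> bool" where
  "Ck_on 0 S f \<longleftrightarrow> continuous_on S f"
| "Ck_on (Suc n) S f \<longleftrightarrow> f differentiable_on S \<and> (\<forall>v\<in>Basis. Ck_on n S (partial v f))"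

text \<open>Analyticity in two complex variables on an open set: the real Frechet derivative exists
  and is complex linear.\<close>

definition holo2_on :: "(complex \<times> complex \<Rightarrow> complex) \<Rightarrow> (complex \<times> complex) set \<Rightarrow> bool" where
  "holo2_on f S \<longleftrightarrow>
     (\<forall>p\<in>S. \<exists>a b. (f has_derivative (\<lambda>h. a * fst h + b * snd h)) (at p))"

subsection \<open>The quarter-plane problem\<close>

definition kappa :: "real \<Rightarrow> complex \<Rightarrow> complex \<Rightarrow> real" where
  "kappa \<epsilon> k1 k2 = (1/4) * min (\<epsilon> / 2) (min (Im k1) (Im k2))"

definition u_in :: "complex \<Rightarrow> complex \<Rightarrow> complex \<Rightarrow> real \<times> real \<times> real \<Rightarrow> complex" where
  "u_in k k1 k2 = (\<lambda>(x1, x2, x3).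
     exp (\<i> * (k1 * of_real x1 + k2 * of_real x2 - csqrt (k^2 - k1^2 - k2^2) * of_real x3)))"

definition u_total ::
  "complex \<Rightarrow> complex \<Rightarrow> complex \<Rightarrow> (real \<times> real \<times> real \<Rightarrow> complex) \<Rightarrow> real \<times> real \<times> real \<Rightarrow> complex" where
  "u_total k k1 k2 u x = u_in k k1 k2 x + u x"

text \<open>The quarter-plane is closed here: the Helmholtz equation is not imposed on the edges
  and at the vertex, where solutions are singular and the edge and vertex conditions apply.\<close>

definition quarter_plane :: "(real \<times> real \<times> real) set" where
  "quarter_plane = {(x1, x2, x3). x3 = 0 \<and> x1 \<ge> 0 \<and> x2 \<ge> 0}"

definition edge_conditions :: "(real \<times> real \<times> real \<Rightarrow> complex) \<Rightarrow> bool" where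
  "edge_conditions ut \<longleftrightarrow>
     (\<exists>e1 :: real \<Rightarrow> real. \<forall>x1>0. \<forall>\<^sub>F (x2, x3) in at (0 :: real \<times> real).
        norm (ut (x1, x2, x3)) < e1 x1 * (x2^2 + x3^2) powr (1/4)) \<and>
     (\<exists>e2 :: real \<Rightarrow> real. \<forall>x2>0. \<forall>\<^sub>F (x1, x3) in at (0 :: real \<times> real).
        norm (ut (x1, x2, x3)) < e2 x2 * (x1^2 + x3^2) powr (1/4))"

definition vertex_condition :: "(real \<times> real \<times> real \<Rightarrow> complex) \<Rightarrow> bool" where
  "vertex_condition ut \<longleftrightarrow>
     (\<exists>\<nu> > - 1/2. \<exists>c :: real \<Rightarrow> real \<Rightarrow> real. \<forall>\<theta>\<in>{0..pi}. \<forall>\<phi>\<in>{0..<2*pi}. \<forall>\<^sub>F r in at_right 0.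
        norm (ut (r * sin \<theta> * cos \<phi>, r * sin \<theta> * sin \<phi>, r * cos \<theta>)) < c \<theta> \<phi> * r powr \<nu>)"

definition quarter_plane_problem ::
  "complex \<Rightarrow> complex \<Rightarrow> complex \<Rightarrow> (real \<times> real \<times> real \<Rightarrow> complex) \<Rightarrow> bool" where
  "quarter_plane_problem k k1 k2 u \<longleftrightarrow>
     (\<forall>x1 x2 x3. u (x1, x2, - x3) = u (x1, x2, x3)) \<and>
     (\<forall>n. Ck_on n {(x1, x2, x3). x3 > 0} u) \<and>
     continuous_on {(x1, x2, x3). x3 \<ge> 0} u \<and>
     Ck_on 2 (- quarter_plane) u \<and>
     (\<forall>x\<in>- quarter_plane. laplacian u x + k^2 * u x = 0) \<and>
     (\<forall>x1>0. \<forall>x2>0. u (x1, x2, 0) = - exp (\<i> * (k1 * of_real x1 + k2 * of_real x2))) \<and>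
     (\<forall>x1 x2. x1 < 0 \<or> x2 < 0 \<longrightarrow> ((\<lambda>x3. u (x1, x2, x3)) has_vector_derivative 0) (at 0)) \<and>
     (u \<longlongrightarrow> 0) at_infinity \<and>
     edge_conditions (u_total k k1 k2 u) \<and>
     vertex_condition (u_total k k1 k2 u)"

definition trace0 :: "(real \<times> real \<times> real \<Rightarrow> complex) \<Rightarrow> real \<times> real \<Rightarrow> complex" where
  "trace0 u = (\<lambda>(x1, x2). Lim (at_right 0) (\<lambda>x3. u (x1, x2, x3)))"

definition normal_trace0 :: "(real \<times> real \<times> real \<Rightarrow> complex) \<Rightarrow> real \<times> real \<Rightarrow> complex" where
  "normal_trace0 u = (\<lambda>(x1, x2). Lim (at_right 0) (\<lambda>x3. vector_derivative (\<lambda>t. u (x1, x2, t)) (at x3)))"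

definition exponential_decay :: "real \<Rightarrow> (real \<times> real \<times> real \<Rightarrow> complex) \<Rightarrow> bool" where
  "exponential_decay \<kappa> u \<longleftrightarrow> (\<exists>C. \<forall>\<^sub>F (x1, x2) in at_infinity.
     norm (trace0 u (x1, x2)) < C * exp (- 4 * \<kappa> * sqrt (x1^2 + x2^2)))"

subsection \<open>Spectral functions\<close>

definition fourier_integrand ::
  "(real \<times> real \<Rightarrow> complex) \<Rightarrow> complex \<times> complex \<Rightarrow> real \<times> real \<Rightarrow> complex" where
  "fourier_integrand \<phi> = (\<lambda>(\<xi>1, \<xi>2) (x1, x2).
     \<phi> (x1, x2) * exp (\<i> * (\<xi>1 * of_real x1 + \<xi>2 * of_real x2)))"

definition fourier :: "(real \<times> real \<Rightarrow> complex) \<Rightarrow> complex \<times> complex \<Rightarrow> complex" where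
  "fourier \<phi> \<xi> = (LINT x|lborel. fourier_integrand \<phi> \<xi> x)"

definition spectral_U :: "(real \<times> real \<times> real \<Rightarrow> complex) \<Rightarrow> complex \<times> complex \<Rightarrow> complex" where
  "spectral_U u = fourier (trace0 u)"

definition spectral_W :: "(real \<times> real \<times> real \<Rightarrow> complex) \<Rightarrow> complex \<times> complex \<Rightarrow> complex" where
  "spectral_W u = fourier (normal_trace0 u)"

text \<open>Used for real arguments only: there the radicand has positive imaginary part
  \<open>Im (k^2)\<close>, so that the principal root has positive real and imaginary parts.\<close>

definition spectral_K :: "complex \<Rightarrow> real \<Rightarrow> real \<Rightarrow> complex" where
  "spectral_K k \<xi>1 \<xi>2 = 1 / csqrt (k^2 - of_real \<xi>1^2 - of_real \<xi>2^2)"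

definition functional_equation :: "complex \<Rightarrow> (real \<times> real \<times> real \<Rightarrow> complex) \<Rightarrow> bool" where
  "functional_equation k u \<longleftrightarrow> (\<forall>\<xi>1 \<xi>2.
     spectral_K k \<xi>1 \<xi>2 * spectral_W u (of_real \<xi>1, of_real \<xi>2)
       = \<i> * spectral_U u (of_real \<xi>1, of_real \<xi>2))"

definition initial_domain :: "real \<Rightarrow> (complex \<times> complex) set" where
  "initial_domain \<kappa> = {(\<xi>1, \<xi>2). Im \<xi>1 > - 2 * \<kappa> \<and> Im \<xi>2 > - 2 * \<kappa>}"

text \<open>Analyticity includes the absolute convergence of the defining integral, because a
  divergent integral has the value \<open>0\<close>.\<close>

definition initially_analytic :: "real \<Rightarrow> (real \<times> real \<times> real \<Rightarrow> complex) \<Rightarrow> bool" where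
  "initially_analytic \<kappa> u \<longleftrightarrow>
     (\<forall>\<xi>\<in>initial_domain \<kappa>. integrable lborel (fourier_integrand (normal_trace0 u) \<xi>)) \<and>
     holo2_on (spectral_W u) (initial_domain \<kappa>)"

definition three_quarter_based :: "(complex \<times> complex \<Rightarrow> complex) \<Rightarrow> bool" where
  "three_quarter_based U \<longleftrightarrow> (\<exists>\<phi>. integrable lborel \<phi> \<and>
     (\<forall>x1>0. \<forall>x2>0. \<phi> (x1, x2) = 0) \<and>
     (\<forall>\<xi>1 \<xi>2 :: real. U (of_real \<xi>1, of_real \<xi>2) = fourier \<phi> (of_real \<xi>1, of_real \<xi>2)))"

definition spectral_U' ::
  "complex \<Rightarrow> complex \<Rightarrow> (real \<times> real \<times> real \<Rightarrow> complex) \<Rightarrow> complex \<times> complex \<Rightarrow> complex" where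
  "spectral_U' k1 k2 u = (\<lambda>(\<xi>1, \<xi>2). spectral_U u (\<xi>1, \<xi>2) - 1 / ((\<xi>1 + k1) * (\<xi>2 + k2)))"

definition growth_conditions :: "(complex \<times> complex \<Rightarrow> complex) \<Rightarrow> bool" where
  "growth_conditions W \<longleftrightarrow>
     (\<exists>E1 :: complex \<Rightarrow> real. \<forall>\<xi>1. Im \<xi>1 > 0 \<longrightarrow>
        (\<forall>\<^sub>F \<xi>2 in inf at_infinity (principal {z. Im z > 0}).
           norm (W (\<xi>1, \<xi>2)) < E1 \<xi>1 * norm \<xi>2 powr (- 1/2))) \<and>
     (\<exists>E2 :: complex \<Rightarrow> real. \<forall>\<xi>2. Im \<xi>2 > 0 \<longrightarrow>
        (\<forall>\<^sub>F \<xi>1 in inf at_infinity (principal {z. Im z > 0}).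
           norm (W (\<xi>1, \<xi>2)) < E2 \<xi>2 * norm \<xi>1 powr (- 1/2))) \<and>
     (\<exists>\<nu> > - 1/2. \<exists>C :: real \<Rightarrow> real \<Rightarrow> real \<Rightarrow> real.
        \<forall>\<beta>\<in>{0<..<pi/2}. \<forall>\<psi>1\<in>{0<..<pi}. \<forall>\<psi>2\<in>{0<..<pi}. \<forall>\<^sub>F \<Lambda> in at_top.
           norm (W (of_real (\<Lambda> * cos \<beta>) * cis \<psi>1, of_real (\<Lambda> * sin \<beta>) * cis \<psi>2))
             < C \<beta> \<psi>1 \<psi>2 * \<Lambda> powr (- 1 - \<nu>))"

subsection \<open>Cuts and domains\<close>

text \<open>The square root with positive imaginary part, analytic off \<open>[0, \<infinity>)\<close>.\<close>

definition sqrt_up :: "complex \<Rightarrow> complex" where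
  "sqrt_up w = \<i> * csqrt (- w)"

text \<open>\<open>sqrt_up (k^2 - \<xi>^2)\<close> is analytic off the two cuts, because \<open>k^2 - \<xi>^2 \<ge> 0\<close>
  exactly on them.\<close>

definition inner_root :: "complex \<Rightarrow> complex \<Rightarrow> complex" where
  "inner_root k \<xi> = sqrt_up (k^2 - \<xi>^2)"

definition gamma_fun :: "complex \<Rightarrow> complex \<Rightarrow> complex \<Rightarrow> complex" where
  "gamma_fun k \<xi>1 \<xi>2 = csqrt (inner_root k \<xi>1 + \<xi>2)"

definition h_plus :: "complex \<Rightarrow> complex set" where
  "h_plus k = range (\<lambda>\<tau>::real. sqrt_up (k^2 - of_real \<tau>^2))"

definition h_minus :: "complex \<Rightarrow> complex set" where
  "h_minus k = range (\<lambda>\<tau>::real. - sqrt_up (k^2 - of_real \<tau>^2))"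

definition H_minus :: "complex \<Rightarrow> complex set" where
  "H_minus k = {\<xi>. Im \<xi> < 0} - h_minus k"

definition H_hat_plus :: "complex set" where
  "H_hat_plus = {\<xi>. Im \<xi> > 0}"

text \<open>To tell the two shores of \<open>h_minus k\<close> apart, a point \<open>\<xi>\<close> of the cut half-plane is
  represented by the pair \<open>(\<xi>, inner_root k \<xi>)\<close>. As \<open>\<xi>\<close> tends to the point
  \<open>p = - sqrt_up (k^2 - \<tau>^2)\<close> of the cut, the inner root tends to \<open>\<tau>\<close> on one shore and to
  \<open>- \<tau>\<close> on the other one (to \<open>\<tau> < 0\<close> on the right shore of the cut directed from \<open>- k\<close>
  to \<open>- \<i>\<infinity>\<close>). The pairs \<open>(p, \<tau>)\<close>, with \<open>\<tau>\<close> running over the reals, are therefore the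
  points of the contour \<open>P\<close>; \<open>\<tau> = 0\<close> is the tip \<open>- k\<close>, which belongs to both shores. With
  the topology of \<open>complex \<times> complex\<close> this is the cut half-plane together with its two-sided
  boundary.\<close>

definition lift :: "complex \<Rightarrow> complex set \<Rightarrow> (complex \<times> complex) set" where
  "lift k A = (\<lambda>\<xi>. (\<xi>, inner_root k \<xi>)) ` A"

definition P_point :: "complex \<Rightarrow> real \<Rightarrow> complex \<times> complex" where
  "P_point k \<tau> = (- sqrt_up (k^2 - of_real \<tau>^2), of_real \<tau>)"

definition P_contour :: "complex \<Rightarrow> (complex \<times> complex) set" where
  "P_contour k = range (P_point k)"

definition boundary_H_minus :: "complex \<Rightarrow> (complex \<times> complex) set" where
  "boundary_H_minus k = lift k \<real> \<union> P_contour k"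

subsection \<open>Boundary notions\<close>

text \<open>\<open>F\<close> is a function on \<open>H_minus k \<times> H_hat_plus\<close> (minus the polar set). The point is
  \<open>((p, \<sigma>), q)\<close>, with \<open>(p, \<sigma>)\<close> a pair as above; the bound on \<open>inner_root k z\<close> selects the
  side of the cut.\<close>

definition analytic_at_boundary ::
  "complex \<Rightarrow> (complex \<times> complex \<Rightarrow> complex) \<Rightarrow> complex \<times> complex \<Rightarrow> complex \<Rightarrow> bool" where
  "analytic_at_boundary k F = (\<lambda>(p, \<sigma>) q. \<exists>\<rho>>0. \<exists>G. holo2_on G (ball p \<rho> \<times> ball q \<rho>) \<and>
     (\<forall>z\<in>H_minus k \<inter> ball p \<rho>. \<forall>w\<in>H_hat_plus \<inter> ball q \<rho>.
        dist (inner_root k z) \<sigma> < \<rho> \<longrightarrow> F (z, w) = G (z, w)))"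

text \<open>At the tip \<open>- k\<close> of the cut the domain surrounds the boundary point, and the
  inner root, which behaves like \<open>sqrt (2 * k * (z + k))\<close>, replaces \<open>z + k\<close> as the local
  coordinate of the two-sided boundary. (A single-valued continuation to a disc in \<open>z\<close> would
  mean that there is no cut at all.)\<close>

definition analytic_at_tip ::
  "complex \<Rightarrow> (complex \<times> complex \<Rightarrow> complex) \<Rightarrow> complex \<Rightarrow> bool" where
  "analytic_at_tip k F q \<longleftrightarrow> (\<exists>\<rho>>0. \<exists>G. holo2_on G (ball 0 \<rho> \<times> ball q \<rho>) \<and>
     (\<forall>z\<in>H_minus k \<inter> ball (- k) \<rho>. \<forall>w\<in>H_hat_plus \<inter> ball q \<rho>.
        inner_root k z \<in> ball 0 \<rho> \<longrightarrow> F (z, w) = G (inner_root k z, w)))"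

text \<open>The value of \<open>F\<close> at an inner point or at a boundary point, at which it is the value of
  the continuation; \<open>c\<close> is the pole.\<close>

definition extended_value ::
  "complex \<Rightarrow> complex \<Rightarrow> (complex \<times> complex \<Rightarrow> complex) \<Rightarrow> (complex \<times> complex) \<times> complex \<Rightarrow> complex" where
  "extended_value k c F b =
     Lim (at b within lift k (H_minus k - {c}) \<times> H_hat_plus) (\<lambda>((z, \<sigma>), w). F (z, w))"

definition continuous_at_boundary ::
  "complex \<Rightarrow> complex \<Rightarrow> (complex \<times> complex \<Rightarrow> complex) \<Rightarrow> complex \<times> complex \<Rightarrow> complex \<Rightarrow> bool" where
  "continuous_at_boundary k c F b q \<longleftrightarrow> (\<exists>L. \<forall>g. path g \<and> pathfinish g = (b, q) \<and>
     g ` {0..<1} \<subseteq> lift k (H_minus k - {c}) \<times> H_hat_plus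
                 \<union> boundary_H_minus k \<times> H_hat_plus
                 \<union> lift k (H_minus k - {c}) \<times> \<real>
     \<longrightarrow> ((\<lambda>t. extended_value k c F (g t)) \<longlongrightarrow> L) (at_left 1))"

end

theory Submission
  imports Defs "HOL-Complex_Analysis.Complex_Analysis" "HOL-Real_Asymp.Real_Asymp"
begin

text \<open>Write \<open>b\<close> for the inner root at \<open>\<xi>1\<close>, so that \<open>W = \<i> csqrt (b + \<xi>2) csqrt (b - \<xi>2) U\<close>, first for real
  arguments and then on a strip in both variables. Divide by \<open>csqrt (b + \<xi>2)\<close> and project onto the functions of
  \<open>\<xi>2\<close> that are analytic in the upper half-plane. The part of \<open>u\<close> over \<open>x1 > 0\<close>, \<open>x2 < 0\<close> drops out, the
  quadrant gives an explicit term with a pole at \<open>\<xi>1 = - k1\<close>, and the transform \<open>U_-\<close> of the part over \<open>x1 < 0\<close>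
  is analytic for \<open>Im \<xi>1 < 0\<close>. The result is a formula \<open>W (\<xi>1, \<xi>2) = G (\<xi>1, b, \<xi>2)\<close> with
  \<open>G (z, s, w) = csqrt (s + w) (\<i> csqrt (s + k2) / ((z + k1) (w + k2)) + J (z, s, w))\<close>, where the Cauchy integral \<open>J\<close>
  is analytic for \<open>Im z < 0\<close> and for \<open>Im s\<close>, \<open>Im w\<close> down to a little below \<open>0\<close>. The only singularity
  of \<open>G\<close> at the boundary is the square root at \<open>s + w = 0\<close>, which needs both \<open>s\<close> and \<open>w\<close> real. Absolute
  convergence comes from the boundedness of \<open>W\<close> alone: it makes \<open>U\<close> decay like the reciprocal of
  \<open>1 + \<bar>Re \<xi>1\<bar> + \<bar>Re \<xi>2\<bar>\<close>, and \<open>U_-\<close> is the Cauchy integral of \<open>U\<close> in \<open>\<xi>1\<close>.\<close>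

subsection \<open>Cauchy integrals over horizontal lines\<close>

text \<open>The construction treats \<open>z\<close> and the inner root \<open>s\<close> as
  independent arguments. On s^2 + z^2 = k^2 the two shores of the cut differ only in the sign of the
  real number \<open>s\<close>, so both boundary values of W are values of the one function G, and
  at the tip \<open>s\<close> itself is a coordinate in which the branch point disappears. The
  obstacle is convergence. The transforms of the parts of the trace are only known to be bounded,
  and multiplication by a root lets them grow, so a single Cauchy kernel gives no absolutely
  convergent integral. Cauchy's theorem is therefore applied to the difference of two kernels, and
  the second pole is sent to infinity only after the parts have been recombined, because decay is
  established only for the recombined function. The lines of integration are chosen accordingly: Im
  \<xi>1 = \<kappa> lies above every point of the lower half-plane, Im \<xi>2 = - \<kappa> lies
  below every real point, and the rate 2 \<kappa> of the weight keeps every transform involved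
  analytic near these lines.\<close>

lemma integrable_powr_abs:
  fixes p :: real
  assumes "p < -1"
  shows "integrable lborel (\<lambda>t::real. (1 + \<bar>t\<bar>) powr p)"
proof -
  define h where "h = (\<lambda>x::real. indicator {1..} x * x powr p)"
  have hm: "h \<in> borel_measurable borel" unfolding h_def by measurable
  have "integrable lborel h"
  proof (rule integrableI_nonneg)
    show "h \<in> borel_measurable lborel" using hm by simp
    show "AE x in lborel. 0 \<le> h x" unfolding h_def by auto
    have "integral\<^sup>N lborel (\<lambda>x. indicator {1..} x * x powr p) = ennreal (-(1 powr (p+1)) / (p+1))"
      by (rule nn_integral_has_integral_lebesgue) (use has_integral_powr_to_inf[of p 1] assms in auto)
    then show "(\<integral>\<^sup>+ x. ennreal (h x) \<partial>lborel) < \<infinity>"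
      unfolding h_def by simp
  qed
  from lborel_integrable_real_affine[OF this, of 1 1] lborel_integrable_real_affine[OF this, of "-1" 1]
  have "integrable lborel (\<lambda>t. h (1 + t) + h (1 - t))"
    by (intro Bochner_Integration.integrable_add) auto
  then show ?thesis
  proof (rule Bochner_Integration.integrable_bound)
    show "AE t in lborel. norm ((1 + \<bar>t\<bar>) powr p) \<le> norm (h (1 + t) + h (1 - t))"
      by (auto simp: h_def indicator_def)
  qed auto
qed

text \<open>The three sides off the real axis have total length 4 R, and decay of order -3/2 makes
  their contribution O(R powr (-1/2)). Taking the common value \<open>I\<close> of the rectangle
  integrals as a hypothesis lets one limit argument serve both Cauchy's formula and Cauchy's
  theorem; \<open>S\<close> collects the enclosed poles.\<close>

lemma line_integral_eq_rect_limit: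
  fixes g :: "complex \<Rightarrow> complex"
  assumes cont: "continuous_on ({z. Im z \<ge> 0} - S) g"
    and S: "\<And>z. z \<in> S \<Longrightarrow> Im z > 0 \<and> norm z < R0" and R0: "R0 > 0"
    and bound: "\<And>z. Im z \<ge> 0 \<Longrightarrow> norm z \<ge> R0 \<Longrightarrow> norm (g z) \<le> C * norm z powr (-3/2)"
    and rect: "\<And>R. R \<ge> R0 \<Longrightarrow> (g has_contour_integral I) (rectpath (of_real (-R)) (Complex R R))"
  shows "integrable lborel (\<lambda>t::real. g (of_real t))"
    and "(LINT t|lborel. g (of_real t)) = I"
proof -
  define G where "G = (\<lambda>t::real. g (of_real t))"
  have contG: "continuous_on A G" for A
    unfolding G_def by (rule continuous_on_compose2[OF cont]) (use S in \<open>force intro!: continuous_intros\<close>)+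
  have measG: "G \<in> borel_measurable borel"
    using borel_measurable_continuous_onI[OF contG] .
  have "compact (G ` {-R0..R0})" by (rule compact_continuous_image[OF contG]) auto
  then obtain M where "\<forall>x\<in>G ` {-R0..R0}. norm x \<le> M"
    by (auto dest!: compact_imp_bounded simp: bounded_iff)
  then have M: "\<And>t. \<bar>t\<bar> \<le> R0 \<Longrightarrow> norm (G t) \<le> M" by (auto simp: abs_le_iff)
  have M0: "M \<ge> 0" using M[of 0] R0 norm_ge_zero[of "G 0"] by linarith
  have C0: "C \<ge> 0"
  proof -
    have "0 \<le> norm (g (of_real R0))" by simp
    also have "\<dots> \<le> C * norm (of_real R0 :: complex) powr (-3/2)" by (rule bound) (use R0 in auto)
    finally show ?thesis using R0 by (simp add: zero_le_mult_iff)
  qed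
  \<comment> \<open>The first summand covers \<bar>t\<bar> \<le> R0, where only the bound
    \<open>M\<close> on a compact set is available; the second comes from 1 + \<bar>t\<bar> \<le> (1
    / R0 + 1) \<bar>t\<bar> beyond R0.\<close>
  define K where "K = M * (1 + R0) powr (3/2) + C * (1 / R0 + 1) powr (3/2)"
  have dom: "norm (G t) \<le> K * (1 + \<bar>t\<bar>) powr (-3/2)" for t
  proof (cases "\<bar>t\<bar> \<le> R0")
    case True
    have "1 \<le> (1 + R0) powr (3/2) * (1 + \<bar>t\<bar>) powr (-3/2)"
      using True by (simp add: powr_minus field_simps powr_mono2)
    then have "M * 1 \<le> M * ((1 + R0) powr (3/2) * (1 + \<bar>t\<bar>) powr (-3/2))"
      using M0 by (intro mult_left_mono) auto
    moreover have "0 \<le> C * (1 / R0 + 1) powr (3/2) * (1 + \<bar>t\<bar>) powr (-3/2)" using C0 by simp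
    ultimately show ?thesis using M[OF True] unfolding K_def by (simp add: algebra_simps)
  next
    case False
    then have t: "\<bar>t\<bar> > R0" "\<bar>t\<bar> > 0" using R0 by auto
    have "norm (G t) \<le> C * \<bar>t\<bar> powr (-3/2)"
      using bound[of "of_real t"] t by (simp add: G_def)
    also have "(1 / R0 + 1) * \<bar>t\<bar> \<ge> 1 + \<bar>t\<bar>" using t R0 by (simp add: field_simps)
    then have "(1 + \<bar>t\<bar>) powr (3/2) \<le> ((1 / R0 + 1) * \<bar>t\<bar>) powr (3/2)" by (intro powr_mono2) auto
    then have "(1 + \<bar>t\<bar>) powr (3/2) \<le> (1 / R0 + 1) powr (3/2) * \<bar>t\<bar> powr (3/2)"
      using R0 by (subst (asm) powr_mult) auto
    then have "\<bar>t\<bar> powr (-3/2) \<le> (1 / R0 + 1) powr (3/2) * (1 + \<bar>t\<bar>) powr (-3/2)"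
      using t by (simp add: powr_minus divide_simps mult.commute)
    then have "C * \<bar>t\<bar> powr (-3/2) \<le> C * ((1 / R0 + 1) powr (3/2) * (1 + \<bar>t\<bar>) powr (-3/2))"
      using C0 by (rule mult_left_mono)
    also have "\<dots> \<le> K * (1 + \<bar>t\<bar>) powr (-3/2)"
      using M0 unfolding K_def by (simp add: algebra_simps)
    finally show ?thesis .
  qed
  have intK: "integrable lborel (\<lambda>t::real. K * (1 + \<bar>t\<bar>) powr (-3/2))"
    by (intro integrable_mult_right integrable_powr_abs) auto
  show int: "integrable lborel (\<lambda>t::real. g (of_real t))"
    unfolding G_def[symmetric]
    by (rule Bochner_Integration.integrable_bound[OF intK])
       (use measG dom in \<open>auto intro!: AE_I2 order_trans[OF dom]\<close>)
  define E where "E = (\<lambda>R::real. I - (LINT t|lborel. indicator {-R..R} t *\<^sub>R G t))"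
  have E: "norm (E R) \<le> C * R powr (-3/2) * (4 * R)" if R: "R \<ge> R0" for R
  proof -
    let ?a = "of_real (-R) :: complex" and ?b = "of_real R :: complex" and ?c = "Complex R R" and ?d = "Complex (-R) R"
    have Rpos: "R > 0" using R R0 by auto
    have eqs: "Complex (Re ?c) (Im ?a) = ?b" "Complex (Re ?a) (Im ?c) = ?d" by (auto simp: complex_eq_iff)
    have seg: "closed_segment ?b ?c \<subseteq> {z. Im z \<ge> 0 \<and> Re z = R}"
       "closed_segment ?c ?d \<subseteq> {z. Im z = R}"
       "closed_segment ?d ?a \<subseteq> {z. Im z \<ge> 0 \<and> Re z = -R}"
       "closed_segment ?a ?b \<subseteq> {z. Im z = 0}"
      using Rpos by (auto simp: closed_segment_same_Re closed_segment_same_Im closed_segment_eq_real_ivl)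
    have big: "norm z \<ge> R \<and> Im z \<ge> 0" if "z \<in> closed_segment ?b ?c \<union> closed_segment ?c ?d \<union> closed_segment ?d ?a" for z
      using that seg Rpos abs_Re_le_cmod[of z] abs_Im_le_cmod[of z] by auto
    have notS: "z \<notin> S" if "z \<in> closed_segment ?b ?c \<union> closed_segment ?c ?d \<union> closed_segment ?d ?a" for z
      using big[OF that] S[of z] R by force
    have bd: "norm (g z) \<le> C * R powr (-3/2)" if "z \<in> closed_segment ?b ?c \<union> closed_segment ?c ?d \<union> closed_segment ?d ?a" for z
    proof -
      have "norm (g z) \<le> C * norm z powr (-3/2)" using big[OF that] R by (intro bound) auto
      also have "\<dots> \<le> C * R powr (-3/2)"
        using big[OF that] Rpos C0 by (intro mult_left_mono) (auto intro!: powr_mono2')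
      finally show ?thesis .
    qed
    have "closed_segment ?a ?b \<subseteq> {z. Im z \<ge> 0} - S"
      using seg(4) S by fastforce
    then have sub: "closed_segment ?a ?b \<subseteq> {z. Im z \<ge> 0} - S" "closed_segment ?b ?c \<subseteq> {z. Im z \<ge> 0} - S"
      "closed_segment ?c ?d \<subseteq> {z. Im z \<ge> 0} - S" "closed_segment ?d ?a \<subseteq> {z. Im z \<ge> 0} - S"
      using big notS by blast+
    have ci: "g contour_integrable_on linepath ?a ?b" "g contour_integrable_on linepath ?b ?c"
      "g contour_integrable_on linepath ?c ?d" "g contour_integrable_on linepath ?d ?a"
      by (intro contour_integrable_continuous_linepath continuous_on_subset[OF cont] sub)+
    have "I = contour_integral (rectpath ?a ?c) g" using rect[OF R] by (simp add: contour_integral_unique)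
    also have "\<dots> = contour_integral (linepath ?a ?b) g + contour_integral (linepath ?b ?c) g
        + contour_integral (linepath ?c ?d) g + contour_integral (linepath ?d ?a) g"
      unfolding rectpath_def Let_def eqs using ci
      by (simp add: contour_integral_join contour_integrable_join)
    finally have I: "I = \<dots>" .
    have "contour_integral (linepath ?a ?b) g = integral {-R..R} G"
      using Rpos by (subst contour_integral_linepath_Reals_eq) (auto simp: G_def)
    also have "integral {-R..R} G = (LINT t|lborel. indicator {-R..R} t *\<^sub>R G t)"
      using set_borel_integral_eq_integral(2)[of "{-R..R}" G] int
      by (simp add: set_lebesgue_integral_def set_integrable_def G_def[symmetric] integrable_mult_indicator)
    finally have ER: "E R = contour_integral (linepath ?b ?c) g
        + contour_integral (linepath ?c ?d) g + contour_integral (linepath ?d ?a) g"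
      unfolding E_def I by simp
    have nb: "norm (contour_integral (linepath ?b ?c) g) \<le> C * R powr (-3/2) * norm (?c - ?b)"
             "norm (contour_integral (linepath ?c ?d) g) \<le> C * R powr (-3/2) * norm (?d - ?c)"
             "norm (contour_integral (linepath ?d ?a) g) \<le> C * R powr (-3/2) * norm (?a - ?d)"
      by (rule contour_integral_bound_linepath; use ci bd C0 in auto)+
    have "?c - ?b = \<i> * R" "?d - ?c = - 2 * R" "?a - ?d = - \<i> * R" by (auto simp: complex_eq_iff)
    then have ns: "norm (?c - ?b) = R" "norm (?d - ?c) = 2 * R" "norm (?a - ?d) = R"
      using Rpos by (auto simp: norm_mult)
    have "norm (E R) \<le> norm (contour_integral (linepath ?b ?c) g) + norm (contour_integral (linepath ?c ?d) g)
        + norm (contour_integral (linepath ?d ?a) g)"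
      unfolding ER by (intro norm_triangle_mono norm_triangle_ineq) auto
    also have "\<dots> \<le> C * R powr (-3/2) * (4 * R)"
      using nb unfolding ns by (simp add: algebra_simps)
    finally show ?thesis .
  qed
  have "((\<lambda>R::real. C * R powr (-3/2) * (4 * R)) \<longlongrightarrow> 0) at_top" by real_asymp
  then have "(E \<longlongrightarrow> 0) at_top"
    by (rule Lim_null_comparison[rotated]) (rule eventually_mono[OF eventually_ge_at_top[of R0] E])
  then have 1: "((\<lambda>R. I - E R) \<longlongrightarrow> I - 0) at_top" by (intro tendsto_intros)
  have 2: "((\<lambda>R. LINT t|lborel. indicator {-R..R} t *\<^sub>R G t) \<longlongrightarrow> (LINT t|lborel. G t)) at_top"
  proof (rule integral_dominated_convergence_at_top[where w="\<lambda>t. norm (G t)"])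
    show "integrable lborel (\<lambda>t. norm (G t))" using int by (auto simp: G_def)
    show "AE t in lborel. ((\<lambda>i. indicator {- i..i} t *\<^sub>R G t) \<longlongrightarrow> G t) at_top"
    proof (rule AE_I2)
      fix t :: real
      have "eventually (\<lambda>i. indicator {- i..i} t *\<^sub>R G t = G t) at_top"
        using eventually_ge_at_top[of "\<bar>t\<bar>"] by eventually_elim (auto simp: indicator_def abs_le_iff)
      then show "((\<lambda>i. indicator {- i..i} t *\<^sub>R G t) \<longlongrightarrow> G t) at_top"
        by (rule tendsto_eventually)
    qed
  qed (use measG in \<open>auto intro!: always_eventually simp: indicator_def\<close>)
  show "(LINT t|lborel. g (of_real t)) = I"
    using tendsto_unique[OF _ 1 ] 2 by (simp add: E_def G_def)
qed


text \<open>Subtracting two Cauchy kernels improves their decay to order -2, which leaves order -3/2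
  against a function that grows like a square root. The condition on \<open>norm z\<close> makes
  both distances at least half of it; the constant 8 is the 4 from these two halves times the 2 from
  sqrt 4.\<close>

lemma cauchy_kernel_bound:
  fixes f :: "complex \<Rightarrow> complex"
  assumes bound: "norm (f z) \<le> C * (1 + norm z) powr (1/2)" and z: "norm z \<ge> 2 * norm a + 2 * norm b + 1"
  shows "norm (f z * (1 / (z - a) - 1 / (z - b))) \<le> 8 * C * norm (a - b) * norm z powr (-3/2)"
proof -
  have zpos: "norm z > 0" using z norm_ge_zero[of a] norm_ge_zero[of b] by linarith
  have za: "norm (z - a) \<ge> norm z / 2" "norm (z - b) \<ge> norm z / 2"
    using z norm_triangle_ineq2[of z a] norm_triangle_ineq2[of z b] norm_ge_zero[of a] norm_ge_zero[of b] by linarith+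
  then have ne: "z \<noteq> a" "z \<noteq> b" using zpos by auto
  have "1 / (z - a) - 1 / (z - b) = (a - b) / ((z - a) * (z - b))"
    using ne by (simp add: divide_simps)
  moreover have "norm ((a - b) / ((z - a) * (z - b))) \<le> norm (a - b) / ((norm z / 2) * (norm z / 2))"
    unfolding norm_divide norm_mult using za zpos by (intro divide_left_mono mult_mono mult_pos_pos) auto
  ultimately have k: "norm (1 / (z - a) - 1 / (z - b)) \<le> norm (a - b) * 4 * norm z powr (-2)"
    using zpos by (simp add: powr_minus powr_numeral power2_eq_square field_simps)
  have C0: "C \<ge> 0"
    using order_trans[OF norm_ge_zero bound] zpos by (simp add: zero_le_mult_iff)
  have "(1 + norm z) powr (1/2) \<le> (4 * norm z) powr (1/2)"
    using z norm_ge_zero[of a] norm_ge_zero[of b] by (intro powr_mono2) linarith+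
  also have "\<dots> = 2 * norm z powr (1/2)"
    using zpos by (simp add: powr_mult powr_half_sqrt)
  finally have "norm (f z) \<le> C * (2 * norm z powr (1/2))"
    using order_trans[OF bound mult_left_mono[OF _ C0]] by blast
  then have "norm (f z * (1 / (z - a) - 1 / (z - b)))
    \<le> C * (2 * norm z powr (1/2)) * (norm (a - b) * 4 * norm z powr (-2))"
    unfolding norm_mult using k C0 by (intro mult_mono) auto
  also have "\<dots> = 8 * C * norm (a - b) * (norm z powr (1/2) * norm z powr (-2))" by (simp add: algebra_simps)
  also have "norm z powr (1/2) * norm z powr (-2) = norm z powr (-3/2)"
    by (subst powr_add[symmetric]) simp
  finally show ?thesis .
qed

text \<open>If both points lie above the axis, large rectangles enclose them and Cauchy's formula
  applies twice; if both lie below, the integrand is holomorphic on a half-plane that contains the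
  closed upper one. The strip of width \<open>d\<close> puts the line of integration inside the open
  domain of \<open>f\<close>.\<close>

lemma upper_half_plane_cauchy0:
  fixes f :: "complex \<Rightarrow> complex"
  assumes hol: "f holomorphic_on {z. Im z > - d}" and d: "d > 0"
    and bound: "\<And>z. Im z \<ge> 0 \<Longrightarrow> norm (f z) \<le> C * (1 + norm z) powr (1/2)"
    and ab: "Im a > 0 \<and> Im b > 0 \<and> I = 2 * pi * \<i> * (f a - f b) \<or> Im a < 0 \<and> Im b < 0 \<and> I = 0"
  shows "integrable lborel (\<lambda>t::real. f (of_real t) * (1 / (of_real t - a) - 1 / (of_real t - b)))" (is ?int)
    and "(LINT t|lborel. f (of_real t) * (1 / (of_real t - a) - 1 / (of_real t - b))) = I" (is ?eq)
proof -
  define g where "g = (\<lambda>z. f z * (1 / (z - a) - 1 / (z - b)))"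
  define S where "S = {a, b} \<inter> {z. Im z > 0}"
  define R0 where "R0 = 2 * norm a + 2 * norm b + 1"
  have R0: "R0 > 0" unfolding R0_def using norm_ge_zero[of a] norm_ge_zero[of b] by linarith
  have contf: "continuous_on {z. Im z \<ge> 0} f"
    by (rule holomorphic_on_imp_continuous_on, rule holomorphic_on_subset[OF hol]) (use d in auto)
  have cont: "continuous_on ({z. Im z \<ge> 0} - S) g"
    unfolding g_def using ab
    by (intro continuous_intros continuous_on_subset[OF contf]) (auto simp: S_def)
  have S: "Im z > 0 \<and> norm z < R0" if "z \<in> S" for z
    using that unfolding R0_def S_def by (auto intro!: add_nonneg_pos)
  have rect: "(g has_contour_integral I) (rectpath (of_real (-R)) (Complex R R))" if R: "R \<ge> R0" for R
  proof -
    let ?p = "rectpath (of_real (-R)) (Complex R R)"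
    have Rpos: "R > 0" using R R0 by simp
    have im: "path_image ?p \<subseteq> {z. Im z \<ge> 0}"
      by (rule order_trans[OF path_image_rectpath_subset_cbox]) (use Rpos in \<open>auto simp: in_cbox_complex_iff\<close>)
    have convex: "convex {z. Im z > - d}" "convex {z. Im z > - e}" for e
      by (simp_all add: convex_halfspace_Im_gt)
    from ab show ?thesis
    proof (elim disjE conjE)
      assume A: "Im a > 0" "Im b > 0" "I = 2 * pi * \<i> * (f a - f b)"
      have one: "((\<lambda>w. f w / (w - c)) has_contour_integral 2 * pi * \<i> * f c) ?p" if c: "c \<in> {a, b}" for c
      proof -
        have "norm c \<le> norm a + norm b" using c by auto
        then have cb: "norm c < R" using R norm_ge_zero[of a] norm_ge_zero[of b] unfolding R0_def by linarith
        have cbox: "c \<in> box (of_real (-R)) (Complex R R)"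
          using cb abs_Re_le_cmod[of c] abs_Im_le_cmod[of c] c A by (auto simp: in_box_complex_iff)
        have "((\<lambda>w. f w / (w - c)) has_contour_integral (2*pi * \<i> * winding_number ?p c * f c)) ?p"
        proof (rule Cauchy_integral_formula_convex_simple[OF convex(1) hol])
          show "c \<in> interior {z. - d < Im z}"
            using c A d by (subst interior_open) (auto simp: open_halfspace_Im_gt)
          have "c \<notin> path_image ?p"
            using cbox Rpos by (subst path_image_rectpath_cbox_minus_box) auto
          then show "path_image ?p \<subseteq> {z. - d < Im z} - {c}" using im d by auto
        qed auto
        then show ?thesis using winding_number_rectpath[OF cbox] by simp
      qed
      have "((\<lambda>w. f w / (w - a) - f w / (w - b)) has_contour_integral 2 * pi * \<i> * f a - 2 * pi * \<i> * f b) ?p"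
        by (intro has_contour_integral_diff one) auto
      moreover have "g = (\<lambda>w. f w / (w - a) - f w / (w - b))"
        by (simp add: g_def fun_eq_iff right_diff_distrib)
      ultimately show ?thesis unfolding A(3) right_diff_distrib by simp
    next
      assume A: "Im a < 0" "Im b < 0" "I = 0"
      define e where "e = min d (min (- Im a) (- Im b))"
      have "g holomorphic_on {z. Im z > - e}"
        unfolding g_def
        by (intro holomorphic_intros holomorphic_on_subset[OF hol]) (auto simp: e_def)
      then have "(g has_contour_integral 0) ?p"
        by (rule Cauchy_theorem_convex_simple) (use im A d convex in \<open>auto simp: e_def\<close>)
      then show ?thesis using A by simp
    qed
  qed
  have bd: "norm (g z) \<le> 8 * C * norm (a - b) * norm z powr (-3/2)" if "Im z \<ge> 0" "norm z \<ge> R0" for z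
    unfolding g_def by (rule cauchy_kernel_bound) (use bound that in \<open>auto simp: R0_def\<close>)
  from line_integral_eq_rect_limit[OF cont S R0 bd rect]
  show ?int ?eq unfolding g_def by auto
qed

text \<open>A vertical translation reduces the line Im z = c to the real axis; the growth bound
  survives with the factor (1 + \<bar>c\<bar>) powr (1/2).\<close>

lemma upper_half_plane_cauchy:
  fixes f :: "complex \<Rightarrow> complex"
  assumes hol: "f holomorphic_on {z. Im z > c'}" and c: "c' < c"
    and bound: "\<And>z. Im z \<ge> c \<Longrightarrow> norm (f z) \<le> C * (1 + norm z) powr (1/2)" and C: "C \<ge> 0"
    and ab: "Im a > c \<and> Im b > c \<and> I = 2 * pi * \<i> * (f a - f b) \<or> Im a < c \<and> Im b < c \<and> I = 0"
  shows "integrable lborel (\<lambda>t::real. f (Complex t c) * (1 / (Complex t c - a) - 1 / (Complex t c - b)))" (is ?int)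
    and "(LINT t|lborel. f (Complex t c) * (1 / (Complex t c - a) - 1 / (Complex t c - b))) = I" (is ?eq)
proof -
  define F where "F = (\<lambda>z. f (z + Complex 0 c))"
  have 1: "F holomorphic_on {z. Im z > - (c - c')}"
    unfolding F_def by (rule holomorphic_on_compose_gen[OF _ hol, unfolded o_def]) (auto intro!: holomorphic_intros)
  have 2: "norm (F z) \<le> (C * (1 + \<bar>c\<bar>) powr (1/2)) * (1 + norm z) powr (1/2)" if "Im z \<ge> 0" for z
  proof -
    have "norm (z + Complex 0 c) \<le> norm z + \<bar>c\<bar>"
      using norm_triangle_ineq[of z "Complex 0 c"] by (simp add: cmod_def)
    moreover have "0 \<le> \<bar>c\<bar> * norm z" by simp
    ultimately have "1 + norm (z + Complex 0 c) \<le> (1 + \<bar>c\<bar>) * (1 + norm z)"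
      unfolding distrib_left distrib_right by linarith
    then have "(1 + norm (z + Complex 0 c)) powr (1/2) \<le> ((1 + \<bar>c\<bar>) * (1 + norm z)) powr (1/2)"
      by (intro powr_mono2) auto
    moreover have "norm (F z) \<le> C * (1 + norm (z + Complex 0 c)) powr (1/2)"
      unfolding F_def by (rule bound) (use that in auto)
    ultimately have "norm (F z) \<le> C * ((1 + \<bar>c\<bar>) * (1 + norm z)) powr (1/2)"
      using C by (meson mult_left_mono order_trans)
    then show ?thesis by (simp add: powr_mult mult.assoc)
  qed
  have eq: "of_real t + Complex 0 c = Complex t c" "of_real t - (w - Complex 0 c) = Complex t c - w" for t w
    by (auto simp: complex_eq_iff)
  have 3: "F (w - Complex 0 c) = f w" for w by (simp add: F_def)
  note * = upper_half_plane_cauchy0[OF 1 _ 2, of "a - Complex 0 c" "b - Complex 0 c" I, unfolded 3 eq]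
  show ?int ?eq using * ab c by (auto simp: F_def eq)
qed

text \<open>The reflection of \<open>z\<close> to \<open>- z\<close> exchanges the half-planes. Each
  kernel changes its sign under it, hence the minus sign in front of the residues.\<close>

lemma lower_half_plane_cauchy:
  fixes f :: "complex \<Rightarrow> complex"
  assumes hol: "f holomorphic_on {z. Im z < c'}" and c: "c < c'"
    and bound: "\<And>z. Im z \<le> c \<Longrightarrow> norm (f z) \<le> C * (1 + norm z) powr (1/2)" and C: "C \<ge> 0"
    and ab: "Im a < c \<and> Im b < c \<and> I = - (2 * pi * \<i> * (f a - f b)) \<or> Im a > c \<and> Im b > c \<and> I = 0"
  shows "integrable lborel (\<lambda>t::real. f (Complex t c) * (1 / (Complex t c - a) - 1 / (Complex t c - b)))" (is ?int)
    and "(LINT t|lborel. f (Complex t c) * (1 / (Complex t c - a) - 1 / (Complex t c - b))) = I" (is ?eq)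
proof -
  define F where "F = (\<lambda>z. f (- z))"
  define h where "h = (\<lambda>t::real. f (Complex t c) * (1 / (Complex t c - a) - 1 / (Complex t c - b)))"
  have 1: "F holomorphic_on {z. Im z > - c'}"
    unfolding F_def by (rule holomorphic_on_compose_gen[OF _ hol, unfolded o_def]) (auto intro!: holomorphic_intros)
  have 2: "norm (F z) \<le> C * (1 + norm z) powr (1/2)" if "Im z \<ge> - c" for z
    using bound[of "- z"] that by (simp add: F_def)
  have eq: "- Complex t (- c) = Complex (- t) c" for t by (simp add: complex_eq_iff)
  have k: "F (Complex t (-c)) * (1 / (Complex t (-c) - (-a)) - 1 / (Complex t (-c) - (-b))) = - h (- t)" for t
  proof -
    have "Complex t (-c) - (-w) = - (Complex (-t) c - w)" for w by (simp add: complex_eq_iff)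
    then show ?thesis by (simp only: F_def h_def eq minus_divide_right[symmetric]) (simp add: algebra_simps)
  qed
  have 3: "F (- w) = f w" for w by (simp add: F_def)
  note * = upper_half_plane_cauchy[where c="- c" and a="- a" and b="- b" and I="- I", OF 1 _ 2 C, unfolded k 3]
  have "integrable lborel (\<lambda>t. - h (- t))" "(LINT t|lborel. - h (- t)) = - I"
    using * ab c by auto
  then show ?int ?eq
    using lborel_integrable_real_affine_iff[of "-1" h 0] lborel_integral_real_affine[of "-1" h 0]
    unfolding h_def[symmetric] by auto
qed

subsection \<open>Parameter integrals and analyticity in two variables\<close>

text \<open>Dominated convergence along sequences, which suffice in a first countable space. The
  majorant may depend on the point, because a Cauchy kernel has no uniform one when its pole can
  approach the line of integration.\<close>

lemma continuous_on_param_lebesgue_integral: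
  fixes f :: "'b::first_countable_topology \<Rightarrow> 'a \<Rightarrow> complex"
  assumes cont: "\<And>t. t \<in> space M \<Longrightarrow> continuous_on S (\<lambda>p. f p t)"
    and meas: "\<And>p. p \<in> S \<Longrightarrow> f p \<in> borel_measurable M"
    and dom: "\<And>p. p \<in> S \<Longrightarrow> \<exists>V g. open V \<and> p \<in> V \<and> integrable M g \<and>
               (\<forall>q\<in>V \<inter> S. \<forall>t\<in>space M. norm (f q t) \<le> g t)"
  shows "continuous_on S (\<lambda>p. LINT t|M. f p t)"
  unfolding continuous_on_def
proof
  fix p assume p: "p \<in> S"
  obtain V g where V: "open V" "p \<in> V" "integrable M g"
    and g: "\<And>q t. q \<in> V \<Longrightarrow> q \<in> S \<Longrightarrow> t \<in> space M \<Longrightarrow> norm (f q t) \<le> g t"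
    using dom[OF p] by blast
  have "((\<lambda>p. LINT t|M. f p t) \<longlongrightarrow> (LINT t|M. f p t)) (at p within V \<inter> S)"
    unfolding tendsto_at_iff_sequentially
  proof (intro allI impI)
    fix X assume X: "\<forall>i::nat. X i \<in> V \<inter> S - {p}" "X \<longlonglongrightarrow> p"
    show "((\<lambda>p. LINT t|M. f p t) \<circ> X) \<longlonglongrightarrow> (LINT t|M. f p t)"
      unfolding o_def
    proof (rule integral_dominated_convergence[where w=g])
      show "AE t in M. (\<lambda>i. f (X i) t) \<longlonglongrightarrow> f p t"
      proof (rule AE_I2)
        fix t assume "t \<in> space M"
        from cont[OF this] p have "((\<lambda>p. f p t) \<longlongrightarrow> f p t) (at p within S)"
          by (auto simp: continuous_on_def)
        then show "(\<lambda>i. f (X i) t) \<longlonglongrightarrow> f p t"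
          using X unfolding tendsto_at_iff_sequentially o_def by auto
      qed
    qed (use X V g meas p in auto)
  qed
  then show "((\<lambda>p. LINT t|M. f p t) \<longlongrightarrow> (LINT t|M. f p t)) (at p within S)"
    using at_within_nhd[of p V "V \<inter> S" S] V by (simp add: Int_commute Int_left_commute)
qed

text \<open>Cauchy's inequality turns the majorant \<open>g\<close> of the integrand into the
  majorant \<open>g t / r\<close> of its difference quotients, so that a bound on the function alone
  permits differentiation under the integral.\<close>

lemma holomorphic_on_param_lebesgue_integral:
  fixes f :: "complex \<Rightarrow> 'a \<Rightarrow> complex"
  assumes S: "open S" and hol: "\<And>t. t \<in> space M \<Longrightarrow> (\<lambda>z. f z t) holomorphic_on S"
    and meas: "\<And>z. z \<in> S \<Longrightarrow> f z \<in> borel_measurable M"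
    and dom: "\<And>z. z \<in> S \<Longrightarrow> \<exists>V g. open V \<and> z \<in> V \<and> integrable M g \<and>
               (\<forall>q\<in>V \<inter> S. \<forall>t\<in>space M. norm (f q t) \<le> g t)"
  shows "(\<lambda>z. LINT t|M. f z t) holomorphic_on S"
  unfolding holomorphic_on_open[OF S]
proof
  fix z assume z: "z \<in> S"
  obtain V g where V: "open V" "z \<in> V" "integrable M g"
    and g: "\<And>q t. q \<in> V \<Longrightarrow> q \<in> S \<Longrightarrow> t \<in> space M \<Longrightarrow> norm (f q t) \<le> g t"
    using dom[OF z] by blast
  obtain e where e: "e > 0" "ball z e \<subseteq> V \<inter> S"
    using V S z by (meson IntI open_Int open_contains_ball)
  \<comment> \<open>With a third of \<open>e\<close>, a closed disc of radius \<open>r\<close>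
    around any point of \<open>ball z r\<close> still lies in \<open>ball z e\<close>, where
    \<open>g\<close> dominates.\<close>
  define r where "r = e / 3"
  have r: "r > 0" using e by (simp add: r_def)
  have sub: "cball w r \<subseteq> V \<inter> S" if "w \<in> ball z r" for w
  proof
    fix v assume "v \<in> cball w r"
    then have "dist z v < e" using that dist_triangle[of z v w] r unfolding r_def by auto
    then show "v \<in> V \<inter> S" using e by auto
  qed
  have int: "integrable M (f w)" if "w \<in> V" "w \<in> S" for w
    by (rule Bochner_Integration.integrable_bound[OF V(3)])
       (use meas that g in \<open>auto intro!: AE_I2 order_trans[OF g]\<close>)
  define D where "D = (\<lambda>t. deriv (\<lambda>z. f z t) z)"
  define Q where "Q = (\<lambda>h t. (f (z + h) t - f z t) / h)"
  have der: "((\<lambda>z. f z t) has_field_derivative deriv (\<lambda>z. f z t) w) (at w)"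
    if "t \<in> space M" "w \<in> S" for t w
    using hol[OF that(1)] S that(2) by (rule holomorphic_derivI)
  have Q: "norm (Q h t) \<le> g t / r" if t: "t \<in> space M" and h: "h \<noteq> 0" "h \<in> ball 0 r" for h t
  proof -
    have "norm (f (z + h) t - f z t) \<le> g t / r * norm (z + h - z)"
    proof (rule field_differentiable_bound[of "ball z r" "\<lambda>z. f z t" "\<lambda>w. deriv (\<lambda>z. f z t) w"])
      fix w assume w: "w \<in> ball z r"
      then have wS: "w \<in> S" using sub[OF w] r by auto
      show "((\<lambda>z. f z t) has_field_derivative deriv (\<lambda>z. f z t) w) (at w within ball z r)"
        using der[OF t wS] has_field_derivative_at_within by blast
      have "norm ((deriv ^^ 1) (\<lambda>z. f z t) w) \<le> fact 1 * g t / r ^ 1"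
        by (rule Cauchy_inequality)
          (use sub[OF w] r g[OF _ _ t] in \<open>auto intro!: holomorphic_on_imp_continuous_on holomorphic_on_subset[OF hol[OF t]]
            simp: dist_norm subset_iff\<close>)
      then show "norm (deriv (\<lambda>z. f z t) w) \<le> g t / r" by simp
    qed (use h r in \<open>auto simp: dist_norm\<close>)
    then show ?thesis using h using r by (simp add: Q_def norm_divide pos_divide_le_eq)
  qed
  have "((\<lambda>h. LINT t|M. Q h t) \<longlongrightarrow> (LINT t|M. D t)) (at 0 within ball 0 r)"
    unfolding tendsto_at_iff_sequentially
  proof (intro allI impI)
    fix X :: "nat \<Rightarrow> complex" assume X: "\<forall>i. (X i :: complex) \<in> ball 0 r - {0}" "X \<longlonglongrightarrow> 0"
    have lim: "(\<lambda>i. Q (X i) t) \<longlonglongrightarrow> D t" if t: "t \<in> space M" for t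
    proof -
      have "((\<lambda>h. Q h t) \<longlongrightarrow> D t) (at 0)"
        using der[OF t z] unfolding Q_def D_def by (simp add: DERIV_def)
      then show ?thesis using X unfolding tendsto_at_iff_sequentially o_def by auto
    qed
    have XS: "z + X i \<in> S" "z + X i \<in> V" for i
    proof -
      have "z + X i \<in> ball z r" using X(1)[rule_format, of i] by (simp add: dist_norm)
      from sub[OF this] r show "z + X i \<in> S" "z + X i \<in> V" by auto
    qed
    have Qm: "Q (X i) \<in> borel_measurable M" for i
      unfolding Q_def using meas z XS by (auto intro!: borel_measurable_divide borel_measurable_diff)
    have Dm: "D \<in> borel_measurable M"
      by (rule borel_measurable_LIMSEQ_metric[of "\<lambda>i. Q (X i)"]) (use Qm lim in auto)
    show "((\<lambda>h. LINT t|M. Q h t) \<circ> X) \<longlonglongrightarrow> (LINT t|M. D t)"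
      unfolding o_def
    proof (rule integral_dominated_convergence[where w="\<lambda>t. g t / r"])
      show "integrable M (\<lambda>t. g t / r)" using V(3) by simp
      show "AE t in M. (\<lambda>i. Q (X i) t) \<longlonglongrightarrow> D t" using lim by (intro AE_I2)
      show "AE t in M. norm (Q (X i) t) \<le> g t / r" for i
        using X(1) by (intro AE_I2 Q) auto
      show "D \<in> borel_measurable M" by (rule Dm)
      show "Q (X i) \<in> borel_measurable M" for i by (rule Qm)
    qed
  qed
  then have lim: "((\<lambda>h. LINT t|M. Q h t) \<longlongrightarrow> (LINT t|M. D t)) (at 0)"
    using at_within_open[of "0::complex" "ball 0 r"] r by simp
  have ev: "\<forall>\<^sub>F h in at 0. (LINT t|M. Q h t) = ((LINT t|M. f (z + h) t) - (LINT t|M. f z t)) / h"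
  proof -
    have "\<forall>\<^sub>F h in at 0. h \<in> ball (0::complex) r"
      using r by (intro eventually_at_in_open') auto
    then show ?thesis
    proof eventually_elim
      case (elim h)
      then have "z + h \<in> ball z r" by (auto simp: dist_norm)
      from sub[OF this] r have "z + h \<in> V" "z + h \<in> S" by auto
      then show ?case using int V z by (simp add: Q_def)
    qed
  qed
  have "((\<lambda>h. ((LINT t|M. f (z + h) t) - (LINT t|M. f z t)) / h) \<longlongrightarrow> (LINT t|M. D t)) (at 0)"
    using Lim_transform_eventually[OF lim ev] .
  then show "\<exists>f'. ((\<lambda>z. LINT t|M. f z t) has_field_derivative f') (at z)"
    unfolding DERIV_def by blast
qed

text \<open>Osgood's lemma. The continuity of the partial derivative in the second variable comes from
  its Cauchy integral over a fixed circle.\<close>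

lemma holo2_on_separately:
  fixes f :: "complex \<times> complex \<Rightarrow> complex"
  assumes S: "open S" and cont: "continuous_on S f"
    and fst: "\<And>z w. (z, w) \<in> S \<Longrightarrow> (\<lambda>x. f (x, w)) field_differentiable at z"
    and snd: "\<And>z w. (z, w) \<in> S \<Longrightarrow> (\<lambda>y. f (z, y)) field_differentiable at w"
  shows "holo2_on f S"
  unfolding holo2_on_def
proof
  fix p assume p: "p \<in> S"
  obtain z0 w0 where p0: "p = (z0, w0)" by (cases p)
  obtain A B where AB: "open A" "open B" "z0 \<in> A" "w0 \<in> B" "A \<times> B \<subseteq> S"
    using S p unfolding p0 by (metis open_prod_elim SigmaE2)
  obtain e1 e2 where e: "e1 > 0" "cball z0 e1 \<subseteq> A" "e2 > 0" "cball w0 e2 \<subseteq> B"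
    using AB by (meson open_contains_cball)
  \<comment> \<open>Halving the radius of \<open>Y\<close> keeps its points away from the circle of
    radius \<open>e2\<close>, so that the Cauchy kernel in \<open>D\<close> is jointly
    continuous.\<close>
  define X Y where "X = ball z0 e1" and "Y = ball w0 (e2/2)"
  have XY: "X \<subseteq> A" "cball w0 e2 \<subseteq> B" using e by (auto simp: X_def)
  define D where "D = (\<lambda>x y. integral {0..1} (\<lambda>t. f (x, circlepath w0 e2 t) / (circlepath w0 e2 t - y)^2
     * (2 * pi * \<i> * e2 * exp (2 * of_real pi * \<i> * t))) / (2 * of_real pi * \<i>))"
  have holy: "(\<lambda>y. f (x, y)) holomorphic_on B" if "x \<in> X" for x
    unfolding holomorphic_on_def using that XY AB snd
    by (blast intro: field_differentiable_at_within)
  have D: "((\<lambda>y. f (x, y)) has_field_derivative D x y) (at y)" if x: "x \<in> X" and y: "y \<in> Y" for x y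
  proof -
    have "((\<lambda>y. f (x, y)) has_field_derivative (1 / (2 * of_real pi * \<i>) * contour_integral(circlepath w0 e2) (\<lambda>u. f (x, u) / (u-y)^2))) (at y)"
    proof (rule Cauchy_derivative_integral_circlepath)
      show "y \<in> ball w0 e2" using y e by (auto simp: Y_def)
    qed (use XY in \<open>auto intro!: holomorphic_on_imp_continuous_on holomorphic_on_subset[OF holy[OF x]]\<close>)
    then show ?thesis
      unfolding D_def contour_integral_integral vector_derivative_circlepath by simp
  qed
  have contf: "continuous_on (X \<times> cball w0 e2) f"
    by (rule continuous_on_subset[OF cont]) (use AB XY in auto)
  have circ: "circlepath w0 e2 t \<in> sphere w0 e2" if "t \<in> {0..1}" for t
    using path_image_circlepath[of w0 e2] that e by (auto simp: path_image_def)
  have ne: "circlepath w0 e2 t \<noteq> y" if "t \<in> {0..1}" "y \<in> Y" for t y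
    using circ[OF that(1)] that(2) e by (auto simp: Y_def)
  have contc: "continuous_on A' (circlepath w0 e2)" for A'
    unfolding circlepath by (intro continuous_intros)
  have contD: "continuous_on (X \<times> Y) (\<lambda>(x, y). D x y)"
  proof -
    have 1: "continuous_on ((X \<times> Y) \<times> {0..1}) (\<lambda>q. f (fst (fst q), circlepath w0 e2 (snd q)))"
    proof (rule continuous_on_compose2[OF contf])
      show "continuous_on ((X \<times> Y) \<times> {0..1}) (\<lambda>q. (fst (fst q), circlepath w0 e2 (snd q)))"
        by (intro continuous_intros continuous_on_compose2[OF contc[of UNIV]]) auto
      show "(\<lambda>q. (fst (fst q), circlepath w0 e2 (snd q))) ` ((X \<times> Y) \<times> {0..1}) \<subseteq> X \<times> cball w0 e2"
        using circ sphere_cball by fastforce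
    qed
    have "continuous_on ((X \<times> Y) \<times> cbox 0 1) (\<lambda>(xy, t). f (fst xy, circlepath w0 e2 t) / (circlepath w0 e2 t - snd xy)^2
     * (2 * pi * \<i> * e2 * exp (2 * of_real pi * \<i> * of_real t)))"
      unfolding case_prod_beta
      by (intro continuous_intros 1[unfolded cbox_interval[symmetric]] continuous_on_compose2[OF contc[of UNIV]]) (use ne in auto)
    then have "continuous_on (X \<times> Y) (\<lambda>xy. integral (cbox 0 1) (\<lambda>t. f (fst xy, circlepath w0 e2 t) / (circlepath w0 e2 t - snd xy)^2
     * (2 * pi * \<i> * e2 * exp (2 * of_real pi * \<i> * of_real t))))"
      by (rule integral_continuous_on_param)
    then show ?thesis
      unfolding D_def case_prod_beta by (auto intro!: continuous_intros simp: cbox_interval)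
  qed
  obtain a where a: "((\<lambda>x. f (x, w0)) has_field_derivative a) (at z0)"
    using fst p unfolding p0 field_differentiable_def by blast
  have in_XY: "(z0, w0) \<in> X \<times> Y" using e by (auto simp: X_def Y_def)
  have "((\<lambda>(x, y). f (x, y)) has_derivative (\<lambda>(tx, ty). a * tx + blinfun_mult_right (D z0 w0) ty)) (at (z0, w0) within X \<times> Y)"
  proof (rule has_derivative_partialsI)
    show "((\<lambda>x. f (x, w0)) has_derivative (*) a) (at z0 within X)"
      using a by (simp add: has_field_derivative_def has_derivative_at_withinI)
    show "((\<lambda>y. f (x, y)) has_derivative blinfun_apply (blinfun_mult_right (D x y))) (at y within Y)"
      if "x \<in> X" "y \<in> Y" for x y
      using D[OF that] by (auto simp: has_field_derivative_def intro: has_derivative_at_withinI)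
    have "continuous_on (X \<times> Y) (\<lambda>(x, y). blinfun_mult_right (D x y))"
      using bounded_linear.continuous_on[OF bounded_linear_blinfun_mult_right contD]
      by (simp add: case_prod_unfold)
    then show "continuous (at (z0, w0) within X \<times> Y) (\<lambda>(x, y). blinfun_mult_right (D x y))"
      using in_XY by (auto simp: continuous_on_eq_continuous_within)
  qed (use in_XY in \<open>auto simp: Y_def\<close>)
  moreover have "open (X \<times> Y)" by (auto simp: X_def Y_def intro: open_Times)
  ultimately have "(f has_derivative (\<lambda>(tx, ty). a * tx + D z0 w0 * ty)) (at p)"
    unfolding p0 using at_within_open[OF in_XY] by simp
  then have "(f has_derivative (\<lambda>h. a * fst h + D z0 w0 * snd h)) (at p)"
    by (simp add: case_prod_unfold)
  then show "\<exists>a b. (f has_derivative (\<lambda>h. a * fst h + b * snd h)) (at p)" by blast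
qed

subsection \<open>Square roots\<close>

declare csqrt.simps [simp del]

lemma csqrt_Im_pos:
  assumes "Im z > 0" shows "Re (csqrt z) > 0" "Im (csqrt z) > 0"
proof -
  have "Im ((csqrt z)\<^sup>2) > 0" using assms by simp
  then have "Re (csqrt z) * Im (csqrt z) > 0" by (simp add: power2_eq_square mult.commute)
  then show "Re (csqrt z) > 0" "Im (csqrt z) > 0"
    using Re_csqrt[of z] by (auto simp: zero_less_mult_iff)
qed

lemma not_nonpos_Reals_if_Im_pos: "Im z > 0 \<Longrightarrow> z \<notin> \<real>\<^sub>\<le>\<^sub>0"
  by (auto simp: complex_nonpos_Reals_iff)

text \<open>Rotating by a quarter turn moves the upper half-plane away from the branch cut.\<close>

lemma continuous_on_csqrt_upper: "continuous_on {z. Im z \<ge> 0} csqrt"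
proof -
  define c where "c = csqrt \<i>"
  have c2: "c\<^sup>2 = \<i>" unfolding c_def by (rule power2_csqrt)
  have c: "c = Complex (1 / sqrt 2) (1 / sqrt 2)"
    unfolding c_def by (simp add: complex_eq_iff)
  \<comment> \<open>The number \<open>c\<close> is the eighth root of unity in the open first
    quadrant. For Im z \<ge> 0 the root of \<open>- \<i> * z\<close> lies in the sector where
    \<bar>Im\<bar> \<le> Re, and \<open>c\<close> turns this sector onto the closed first
    quadrant.\<close>
  have eq: "csqrt z = c * csqrt (- \<i> * z)" if z: "Im z \<ge> 0" for z
  proof (rule csqrt_unique)
    let ?d = "csqrt (- \<i> * z)"
    show "(c * ?d)\<^sup>2 = z" by (simp add: power_mult_distrib c2)
    have "Re (?d\<^sup>2) \<ge> 0" using z by simp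
    then have "(Im ?d)\<^sup>2 \<le> (Re ?d)\<^sup>2" by (simp add: power2_eq_square)
    then have d: "\<bar>Im ?d\<bar> \<le> Re ?d" using Re_csqrt[of "- \<i> * z"] by (simp add: abs_le_square_iff[symmetric])
    have "Re (c * ?d) = (Re ?d - Im ?d) / sqrt 2" "Im (c * ?d) = (Re ?d + Im ?d) / sqrt 2"
      by (simp_all add: c diff_divide_distrib add_divide_distrib add.commute)
    then show "0 < Re (c * ?d) \<or> Re (c * ?d) = 0 \<and> 0 \<le> Im (c * ?d)"
      using d by (auto simp: abs_le_iff)
  qed
  show ?thesis
    unfolding continuous_on_eq_continuous_within
  proof
    fix z :: complex assume z: "z \<in> {z. Im z \<ge> 0}"
    show "continuous (at z within {z. Im z \<ge> 0}) csqrt"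
    proof (cases "z = 0")
      case True
      have "((\<lambda>w::complex. sqrt (norm w)) \<longlongrightarrow> sqrt (norm (0::complex))) (at 0 within {z. Im z \<ge> 0})"
        by (intro tendsto_intros)
      then show ?thesis
        unfolding True continuous_within by (simp add: tendsto_norm_zero_iff[of csqrt, symmetric])
    next
      case False
      have "- \<i> * z \<notin> \<real>\<^sub>\<le>\<^sub>0" using z False by (auto simp: complex_nonpos_Reals_iff complex_eq_iff)
      then have "continuous (at z within {z. Im z \<ge> 0}) (\<lambda>z. c * csqrt (- \<i> * z))"
        by (intro continuous_intros continuous_within_compose3[OF continuous_at_csqrt]) auto
      then show ?thesis
        by (rule continuous_transform_within[where \<delta>=1]) (use z eq in auto)
    qed
  qed
qed

lemma sqrt_up_square [simp]: "(sqrt_up w)\<^sup>2 = w"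
  by (simp add: sqrt_up_def power_mult_distrib)

lemma Im_sqrt_up_nonneg: "Im (sqrt_up w) \<ge> 0"
  by (simp add: sqrt_up_def Re_csqrt)

lemma sqrt_up_unique:
  assumes "s\<^sup>2 = w" "Im s > 0" shows "sqrt_up w = s"
proof -
  have "csqrt (- w) = - \<i> * s"
    by (rule csqrt_unique) (use assms in \<open>auto simp: power_mult_distrib\<close>)
  then show ?thesis by (simp add: sqrt_up_def)
qed

lemma Im_sqrt_up_pos_iff: "Im (sqrt_up w) > 0 \<longleftrightarrow> w \<notin> \<real>\<^sub>\<ge>\<^sub>0"
proof -
  have "w \<in> \<real>\<^sub>\<ge>\<^sub>0" if "Im (sqrt_up w) = 0"
  proof -
    have "w = of_real ((Re (sqrt_up w))\<^sup>2)"
      using that sqrt_up_square[of w] by (metis complex_is_Real_iff of_real_Re of_real_power)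
    then show ?thesis by (metis nonneg_Reals_of_real_iff zero_le_power2)
  qed
  moreover have "Im (sqrt_up w) = 0" if "w \<in> \<real>\<^sub>\<ge>\<^sub>0"
  proof -
    obtain r where r: "w = of_real r" "r \<ge> 0" using \<open>w \<in> \<real>\<^sub>\<ge>\<^sub>0\<close> nonneg_Reals_cases by blast
    then have "(sqrt_up w)\<^sup>2 = (of_real (sqrt r))\<^sup>2" by (simp flip: of_real_power)
    then have "sqrt_up w = of_real (sqrt r) \<or> sqrt_up w = - of_real (sqrt r)" by (simp only: power2_eq_iff)
    then show ?thesis by auto
  qed
  ultimately show ?thesis using Im_sqrt_up_nonneg[of w] by fastforce
qed

lemma holomorphic_on_sqrt_up [holomorphic_intros]:
  assumes "f holomorphic_on A" "\<And>z. z \<in> A \<Longrightarrow> f z \<notin> \<real>\<^sub>\<ge>\<^sub>0"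
  shows "(\<lambda>z. sqrt_up (f z)) holomorphic_on A"
  unfolding sqrt_up_def using assms
  by (intro holomorphic_intros holomorphic_on_csqrt') (auto simp: complex_nonpos_Reals_iff complex_nonneg_Reals_iff)

lemma inner_root_square: "(inner_root k z)\<^sup>2 = k\<^sup>2 - z\<^sup>2"
  by (simp add: inner_root_def)

lemma Im_inner_root_nonneg: "Im (inner_root k z) \<ge> 0"
  by (simp add: inner_root_def Im_sqrt_up_nonneg)

lemma inner_root_even: "inner_root k (- z) = inner_root k z"
  by (simp add: inner_root_def)

text \<open>The relation s^2 + z^2 = k^2 is symmetric: a real root \<open>s\<close> at
  \<open>z\<close> makes \<open>- z\<close> the upper root of k^2 - s^2, which is how the cut is
  parametrized. The curve is thereby replaced by two strict inequalities.\<close>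

lemma H_minus_iff: "z \<in> H_minus k \<longleftrightarrow> Im z < 0 \<and> Im (inner_root k z) > 0"
proof -
  have "z \<in> h_minus k \<longleftrightarrow> Im (inner_root k z) = 0" if z: "Im z < 0"
  proof
    assume "z \<in> h_minus k"
    then obtain \<tau> :: real where "z = - sqrt_up (k\<^sup>2 - (of_real \<tau>)\<^sup>2)" by (auto simp: h_minus_def)
    then have "z\<^sup>2 = k\<^sup>2 - (of_real \<tau>)\<^sup>2" by simp
    then have "(inner_root k z)\<^sup>2 = (of_real \<tau>)\<^sup>2" by (simp add: inner_root_square)
    then have "inner_root k z = of_real \<tau> \<or> inner_root k z = - of_real \<tau>" by (simp only: power2_eq_iff)
    then show "Im (inner_root k z) = 0" by auto
  next
    assume "Im (inner_root k z) = 0"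
    then have b: "inner_root k z = of_real (Re (inner_root k z))" by (simp add: complex_eq_iff)
    have "sqrt_up (k\<^sup>2 - (of_real (Re (inner_root k z)))\<^sup>2) = - z"
      by (rule sqrt_up_unique) (use z in \<open>simp_all add: b[symmetric] inner_root_square\<close>)
    then show "z \<in> h_minus k" by (auto simp: h_minus_def intro!: image_eqI[where x="Re (inner_root k z)"])
  qed
  then show ?thesis using Im_inner_root_nonneg[of k z] by (auto simp: H_minus_def less_le)
qed

lemma minus_h_plus: "- z \<in> h_minus k \<longleftrightarrow> z \<in> h_plus k"
  by (auto simp: h_minus_def h_plus_def image_iff)

text \<open>Write p + i q for the inner root, t + i y for \<open>z\<close>, and r = q^2 + y^2. The
  relation between them gives p^2 + t^2 = 1 + r and p q + t y = \<epsilon> / 2, so Cauchy-Schwarz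
  yields \<epsilon>^2 / 4 \<le> (1 + r) r; together with r \<le> \<epsilon>^2 / 8 this contradicts 1
  + r < 2. Thus the inner root stays away from the real axis while \<open>z\<close> is close to
  it.\<close>

lemma inner_root_strip:
  assumes "k\<^sup>2 = 1 + \<i> * of_real \<epsilon>" "0 < \<epsilon>" "\<epsilon> < 1"
  shows "(Im (inner_root k z))\<^sup>2 + (Im z)\<^sup>2 > \<epsilon>\<^sup>2 / 8"
proof (rule ccontr)
  define p q t y where "p = Re (inner_root k z)" and "q = Im (inner_root k z)" and "t = Re z" and "y = Im z"
  define r where "r = q\<^sup>2 + y\<^sup>2"
  assume "\<not> ?thesis"
  then have r: "r \<le> \<epsilon>\<^sup>2 / 8" by (simp add: r_def q_def y_def)
  have "(inner_root k z)\<^sup>2 + z\<^sup>2 = 1 + \<i> * of_real \<epsilon>" by (simp add: inner_root_square assms)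
  then have "p\<^sup>2 - q\<^sup>2 + (t\<^sup>2 - y\<^sup>2) = 1" "2 * (p * q) + 2 * (t * y) = \<epsilon>"
    by (auto simp: complex_eq_iff p_def q_def t_def y_def power2_eq_square)
  then have 1: "p\<^sup>2 + t\<^sup>2 = 1 + r" "p * q + t * y = \<epsilon> / 2" by (auto simp: r_def)
  have "(p * q + t * y)\<^sup>2 + (p * y - t * q)\<^sup>2 = (p\<^sup>2 + t\<^sup>2) * r"
    by (simp add: r_def power2_eq_square algebra_simps)
  then have "(\<epsilon> / 2)\<^sup>2 \<le> (1 + r) * r" unfolding 1 using zero_le_power2[of "p * y - t * q"] by linarith
  also have "\<dots> \<le> (1 + 1) * (\<epsilon>\<^sup>2 / 8)"
  proof (rule mult_mono)
    have "\<epsilon>\<^sup>2 \<le> 1" using assms by (simp add: power_le_one)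
    then show "1 + r \<le> 1 + 1" using r by linarith
  qed (use r in \<open>auto simp: r_def\<close>)
  finally have e1: "(1 + r) * r = \<epsilon>\<^sup>2 / 4" "(\<epsilon>/2)\<^sup>2 = \<epsilon>\<^sup>2/4" using \<open>(\<epsilon> / 2)\<^sup>2 \<le> (1 + r) * r\<close> \<open>(1 + r) * r \<le> (1 + 1) * (\<epsilon>\<^sup>2 / 8)\<close>
    by (auto simp: power2_eq_square)
  have "\<epsilon>\<^sup>2 < 1" "\<epsilon>\<^sup>2 > 0" using assms by (simp_all add: power_less_one_iff abs_square_less_1)
  then have "1 + r < 2" using r by linarith
  moreover have "r > 0" using e1 \<open>\<epsilon>\<^sup>2 > 0\<close> by (cases "r = 0") (auto simp: r_def less_le)
  ultimately have "(1 + r) * r < 2 * r" by (simp add: mult_strict_right_mono)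
  then show False using r e1 by linarith
qed

subsection \<open>Integrals over the half-line and the plane\<close>

lemma integrable_exp_abs:
  assumes "c > 0"
  shows "integrable lborel (\<lambda>x::real. exp (- c * \<bar>x\<bar>))"
proof -
  define h where "h = (\<lambda>x::real. indicator {0..} x * exp (- c * x))"
  have "integrable lborel h"
  proof (rule integrableI_nonneg)
    show "h \<in> borel_measurable lborel" unfolding h_def by measurable
    show "AE x in lborel. 0 \<le> h x" unfolding h_def by auto
    have "integral\<^sup>N lborel (\<lambda>x. indicator {0..} x * exp (- c * x)) = ennreal (exp (- c * 0) / c)"
      by (rule nn_integral_has_integral_lebesgue) (use has_integral_exp_minus_to_infinity[of c 0] assms in auto)
    then show "(\<integral>\<^sup>+ x. ennreal (h x) \<partial>lborel) < \<infinity>"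
      unfolding h_def by simp
  qed
  from this lborel_integrable_real_affine[OF this, of "-1" 0]
  have "integrable lborel (\<lambda>t. h t + h (- t))"
    by (intro Bochner_Integration.integrable_add) auto
  then show ?thesis
  proof (rule Bochner_Integration.integrable_bound)
    show "AE t in lborel. norm (exp (- c * \<bar>t\<bar>)) \<le> norm (h t + h (- t))"
      by (auto simp: h_def indicator_def)
  qed auto
qed

lemma integral_exp_half_line:
  fixes a :: complex
  assumes a: "Im a > 0"
  shows "integrable lborel (\<lambda>x::real. indicator {0<..} x *\<^sub>R exp (\<i> * (a * of_real x)))" (is "integrable _ ?f")
    and "(LINT x|lborel. indicator {0<..} x *\<^sub>R exp (\<i> * (a * of_real x))) = \<i> / a"
proof -
  show int: "integrable lborel ?f"
  proof (rule Bochner_Integration.integrable_bound[OF integrable_exp_abs[OF a]])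
    show "AE x in lborel. norm (?f x) \<le> norm (exp (- Im a * \<bar>x\<bar>))"
      by (auto simp: indicator_def)
  qed measurable
  have eq: "(LINT x|lborel. indicator {..y} x *\<^sub>R ?f x) = (exp (\<i> * (a * of_real y)) - 1) / (\<i> * a)" if y: "y > 0" for y
  proof -
    have a0: "a \<noteq> 0" using a by auto
    have "((\<lambda>x. exp (\<i> * (a * of_real x))) has_integral (exp (\<i> * (a * of_real y)) / (\<i> * a) - exp (\<i> * (a * of_real 0)) / (\<i> * a))) {0..y}"
      by (rule fundamental_theorem_of_calculus)
         (use y a0 in \<open>auto intro!: derivative_eq_intros has_vector_derivative_real_field simp: field_simps\<close>)
    then have hi: "((\<lambda>x. exp (\<i> * (a * of_real x))) has_integral (exp (\<i> * (a * of_real y)) - 1) / (\<i> * a)) {0..y}"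
      by (simp add: diff_divide_distrib)
    have "set_integrable lborel {0..y} (\<lambda>x. exp (\<i> * (a * of_real x)))"
      by (intro borel_integrable_atLeastAtMost' continuous_intros)
    from set_borel_integral_eq_integral(2)[OF this]
    have "(LINT x|lborel. indicator {0..y} x *\<^sub>R exp (\<i> * (a * of_real x))) = (exp (\<i> * (a * of_real y)) - 1) / (\<i> * a)"
      using hi by (simp add: set_lebesgue_integral_def integral_unique)
    moreover have "(LINT x|lborel. indicator {..y} x *\<^sub>R ?f x) = (LINT x|lborel. indicator {0..y} x *\<^sub>R exp (\<i> * (a * of_real x)))"
    proof (rule integral_cong_AE)
      show "AE x in lborel. indicator {..y} x *\<^sub>R ?f x = indicator {0..y} x *\<^sub>R exp (\<i> * (a * of_real x))"
        using AE_lborel_singleton[of 0] by eventually_elim (auto simp: indicator_def)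
    qed measurable
    ultimately show ?thesis by simp
  qed
  have "((\<lambda>y. norm (exp (\<i> * (a * of_real y)))) \<longlongrightarrow> 0) at_top"
    using a by (simp, real_asymp)
  then have "((\<lambda>y. exp (\<i> * (a * of_real y))) \<longlongrightarrow> 0) at_top" by (rule tendsto_norm_zero_cancel)
  then have "((\<lambda>y. (exp (\<i> * (a * of_real y)) - 1) / (\<i> * a)) \<longlongrightarrow> (0 - 1) / (\<i> * a)) at_top"
    using a by (intro tendsto_intros) auto
  moreover have "((\<lambda>y. LINT x|lborel. indicator {..y} x *\<^sub>R ?f x) \<longlongrightarrow> (LINT x|lborel. ?f x)) at_top"
    by (rule tendsto_integral_at_top) (use int in auto)
  then have "((\<lambda>y. (exp (\<i> * (a * of_real y)) - 1) / (\<i> * a)) \<longlongrightarrow> (LINT x|lborel. ?f x)) at_top"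
    by (rule Lim_transform_eventually[OF _ eventually_mono[OF eventually_gt_at_top[of 0] eq]])
  ultimately have "(LINT x|lborel. ?f x) = (0 - 1) / (\<i> * a)"
    using tendsto_unique trivial_limit_at_top_linorder by blast
  moreover have "a \<noteq> 0" using a by auto
  then have "(0 - 1) / (\<i> * a) = \<i> / a"
    by (subst frac_eq_eq) (simp_all flip: mult.assoc)
  ultimately show "(LINT x|lborel. ?f x) = \<i> / a" by metis
qed

lemma integral_lborel_product:
  fixes f g :: "real \<Rightarrow> 'b::{real_normed_field, banach, second_countable_topology}"
  assumes f: "integrable lborel f" and g: "integrable lborel g"
  shows "integrable lborel (\<lambda>x. f (fst x) * g (snd x))"
    and "(LINT x|lborel. f (fst x) * g (snd x)) = (LINT x|lborel. f x) * (LINT x|lborel. g x)"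
proof -
  have [measurable]: "f \<in> borel_measurable borel" "g \<in> borel_measurable borel"
    using f g by (auto dest: borel_measurable_integrable)
  have 1: "integrable (lborel \<Otimes>\<^sub>M lborel) (\<lambda>x. f (fst x) * g (snd x))"
  proof (rule lborel_pair.Fubini_integrable)
    show "integrable lborel (\<lambda>x. \<integral>y. norm (f (fst (x, y)) * g (snd (x, y))) \<partial>lborel)"
      using f by (simp add: norm_mult)
    show "AE x in lborel. integrable lborel (\<lambda>y. f (fst (x, y)) * g (snd (x, y)))"
      using g by simp
  qed measurable
  then show "integrable lborel (\<lambda>x. f (fst x) * g (snd x))" by (simp add: lborel_prod)
  have "(LINT x|lborel. (LINT y|lborel. f x * g y)) = (LINT x|(lborel \<Otimes>\<^sub>M lborel). f (fst x) * g (snd x))"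
    using lborel_pair.integral_fst'[OF 1] by simp
  then show "(LINT x|lborel. f (fst x) * g (snd x)) = (LINT x|lborel. f x) * (LINT x|lborel. g x)"
    by (simp add: lborel_prod)
qed

text \<open>The half-plane x1 \<le> 0 is taken closed, and on its edge the factor exp (n x1) does
  not decay as \<open>n\<close> grows; the edge has to be discarded as a null set.\<close>

lemma AE_lborel_fst_ne: "AE x in (lborel :: (real \<times> real) measure). fst x \<noteq> c"
proof -
  let ?N = "{x :: real \<times> real. x \<bullet> (1, 0) = c}"
  have "negligible ?N" by (rule negligible_standard_hyperplane) (auto simp: Basis_prod_def)
  then have "?N \<in> null_sets lebesgue" by (simp add: negligible_iff_null_sets)
  moreover have "closed ?N" by (intro closed_Collect_eq continuous_intros)
  then have "?N \<in> sets lborel" by simp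
  ultimately have "?N \<in> null_sets lborel"
    by (auto simp: null_sets_def emeasure_completion)
  then show ?thesis by (rule AE_I') (auto simp: inner_prod_def)
qed

text \<open>The distance to the line dominates both \<bar>t - Re w\<bar> and the constant \<delta>.
  A Cauchy kernel is therefore of order -1 in 1 + \<bar>t\<bar>, with a constant that is uniform for
  \<open>w\<close> in a bounded set away from the line.\<close>

lemma line_distance:
  fixes w :: complex
  assumes "\<bar>Im w - c\<bar> \<ge> \<delta>" "\<delta> > 0" "norm w \<le> R"
  shows "1 + \<bar>t\<bar> \<le> ((1 + R) / \<delta> + 1) * norm (Complex t c - w)"
proof -
  let ?d = "norm (Complex t c - w)"
  have d: "?d \<ge> \<delta>" using abs_Im_le_cmod[of "Complex t c - w"] assms(1) by (simp add: abs_minus_commute)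
  have "\<bar>t\<bar> \<le> \<bar>t - Re w\<bar> + \<bar>Re w\<bar>" by simp
  also have "\<bar>t - Re w\<bar> \<le> ?d" using abs_Re_le_cmod[of "Complex t c - w"] by simp
  also have "\<bar>Re w\<bar> \<le> R" using abs_Re_le_cmod[of w] assms by linarith
  finally have 1: "1 + \<bar>t\<bar> \<le> ?d + (1 + R)" by simp
  have "1 + R \<ge> 0" using assms(3) norm_ge_zero[of w] by linarith
  then have "(1 + R) * 1 \<le> (1 + R) * (?d / \<delta>)" using d assms(2) by (intro mult_left_mono) auto
  then show ?thesis using 1 by (simp add: algebra_simps)
qed

lemma holo2_on_imp_differentiable:
  assumes "holo2_on f S" "(z, w) \<in> S"
  shows "(\<lambda>x. f (x, w)) field_differentiable at z" "(\<lambda>y. f (z, y)) field_differentiable at w"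
proof -
  obtain a b where d: "(f has_derivative (\<lambda>h. a * fst h + b * snd h)) (at (z, w))"
    using assms unfolding holo2_on_def by blast
  have "((\<lambda>x. f (x, w)) has_derivative (\<lambda>h. a * fst (h, 0::complex) + b * snd (h, 0::complex))) (at z)"
    by (rule has_derivative_compose[of "\<lambda>x. (x, w)", OF _ d]) (intro has_derivative_Pair has_derivative_ident has_derivative_const)
  then show "(\<lambda>x. f (x, w)) field_differentiable at z"
    unfolding field_differentiable_def has_field_derivative_def by (intro exI[of _ a]) simp
  have "((\<lambda>y. f (z, y)) has_derivative (\<lambda>h. a * fst (0::complex, h) + b * snd (0::complex, h))) (at w)"
    by (rule has_derivative_compose[of "\<lambda>y. (z, y)", OF _ d]) (intro has_derivative_Pair has_derivative_ident has_derivative_const)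
  then show "(\<lambda>y. f (z, y)) field_differentiable at w"
    unfolding field_differentiable_def has_field_derivative_def by (intro exI[of _ b]) simp
qed

lemma holo2_on_transform:
  assumes "holo2_on f S" "open S" "\<And>p. p \<in> S \<Longrightarrow> f p = g p"
  shows "holo2_on g S"
  unfolding holo2_on_def
proof
  fix p assume p: "p \<in> S"
  then obtain a b where "(f has_derivative (\<lambda>h. a * fst h + b * snd h)) (at p)"
    using assms(1) unfolding holo2_on_def by blast
  then have "(g has_derivative (\<lambda>h. a * fst h + b * snd h)) (at p)"
    by (rule has_derivative_transform_within_open[OF _ assms(2) p assms(3)])
  then show "\<exists>a b. (g has_derivative (\<lambda>h. a * fst h + b * snd h)) (at p)" by blast
qed

subsection \<open>Fourier transforms of the parts of the trace\<close>

lemma norm_fourier_integrand: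
  "norm (fourier_integrand f \<xi> x) = norm (f x) * exp (- (Im (fst \<xi>) * fst x + Im (snd \<xi>) * snd x))"
  by (cases \<xi>; cases x) (simp add: fourier_integrand_def norm_mult)

lemma fourier_integrand_eq:
  "fourier_integrand f \<xi> x = f x * exp (\<i> * (fst \<xi> * of_real (fst x) + snd \<xi> * of_real (snd x)))"
  by (cases \<xi>; cases x) (simp add: fourier_integrand_def)

lemma borel_measurable_fourier_integrand:
  assumes "f \<in> borel_measurable borel"
  shows "fourier_integrand f \<xi> \<in> borel_measurable borel"
  unfolding fourier_integrand_eq[abs_def]
  by (intro borel_measurable_times assms borel_measurable_continuous_onI continuous_intros)

lemma tendsto_exp_linear:
  fixes c d :: real
  assumes "c < 0"
  shows "(\<lambda>n. exp (c * real n + d)) \<longlonglongrightarrow> 0"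
  using assms by real_asymp

lemma zero_islimpt_Reals: "(0::complex) islimpt \<real>"
  unfolding islimpt_approachable
proof (intro allI impI)
  fix e :: real assume "e > 0"
  then show "\<exists>x'\<in>\<real>. x' \<noteq> 0 \<and> dist x' (0::complex) < e"
    by (intro bexI[of _ "of_real (e / 2)"]) auto
qed

lemma holomorphic_on_inner_root [holomorphic_intros]:
  assumes "f holomorphic_on A" "\<And>z. z \<in> A \<Longrightarrow> Im (inner_root k (f z)) > 0"
  shows "(\<lambda>z. inner_root k (f z)) holomorphic_on A"
  unfolding inner_root_def
  by (intro holomorphic_intros assms(1)) (use assms(2) in \<open>auto simp: inner_root_def Im_sqrt_up_pos_iff\<close>)

lemma holomorphic_on_csqrt_upper [holomorphic_intros]:
  assumes "f holomorphic_on A" "\<And>z. z \<in> A \<Longrightarrow> Im (f z) > 0"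
  shows "(\<lambda>z. csqrt (f z)) holomorphic_on A"
  using assms by (intro holomorphic_on_csqrt' not_nonpos_Reals_if_Im_pos)

lemma convex_Im_strip: "convex {w::complex. \<bar>Im w\<bar> < c}"
proof -
  have "{w::complex. \<bar>Im w\<bar> < c} = {w. Im w > - c} \<inter> {w. Im w < c}" by auto
  then show ?thesis by (simp add: convex_Int convex_halfspace_Im_gt convex_halfspace_Im_lt)
qed

lemma open_Im_strip: "open {w::complex. \<bar>Im w\<bar> < c}"
  by (intro open_Collect_less continuous_intros)

section \<open>Fourier data on the plane and transforms over half-planes and quadrants\<close>

locale spectral_data =
  fixes \<epsilon> \<kappa> :: real and k k1 k2 :: complex and \<phi> \<omega> :: "real \<times> real \<Rightarrow> complex"
  assumes eps: "0 < \<epsilon>" "\<epsilon> < 1" and k: "k\<^sup>2 = 1 + \<i> * of_real \<epsilon>"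
    and kap: "0 < \<kappa>" "8 * \<kappa> \<le> \<epsilon>" "4 * \<kappa> \<le> Im k1" "4 * \<kappa> \<le> Im k2"
    and k1_cut: "k1 \<notin> h_plus k"
    and phi_measurable: "\<phi> \<in> borel_measurable borel"
    and phi_integrable: "integrable lborel (\<lambda>x. norm (\<phi> x) * exp (2 * \<kappa> * (\<bar>fst x\<bar> + \<bar>snd x\<bar>)))"
    and phi_quadrant: "\<And>x1 x2. x1 > 0 \<Longrightarrow> x2 > 0 \<Longrightarrow>
          \<phi> (x1, x2) = - exp (\<i> * (k1 * of_real x1 + k2 * of_real x2))"
    and omega_integrable: "\<And>\<xi>. \<xi> \<in> initial_domain \<kappa> \<Longrightarrow> integrable lborel (fourier_integrand \<omega> \<xi>)"
    and omega_support: "\<And>x1 x2. x1 < 0 \<or> x2 < 0 \<Longrightarrow> \<omega> (x1, x2) = 0"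
    and omega_holo: "holo2_on (fourier \<omega>) (initial_domain \<kappa>)"
    and functional_eq: "\<And>s t. spectral_K k s t * fourier \<omega> (of_real s, of_real t)
          = \<i> * fourier \<phi> (of_real s, of_real t)"
begin

definition part :: "(real \<times> real) set \<Rightarrow> complex \<times> complex \<Rightarrow> complex" where
  "part A \<xi> = (LINT x|lborel. indicator A x *\<^sub>R fourier_integrand \<phi> \<xi> x)"

text \<open>This is the condition under which the exponential factor is dominated on
  \<open>A\<close> by the weight of \<open>phi_integrable\<close>, so that one integrable majorant
  serves all parts and all parameters.\<close>

definition tame :: "(real \<times> real) set \<Rightarrow> complex \<times> complex \<Rightarrow> bool" where
  "tame A \<xi> \<longleftrightarrow> (\<forall>x\<in>A. - (Im (fst \<xi>) * fst x + Im (snd \<xi>) * snd x) \<le> 2 * \<kappa> * (\<bar>fst x\<bar> + \<bar>snd x\<bar>))"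

definition bound :: real where
  "bound = (LINT x|lborel. norm (\<phi> x) * exp (2 * \<kappa> * (\<bar>fst x\<bar> + \<bar>snd x\<bar>)))"

lemma bound_nonneg: "bound \<ge> 0"
  unfolding bound_def by (rule Bochner_Integration.integral_nonneg) auto

lemma part_dominated:
  assumes "tame A \<xi>"
  shows "norm (indicator A x *\<^sub>R fourier_integrand \<phi> \<xi> x) \<le> norm (\<phi> x) * exp (2 * \<kappa> * (\<bar>fst x\<bar> + \<bar>snd x\<bar>))"
  using assms by (auto simp: indicator_def norm_fourier_integrand tame_def intro!: mult_left_mono)

lemma part_measurable:
  assumes "A \<in> sets borel"
  shows "(\<lambda>x. indicator A x *\<^sub>R fourier_integrand \<phi> \<xi> x) \<in> borel_measurable borel"
  using assms by (intro borel_measurable_scaleR borel_measurable_indicator borel_measurable_fourier_integrand phi_measurable) auto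

lemma part_integrable:
  assumes "A \<in> sets borel" "tame A \<xi>"
  shows "integrable lborel (\<lambda>x. indicator A x *\<^sub>R fourier_integrand \<phi> \<xi> x)"
  by (rule Bochner_Integration.integrable_bound[OF phi_integrable])
     (use part_measurable[OF assms(1)] part_dominated[OF assms(2)] in \<open>auto intro!: AE_I2 simp del: norm_scaleR\<close>)

lemma part_bound:
  assumes "A \<in> sets borel" "tame A \<xi>"
  shows "norm (part A \<xi>) \<le> bound"
proof -
  have "norm (part A \<xi>) \<le> (LINT x|lborel. norm (indicator A x *\<^sub>R fourier_integrand \<phi> \<xi> x))"
    unfolding part_def by (rule integral_norm_bound)
  also have "\<dots> \<le> bound"
    unfolding bound_def
    by (rule integral_mono) (use part_integrable[OF assms] phi_integrable part_dominated[OF assms(2)] in \<open>auto simp del: norm_scaleR\<close>)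
  finally show ?thesis .
qed

lemma part_continuous:
  assumes "A \<in> sets borel" "\<And>\<xi>. \<xi> \<in> D \<Longrightarrow> tame A \<xi>"
  shows "continuous_on D (part A)"
  unfolding part_def[abs_def]
proof (rule continuous_on_param_lebesgue_integral)
  show "continuous_on D (\<lambda>\<xi>. indicator A x *\<^sub>R fourier_integrand \<phi> \<xi> x)" for x
    unfolding fourier_integrand_eq by (intro continuous_intros)
  show "(\<lambda>x. indicator A x *\<^sub>R fourier_integrand \<phi> \<xi> x) \<in> borel_measurable lborel" for \<xi>
    using part_measurable[OF assms(1)] by simp
  show "\<exists>V g. open V \<and> \<xi> \<in> V \<and> integrable lborel g \<and>
      (\<forall>q\<in>V \<inter> D. \<forall>t\<in>space lborel. norm (indicator A t *\<^sub>R fourier_integrand \<phi> q t) \<le> g t)" for \<xi>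
    using phi_integrable part_dominated assms(2) by (intro exI[of _ UNIV]) blast
qed

lemma part_holomorphic:
  assumes "A \<in> sets borel" "open S" "\<And>z. z \<in> S \<Longrightarrow> tame A (f z, g z)" "f holomorphic_on S" "g holomorphic_on S"
  shows "(\<lambda>z. part A (f z, g z)) holomorphic_on S"
  unfolding part_def[abs_def]
proof (rule holomorphic_on_param_lebesgue_integral)
  show "(\<lambda>z. indicator A x *\<^sub>R fourier_integrand \<phi> (f z, g z) x) holomorphic_on S" for x
    unfolding fourier_integrand_eq scaleR_conv_of_real by (intro holomorphic_intros; simp add: assms)
  show "(\<lambda>x. indicator A x *\<^sub>R fourier_integrand \<phi> (f z, g z) x) \<in> borel_measurable lborel" for z
    using part_measurable[OF assms(1)] by simp
  show "\<exists>V g'. open V \<and> z \<in> V \<and> integrable lborel g' \<and>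
      (\<forall>q\<in>V \<inter> S. \<forall>t\<in>space lborel. norm (indicator A t *\<^sub>R fourier_integrand \<phi> (f q, g q) t) \<le> g' t)" for z
    using phi_integrable part_dominated assms(3) by (intro exI[of _ UNIV]) blast
qed (fact assms)

lemma part_Un:
  assumes "A \<in> sets borel" "B \<in> sets borel" "A \<inter> B = {}" "tame A \<xi>" "tame B \<xi>"
  shows "part (A \<union> B) \<xi> = part A \<xi> + part B \<xi>"
proof -
  have "part (A \<union> B) \<xi> = (LINT x|lborel. indicator A x *\<^sub>R fourier_integrand \<phi> \<xi> x + indicator B x *\<^sub>R fourier_integrand \<phi> \<xi> x)"
    unfolding part_def using assms(3) by (intro Bochner_Integration.integral_cong) (auto simp: indicator_def)
  also have "\<dots> = part A \<xi> + part B \<xi>"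
    unfolding part_def using assms by (intro Bochner_Integration.integral_add part_integrable)
  finally show ?thesis .
qed

lemma fourier_phi: "fourier \<phi> = part UNIV"
  by (simp add: fourier_def part_def fun_eq_iff)

abbreviation "left_half \<equiv> {x :: real \<times> real. fst x \<le> 0}"
abbreviation "right_half \<equiv> {x :: real \<times> real. fst x > 0}"
abbreviation "quadrant \<equiv> {x :: real \<times> real. fst x > 0 \<and> snd x > 0}"
abbreviation "lower_quadrant \<equiv> {x :: real \<times> real. fst x > 0 \<and> snd x \<le> 0}"

lemma measurable_parts:
  "left_half \<in> sets borel" "right_half \<in> sets borel" "quadrant \<in> sets borel" "lower_quadrant \<in> sets borel"
  "(UNIV :: (real \<times> real) set) \<in> sets borel"
proof -
  have 1: "open right_half" and 2: "closed left_half" and 3: "open {x :: real \<times> real. snd x > 0}"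
    and 4: "closed {x :: real \<times> real. snd x \<le> 0}"
    by (intro open_Collect_less closed_Collect_le continuous_intros)+
  show "left_half \<in> sets borel" "right_half \<in> sets borel" using 1 2 by auto
  have "quadrant = right_half \<inter> {x. snd x > 0}" "lower_quadrant = right_half \<inter> {x. snd x \<le> 0}" by auto
  then show "quadrant \<in> sets borel" "lower_quadrant \<in> sets borel" using 1 3 4 by auto
qed auto

lemma tame_term:
  fixes x y :: real
  assumes "x > 0 \<Longrightarrow> y \<ge> - (2 * \<kappa>)" "x < 0 \<Longrightarrow> y \<le> 2 * \<kappa>"
  shows "- (y * x) \<le> 2 * \<kappa> * \<bar>x\<bar>"
proof (cases x "0::real" rule: linorder_cases)
  case greater
  then have "(- y) * x \<le> (2 * \<kappa>) * x" using assms(1) by (intro mult_right_mono) auto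
  then show ?thesis using greater by simp
next
  case less
  then have "y * (- x) \<le> (2 * \<kappa>) * (- x)" using assms(2) by (intro mult_right_mono) auto
  then show ?thesis using less by simp
qed simp

lemma tame_parts:
  "Im z \<le> 2 * \<kappa> \<Longrightarrow> \<bar>Im w\<bar> \<le> 2 * \<kappa> \<Longrightarrow> tame left_half (z, w)"
  "Im z \<ge> - 2 * \<kappa> \<Longrightarrow> \<bar>Im w\<bar> \<le> 2 * \<kappa> \<Longrightarrow> tame right_half (z, w)"
  "Im z \<ge> - 2 * \<kappa> \<Longrightarrow> Im w \<ge> - 2 * \<kappa> \<Longrightarrow> tame quadrant (z, w)"
  "Im z \<ge> - 2 * \<kappa> \<Longrightarrow> Im w \<le> 2 * \<kappa> \<Longrightarrow> tame lower_quadrant (z, w)"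
  "\<bar>Im z\<bar> \<le> 2 * \<kappa> \<Longrightarrow> \<bar>Im w\<bar> \<le> 2 * \<kappa> \<Longrightarrow> tame UNIV (z, w)"
proof -
  have *: "- (a * x + b * y) \<le> 2 * \<kappa> * (\<bar>x\<bar> + \<bar>y\<bar>)"
    if "x > 0 \<Longrightarrow> a \<ge> - (2 * \<kappa>)" "x < 0 \<Longrightarrow> a \<le> 2 * \<kappa>" "y > 0 \<Longrightarrow> b \<ge> - (2 * \<kappa>)" "y < 0 \<Longrightarrow> b \<le> 2 * \<kappa>" for a b x y
  proof -
    have "- (a * x) \<le> 2 * \<kappa> * \<bar>x\<bar>" "- (b * y) \<le> 2 * \<kappa> * \<bar>y\<bar>"
      using that by (intro tame_term; blast)+
    then show ?thesis by (simp add: distrib_left)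
  qed
  show "Im z \<le> 2 * \<kappa> \<Longrightarrow> \<bar>Im w\<bar> \<le> 2 * \<kappa> \<Longrightarrow> tame left_half (z, w)"
    "Im z \<ge> - 2 * \<kappa> \<Longrightarrow> \<bar>Im w\<bar> \<le> 2 * \<kappa> \<Longrightarrow> tame right_half (z, w)"
    "Im z \<ge> - 2 * \<kappa> \<Longrightarrow> Im w \<ge> - 2 * \<kappa> \<Longrightarrow> tame quadrant (z, w)"
    "Im z \<ge> - 2 * \<kappa> \<Longrightarrow> Im w \<le> 2 * \<kappa> \<Longrightarrow> tame lower_quadrant (z, w)"
    "\<bar>Im z\<bar> \<le> 2 * \<kappa> \<Longrightarrow> \<bar>Im w\<bar> \<le> 2 * \<kappa> \<Longrightarrow> tame UNIV (z, w)"
    unfolding tame_def fst_conv snd_conv by (intro ballI *; use kap(1) in auto)+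
qed

lemma part_UNIV_split:
  assumes "\<bar>Im z\<bar> \<le> 2 * \<kappa>" "\<bar>Im w\<bar> \<le> 2 * \<kappa>"
  shows "part UNIV (z, w) = part left_half (z, w) + part right_half (z, w)"
proof -
  have "part (left_half \<union> right_half) (z, w) = part left_half (z, w) + part right_half (z, w)"
    by (intro part_Un measurable_parts tame_parts) (use assms in auto)
  moreover have "left_half \<union> right_half = UNIV" by auto
  ultimately show ?thesis by simp
qed

text \<open>On the quadrant the trace is minus a product of exponentials, so its transform is minus
  the product of the half-line integrals \<i> / (z + k1) and \<i> / (w + k2). They converge because
  Im k1 and Im k2 are at least 4 \<kappa>.\<close>

lemma part_right_split:
  assumes "Im z \<ge> - 2 * \<kappa>" "\<bar>Im w\<bar> \<le> 2 * \<kappa>"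
  shows "part right_half (z, w) = 1 / ((z + k1) * (w + k2)) + part lower_quadrant (z, w)"
proof -
  have "part (quadrant \<union> lower_quadrant) (z, w) = part quadrant (z, w) + part lower_quadrant (z, w)"
    by (intro part_Un measurable_parts tame_parts) (use assms in auto)
  moreover have "quadrant \<union> lower_quadrant = right_half" by auto
  moreover have "part quadrant (z, w) = 1 / ((z + k1) * (w + k2))"
  proof -
    have im: "Im (z + k1) > 0" "Im (w + k2) > 0" using assms kap by auto
    have "part quadrant (z, w) = (LINT x|lborel. - ((indicator {0<..} (fst x) *\<^sub>R exp (\<i> * ((z + k1) * of_real (fst x))))
        * (indicator {0<..} (snd x) *\<^sub>R exp (\<i> * ((w + k2) * of_real (snd x))))))"
      unfolding part_def
    proof (rule Bochner_Integration.integral_cong)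
      fix x :: "real \<times> real"
      show "indicator quadrant x *\<^sub>R fourier_integrand \<phi> (z, w) x =
        - ((indicator {0<..} (fst x) *\<^sub>R exp (\<i> * ((z + k1) * of_real (fst x))))
        * (indicator {0<..} (snd x) *\<^sub>R exp (\<i> * ((w + k2) * of_real (snd x)))))"
        by (cases x) (auto simp: indicator_def fourier_integrand_eq phi_quadrant algebra_simps simp flip: exp_add)
    qed auto
    also have "\<dots> = - ((\<i> / (z + k1)) * (\<i> / (w + k2)))"
      using integral_lborel_product(2)[OF integral_exp_half_line(1)[OF im(1)] integral_exp_half_line(1)[OF im(2)]]
      by (simp add: integral_exp_half_line(2)[OF im(1)] integral_exp_half_line(2)[OF im(2)])
    finally show ?thesis by simp
  qed
  ultimately show ?thesis by simp
qed

text \<open>For x1 < 0 the factor exp (n x1) tends to 0. The limit disposes of the value at the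
  second pole when \<open>left_cauchy\<close> sends that pole to infinity.\<close>

lemma part_left_limit:
  assumes w: "\<bar>Im w\<bar> \<le> 2 * \<kappa>"
  shows "(\<lambda>n. part left_half (- \<i> * of_nat n, w)) \<longlonglongrightarrow> 0"
proof -
  have "(\<lambda>n. part left_half (- \<i> * of_nat n, w)) \<longlonglongrightarrow> (LINT x|(lborel :: (real \<times> real) measure). 0)"
    unfolding part_def
  proof (rule integral_dominated_convergence[where w="\<lambda>x. norm (\<phi> x) * exp (2 * \<kappa> * (\<bar>fst x\<bar> + \<bar>snd x\<bar>))"])
    have lim: "(\<lambda>n. indicator left_half x *\<^sub>R fourier_integrand \<phi> (- \<i> * of_nat n, w) x) \<longlonglongrightarrow> 0" if "fst x \<noteq> 0" for x
    proof (cases "fst x < 0")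
      case True
      have "(\<lambda>n. norm (\<phi> x) * exp (- (- real n * fst x + Im w * snd x))) \<longlonglongrightarrow> 0"
      proof -
        have eq: "- (- real n * fst x + Im w * snd x) = fst x * real n + - (Im w * snd x)" for n by simp
        show ?thesis
          unfolding eq by (rule tendsto_mult_right_zero[OF tendsto_exp_linear[OF True]])
      qed
      moreover have "norm (indicator left_half x *\<^sub>R fourier_integrand \<phi> (- \<i> * of_nat n, w) x)
          = norm (\<phi> x) * exp (- (- real n * fst x + Im w * snd x))" for n
        unfolding norm_fourier_integrand norm_scaleR using True by simp
      ultimately have "(\<lambda>n. norm (indicator left_half x *\<^sub>R fourier_integrand \<phi> (- \<i> * of_nat n, w) x)) \<longlonglongrightarrow> 0"
        by (simp only:)
      then show ?thesis by (rule tendsto_norm_zero_cancel)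
    next
      case False
      then have "x \<notin> left_half" using that by simp
      then show ?thesis by simp
    qed
    show "AE x in lborel. (\<lambda>n. indicator left_half x *\<^sub>R fourier_integrand \<phi> (- \<i> * of_nat n, w) x) \<longlonglongrightarrow> 0"
      using AE_lborel_fst_ne[of 0] by eventually_elim (rule lim)
    show "AE x in lborel. norm (indicator left_half x *\<^sub>R fourier_integrand \<phi> (- \<i> * of_nat n, w) x)
        \<le> norm (\<phi> x) * exp (2 * \<kappa> * (\<bar>fst x\<bar> + \<bar>snd x\<bar>))" for n
      using w kap by (intro AE_I2 part_dominated tame_parts) auto
    show "(\<lambda>x. indicator left_half x *\<^sub>R fourier_integrand \<phi> (- \<i> * of_nat n, w) x) \<in> borel_measurable lborel" for n
      using part_measurable measurable_parts by simp
  qed (use phi_integrable in auto)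
  then show ?thesis by simp
qed

text \<open>Since \<omega> vanishes outside the closed quadrant, lowering both imaginary parts only
  enlarges the modulus of the integrand; its integral at the corner (- i a, - i b) bounds all
  others.\<close>

lemma W_bounded:
  assumes "a < 2 * \<kappa>" "b < 2 * \<kappa>"
  obtains B where "B \<ge> 0" "\<And>z w. Im z \<ge> - a \<Longrightarrow> Im w \<ge> - b \<Longrightarrow> norm (fourier \<omega> (z, w)) \<le> B"
proof
  let ?\<xi> = "(- \<i> * of_real a, - \<i> * of_real b)"
  let ?B = "LINT x|lborel. norm (fourier_integrand \<omega> ?\<xi> x)"
  have int: "integrable lborel (fourier_integrand \<omega> ?\<xi>)"
    using assms by (intro omega_integrable) (auto simp: initial_domain_def)
  show "?B \<ge> 0" by (rule Bochner_Integration.integral_nonneg) auto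
  show "norm (fourier \<omega> (z, w)) \<le> ?B" if "Im z \<ge> - a" "Im w \<ge> - b" for z w
  proof -
    have int2: "integrable lborel (fourier_integrand \<omega> (z, w))"
      using assms that by (intro omega_integrable) (auto simp: initial_domain_def)
    have "norm (fourier \<omega> (z, w)) \<le> (LINT x|lborel. norm (fourier_integrand \<omega> (z, w) x))"
      unfolding fourier_def by (rule integral_norm_bound)
    also have "\<dots> \<le> ?B"
    proof (rule integral_mono)
      fix x :: "real \<times> real"
      show "norm (fourier_integrand \<omega> (z, w) x) \<le> norm (fourier_integrand \<omega> ?\<xi> x)"
      proof (cases "fst x \<ge> 0 \<and> snd x \<ge> 0")
        case True
        then have "- a * fst x \<le> Im z * fst x" "- b * snd x \<le> Im w * snd x"
          using that True mult_right_mono[of "- a" "Im z" "fst x"] mult_right_mono[of "- b" "Im w" "snd x"] by auto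
        then show ?thesis by (simp add: norm_fourier_integrand mult_left_mono)
      next
        case False
        then have "\<omega> x = 0" by (cases x) (auto intro: omega_support)
        then show ?thesis by (simp add: norm_fourier_integrand)
      qed
    qed (use int int2 in auto)
    finally show ?thesis .
  qed
qed

end

subsection \<open>Decay of the spectral functions\<close>

lemma one_divide_le:
  fixes x d K :: real
  assumes "0 < x" "x \<le> K * d" "0 < d"
  shows "1 / d \<le> K / x"
  using assms by (simp add: pos_le_divide_eq pos_divide_le_eq)

text \<open>Once \<open>V\<close> decays, however slowly, a single kernel is absolutely integrable
  and the second pole can be sent to infinity. The condition \<open>c * s < 0\<close> makes it start
  at 0 and move away from the line, so its distance to any point of the line is smallest at n = 0;
  this gives a majorant uniform in \<open>n\<close>.\<close>

lemma cauchy_kernel_limit: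
  fixes V :: "real \<Rightarrow> complex"
  assumes V: "V \<in> borel_measurable borel" and dec: "\<And>t. norm (V t) \<le> C * (1 + \<bar>t\<bar>) powr (- p)"
    and p: "p > 0" and a: "Im a \<noteq> c" and c: "c * s < 0"
  shows "integrable lborel (\<lambda>t. V t / (Complex t c - a))"
    and "(\<lambda>n. LINT t|lborel. V t * (1 / (Complex t c - a) - 1 / (Complex t c - \<i> * of_real (s * real n))))
          \<longlonglongrightarrow> (LINT t|lborel. V t / (Complex t c - a))"
proof -
  define \<delta> where "\<delta> = \<bar>Im a - c\<bar>"
  have \<delta>: "\<delta> > 0" using a by (simp add: \<delta>_def)
  define Ka where "Ka = (1 + norm a) / \<delta> + 1"
  define K0 where "K0 = 1 / \<bar>c\<bar> + 1"
  have c0: "\<bar>c\<bar> > 0" using c by auto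
  have C: "C \<ge> 0" using order_trans[OF norm_ge_zero dec[of 0]] by simp
  have K: "Ka > 0" "K0 > 0" using \<delta> c0 norm_ge_zero[of a] by (simp_all add: Ka_def K0_def add_nonneg_pos)
  have ba: "norm (1 / (Complex t c - a)) \<le> Ka / (1 + \<bar>t\<bar>)" for t
  proof -
    have "1 + \<bar>t\<bar> \<le> Ka * norm (Complex t c - a)"
      unfolding Ka_def by (rule line_distance) (use \<delta> in \<open>auto simp: \<delta>_def\<close>)
    moreover have "norm (Complex t c - a) > 0" using a by (auto simp: complex_eq_iff)
    ultimately show ?thesis unfolding norm_divide norm_one by (intro one_divide_le) auto
  qed
  have bn: "norm (1 / (Complex t c - \<i> * of_real (s * real n))) \<le> K0 / (1 + \<bar>t\<bar>)" for t n
  proof -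
    have "1 + \<bar>t\<bar> \<le> ((1 + 0) / \<bar>c\<bar> + 1) * norm (Complex t c - 0)"
      by (rule line_distance) (use c0 in auto)
    moreover have "norm (Complex t c - 0) \<le> norm (Complex t c - \<i> * of_real (s * real n))"
    proof -
      have "c * s * real n \<le> 0" using c by (simp add: mult_nonpos_nonneg)
      then have "c\<^sup>2 \<le> (c - s * real n)\<^sup>2"
        using zero_le_power2[of "s * real n"] unfolding power2_diff mult.assoc by linarith
      then show ?thesis by (simp add: cmod_def)
    qed
    ultimately have "1 + \<bar>t\<bar> \<le> K0 * norm (Complex t c - \<i> * of_real (s * real n))"
      unfolding K0_def using c0 by (smt (verit) mult_left_mono divide_nonneg_pos)
    moreover have "norm (Complex t c - \<i> * of_real (s * real n)) > 0"
      using calculation K by (smt (verit) abs_ge_zero norm_ge_zero mult_nonneg_nonpos)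
    ultimately show ?thesis unfolding norm_divide norm_one by (intro one_divide_le) auto
  qed
  define W where "W = (\<lambda>t::real. C * (Ka + K0) * (1 + \<bar>t\<bar>) powr (- p - 1))"
  have W: "integrable lborel W"
    unfolding W_def by (intro integrable_mult_right integrable_powr_abs) (use p in auto)
  have dom: "norm (V t * x) \<le> W t" if "norm x \<le> (Ka + K0) / (1 + \<bar>t\<bar>)" for t x
  proof -
    have "norm (V t * x) \<le> (C * (1 + \<bar>t\<bar>) powr (- p)) * ((Ka + K0) / (1 + \<bar>t\<bar>))"
      unfolding norm_mult using dec that C by (intro mult_mono) auto
    also have "\<dots> = W t" by (simp add: W_def powr_diff)
    finally show ?thesis .
  qed
  have m: "(\<lambda>t. V t / (Complex t c - w)) \<in> borel_measurable borel" for w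
  proof -
    have "(\<lambda>t. Complex t c - w) \<in> borel_measurable borel"
      unfolding Complex_eq by (intro borel_measurable_continuous_onI continuous_intros)
    then show ?thesis using V by (intro borel_measurable_divide)
  qed
  show "integrable lborel (\<lambda>t. V t / (Complex t c - a))"
  proof (rule Bochner_Integration.integrable_bound[OF W])
    have "norm (V t / (Complex t c - a)) \<le> W t" for t
    proof -
      have "norm (V t * (1 / (Complex t c - a))) \<le> W t"
        by (rule dom, rule order_trans[OF ba]) (use K in \<open>auto intro!: divide_right_mono\<close>)
      then show ?thesis by simp
    qed
    then show "AE t in lborel. norm (V t / (Complex t c - a)) \<le> norm (W t)"
      by (intro AE_I2) (auto intro: order_trans[OF _ abs_ge_self])
  qed (use m in auto)
  show "(\<lambda>n. LINT t|lborel. V t * (1 / (Complex t c - a) - 1 / (Complex t c - \<i> * of_real (s * real n))))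
          \<longlonglongrightarrow> (LINT t|lborel. V t / (Complex t c - a))"
  proof (rule integral_dominated_convergence[where w=W])
    show "AE t in lborel. norm (V t * (1 / (Complex t c - a) - 1 / (Complex t c - \<i> * of_real (s * real n)))) \<le> W t" for n
    proof (intro AE_I2 dom)
      fix t
      show "norm (1 / (Complex t c - a) - 1 / (Complex t c - \<i> * of_real (s * real n))) \<le> (Ka + K0) / (1 + \<bar>t\<bar>)"
        using norm_triangle_ineq4[of "1 / (Complex t c - a)" "1 / (Complex t c - \<i> * of_real (s * real n))"] ba[of t] bn[of t n]
        unfolding add_divide_distrib by linarith
    qed
    show "AE t in lborel. (\<lambda>n. V t * (1 / (Complex t c - a) - 1 / (Complex t c - \<i> * of_real (s * real n)))) \<longlonglongrightarrow> V t / (Complex t c - a)"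
    proof (rule AE_I2)
      fix t
      have "s \<noteq> 0" using c by auto
      have "filterlim (\<lambda>n. norm (Complex t c - \<i> * of_real (s * real n))) at_top sequentially"
      proof (rule filterlim_at_top_mono)
        show "filterlim (\<lambda>n. \<bar>s\<bar> * real n) at_top sequentially"
          using \<open>s \<noteq> 0\<close> by (intro filterlim_tendsto_pos_mult_at_top[OF tendsto_const] filterlim_real_sequentially) auto
        have "\<bar>s\<bar> * real n \<le> norm (Complex t c - \<i> * of_real (s * real n))" for n
        proof -
          have "c * s * real n \<le> 0" using c by (simp add: mult_nonpos_nonneg)
          then have "(s * real n)\<^sup>2 \<le> (c - s * real n)\<^sup>2"
            using zero_le_power2[of c] unfolding power2_diff mult.assoc by linarith
          then have "\<bar>s * real n\<bar> \<le> \<bar>c - s * real n\<bar>" by (simp add: abs_le_square_iff)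
          then show ?thesis
            using abs_Im_le_cmod[of "Complex t c - \<i> * of_real (s * real n)"] by (simp add: abs_mult)
        qed
        then show "\<forall>\<^sub>F n in sequentially. \<bar>s\<bar> * real n \<le> norm (Complex t c - \<i> * of_real (s * real n))" by simp
      qed
      then have "filterlim (\<lambda>n. Complex t c - \<i> * of_real (s * real n)) at_infinity sequentially"
        by (simp add: filterlim_at_infinity_conv_norm_at_top)
      then have "(\<lambda>n. 1 / (Complex t c - \<i> * of_real (s * real n))) \<longlonglongrightarrow> 0"
        by (intro tendsto_divide_0[OF tendsto_const])
      then have "(\<lambda>n. V t * (1 / (Complex t c - a) - 1 / (Complex t c - \<i> * of_real (s * real n)))) \<longlonglongrightarrow> V t * (1 / (Complex t c - a) - 0)"
        by (intro tendsto_intros)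
      then show "(\<lambda>n. V t * (1 / (Complex t c - a) - 1 / (Complex t c - \<i> * of_real (s * real n)))) \<longlonglongrightarrow> V t / (Complex t c - a)" by simp
    qed
    have "(\<lambda>t. V t * (1 / (Complex t c - a) - 1 / (Complex t c - b))) = (\<lambda>t. V t / (Complex t c - a) - V t / (Complex t c - b))" for b
      by (simp add: fun_eq_iff right_diff_distrib)
    then show "(\<lambda>t. V t * (1 / (Complex t c - a) - 1 / (Complex t c - \<i> * of_real (s * real n)))) \<in> borel_measurable lborel" for n
      using m by simp
  qed (use W m in auto)
qed

context spectral_data
begin

text \<open>The constants of \<open>inner_root_strip\<close> fit exactly: two squares of at most (2
  \<kappa>)^2 add up to at most 8 \<kappa>^2, which is at most \<epsilon>^2 / 8 because 8 \<kappa>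
  \<le> \<epsilon>.\<close>

lemma Im_inner_root_strip:
  assumes "\<bar>Im z\<bar> \<le> 2 * \<kappa>"
  shows "Im (inner_root k z) > 2 * \<kappa>"
proof (rule ccontr)
  assume "\<not> ?thesis"
  then have "(Im (inner_root k z))\<^sup>2 \<le> (2 * \<kappa>)\<^sup>2"
    using Im_inner_root_nonneg[of k z] by (intro power_mono) auto
  moreover have "(Im z)\<^sup>2 \<le> (2 * \<kappa>)\<^sup>2" using power_mono[OF assms abs_ge_zero, of 2] by simp
  moreover have "(8 * \<kappa>)\<^sup>2 \<le> \<epsilon>\<^sup>2" using kap by (intro power_mono) auto
  ultimately show False using inner_root_strip[OF k eps, of z] by (simp add: power_mult_distrib)
qed

section \<open>The functional equation on a strip\<close>

lemma W_holomorphic: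
  assumes "open S" "f holomorphic_on S"
  shows "(\<And>z. z \<in> S \<Longrightarrow> (f z, w) \<in> initial_domain \<kappa>) \<Longrightarrow> (\<lambda>z. fourier \<omega> (f z, w)) holomorphic_on S"
    and "(\<And>z. z \<in> S \<Longrightarrow> (w, f z) \<in> initial_domain \<kappa>) \<Longrightarrow> (\<lambda>z. fourier \<omega> (w, f z)) holomorphic_on S"
proof -
  assume *: "\<And>z. z \<in> S \<Longrightarrow> (f z, w) \<in> initial_domain \<kappa>"
  have "(\<lambda>x. fourier \<omega> (x, w)) holomorphic_on f ` S"
    unfolding holomorphic_on_def
    using holo2_on_imp_differentiable(1)[OF omega_holo *] by (auto intro: field_differentiable_at_within)
  from holomorphic_on_compose[OF assms(2) this] show "(\<lambda>z. fourier \<omega> (f z, w)) holomorphic_on S"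
    by (simp add: o_def)
next
  assume *: "\<And>z. z \<in> S \<Longrightarrow> (w, f z) \<in> initial_domain \<kappa>"
  have "(\<lambda>x. fourier \<omega> (w, x)) holomorphic_on f ` S"
    unfolding holomorphic_on_def
    using holo2_on_imp_differentiable(2)[OF omega_holo *] by (auto intro: field_differentiable_at_within)
  from holomorphic_on_compose[OF assms(2) this] show "(\<lambda>z. fourier \<omega> (w, f z)) holomorphic_on S"
    by (simp add: o_def)
qed

text \<open>The difference \<open>D\<close> of the two sides is holomorphic in each variable
  separately, since both radicands have positive imaginary part on the strip. The identity theorem
  in one variable, from the reals, is applied in \<open>w\<close> for real \<open>z\<close> and then
  in \<open>z\<close> for each \<open>w\<close>.\<close>

lemma functional_eq_strip:
  assumes z: "\<bar>Im z\<bar> < 2 * \<kappa>" and w: "\<bar>Im w\<bar> < 2 * \<kappa>"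
  shows "fourier \<omega> (z, w) = \<i> * csqrt (inner_root k z + w) * csqrt (inner_root k z - w) * part UNIV (z, w)"
proof -
  let ?S = "{w::complex. \<bar>Im w\<bar> < 2 * \<kappa>}"
  define D where "D = (\<lambda>z w. fourier \<omega> (z, w) - \<i> * csqrt (inner_root k z + w) * csqrt (inner_root k z - w) * part UNIV (z, w))"
  have im: "Im (inner_root k z + w) > 0" "Im (inner_root k z - w) > 0" if "z \<in> ?S" "w \<in> ?S" for z w
    using Im_inner_root_strip[of z] that by auto
  have RS: "\<real> \<subseteq> ?S" using kap by (auto elim!: Reals_cases)
  have S: "open ?S" "connected ?S" "0 \<in> ?S"
    using open_Im_strip convex_connected[OF convex_Im_strip] kap by auto
  have real: "D (of_real s) (of_real t) = 0" for s t
  proof -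
    define b where "b = inner_root k (of_real s)"
    have b: "Im (b + of_real t) > 0" "Im (b - of_real t) > 0"
      using im[of "of_real s" "of_real t"] kap by (auto simp: b_def)
    \<comment> \<open>A product of principal roots need not be principal. Here both factors lie in
      the open first quadrant, so Im p > 0, and Im (p^2) = \<epsilon> > 0 then forces Re p >
      0.\<close>
    define p where "p = csqrt (b + of_real t) * csqrt (b - of_real t)"
    have p2: "p\<^sup>2 = k\<^sup>2 - (of_real s)\<^sup>2 - (of_real t)\<^sup>2"
      unfolding p_def power_mult_distrib power2_csqrt
      using inner_root_square[of k "of_real s"] by (simp add: b_def power2_eq_square algebra_simps)
    have "Im p > 0"
      using csqrt_Im_pos[OF b(1)] csqrt_Im_pos[OF b(2)] by (simp add: p_def add_pos_pos)
    moreover have "Im (p\<^sup>2) > 0" unfolding p2 k using eps by (simp add: power2_eq_square)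
    then have "Re p * Im p > 0" by (simp add: power2_eq_square mult.commute)
    ultimately have "Re p > 0" by (simp add: zero_less_mult_iff)
    then have "csqrt (k\<^sup>2 - (of_real s)\<^sup>2 - (of_real t)\<^sup>2) = p"
      using p2 by (intro csqrt_unique) auto
    then have "spectral_K k s t = 1 / p" by (simp add: spectral_K_def)
    then have "1 / p * fourier \<omega> (of_real s, of_real t) = \<i> * part UNIV (of_real s, of_real t)"
      using functional_eq[of s t] by (simp add: fourier_phi)
    moreover have "p \<noteq> 0" using \<open>Re p > 0\<close> by auto
    ultimately have "fourier \<omega> (of_real s, of_real t) = \<i> * p * part UNIV (of_real s, of_real t)"
      by (simp add: field_simps)
    then show ?thesis by (simp add: D_def p_def b_def mult.assoc)
  qed
  have hol2: "D z holomorphic_on ?S" if "z \<in> ?S" for z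
    unfolding D_def using that im[OF that] kap
    by (intro holomorphic_intros W_holomorphic part_holomorphic S measurable_parts tame_parts)
       (auto simp: initial_domain_def)
  have hol1: "(\<lambda>z. D z w) holomorphic_on ?S" if w: "w \<in> ?S" for w
  proof -
    have b: "inner_root k holomorphic_on ?S"
      by (rule holomorphic_on_inner_root[OF holomorphic_on_ident]) (use im[OF _ S(3)] in auto)
    have c: "(\<lambda>z. csqrt (inner_root k z + w)) holomorphic_on ?S" "(\<lambda>z. csqrt (inner_root k z - w)) holomorphic_on ?S"
      using im[OF _ w] by (auto intro!: holomorphic_on_csqrt_upper holomorphic_on_add holomorphic_on_diff b)
    then show ?thesis
      unfolding D_def using w kap
      by (intro holomorphic_on_diff holomorphic_on_mult holomorphic_on_const holomorphic_on_ident c W_holomorphic part_holomorphic S measurable_parts tame_parts)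
         (auto simp: initial_domain_def)
  qed
  have "D (of_real s) w = 0" if "w \<in> ?S" for s w
    by (rule analytic_continuation[OF hol2 S(1,2) RS S(3) zero_islimpt_Reals _ that])
       (use kap real in \<open>auto elim!: Reals_cases\<close>)
  then have "D z w = 0"
    using analytic_continuation[OF hol1 S(1,2) RS S(3) zero_islimpt_Reals, of w z] z w by (auto elim!: Reals_cases)
  then show ?thesis by (simp add: D_def)
qed

text \<open>For large s^2 + t^2 the real part of the radicand dominates. For s^2 + t^2 < 4 it
  factors into (b + w) (b - w), where each factor has imaginary part above \<kappa> because Im b > 2
  \<kappa>. The 15 is the value of 3 (1 + s^2 + t^2) at s^2 + t^2 = 4.\<close>

lemma abs_radicand_lower_bound:
  "norm (k\<^sup>2 - (Complex s \<kappa>)\<^sup>2 - (Complex t (- \<kappa>))\<^sup>2) \<ge> (\<kappa>\<^sup>2 / 15) * (1 + \<bar>s\<bar> + \<bar>t\<bar>)\<^sup>2"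
proof -
  let ?z = "Complex s \<kappa>" and ?w = "Complex t (- \<kappa>)"
  let ?r = "k\<^sup>2 - ?z\<^sup>2 - ?w\<^sup>2"
  have \<kappa>1: "\<kappa>\<^sup>2 \<le> 1 / 64"
  proof -
    have "\<kappa>\<^sup>2 \<le> (1/8)\<^sup>2" using kap eps by (intro power_mono) auto
    then show ?thesis by (simp add: power2_eq_square)
  qed
  have T: "(1 + \<bar>s\<bar> + \<bar>t\<bar>)\<^sup>2 \<le> 3 * (1 + s\<^sup>2 + t\<^sup>2)"
  proof -
    have "0 \<le> (1 - \<bar>s\<bar>)\<^sup>2 + (1 - \<bar>t\<bar>)\<^sup>2 + (\<bar>s\<bar> - \<bar>t\<bar>)\<^sup>2" by simp
    then show ?thesis by (simp add: power2_eq_square algebra_simps)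
  qed
  show ?thesis
  proof (cases "s\<^sup>2 + t\<^sup>2 \<ge> 4")
    case True
    have "Re ?r = 1 - s\<^sup>2 - t\<^sup>2 + 2 * \<kappa>\<^sup>2" unfolding k by (simp add: power2_eq_square)
    then have "norm ?r \<ge> s\<^sup>2 + t\<^sup>2 - 1 - 2 * \<kappa>\<^sup>2" using abs_Re_le_cmod[of ?r] by linarith
    then have 1: "norm ?r \<ge> (s\<^sup>2 + t\<^sup>2) / 2" unfolding add_divide_distrib using True \<kappa>1 by linarith
    have "(\<kappa>\<^sup>2 / 15) * (1 + \<bar>s\<bar> + \<bar>t\<bar>)\<^sup>2 \<le> (1 / 64 / 15) * (3 * (1 + s\<^sup>2 + t\<^sup>2))"
      using \<kappa>1 T by (intro mult_mono) auto
    also have "\<dots> \<le> (s\<^sup>2 + t\<^sup>2) / 2" using True by simp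
    finally show ?thesis using 1 by linarith
  next
    case False
    let ?b = "inner_root k ?z"
    have b: "Im ?b > 2 * \<kappa>" by (rule Im_inner_root_strip) (use kap in auto)
    have "?r = (?b + ?w) * (?b - ?w)"
      using inner_root_square[of k ?z] by (simp add: power2_eq_square algebra_simps)
    then have "norm ?r = norm (?b + ?w) * norm (?b - ?w)" by (simp only: norm_mult)
    also have "\<dots> \<ge> \<kappa> * \<kappa>"
    proof (intro mult_mono)
      show "\<kappa> \<le> norm (?b + ?w)" using b kap abs_Im_le_cmod[of "?b + ?w"] by simp
      show "\<kappa> \<le> norm (?b - ?w)" using b kap abs_Im_le_cmod[of "?b - ?w"] by simp
    qed (use kap in auto)
    finally have 1: "norm ?r \<ge> \<kappa>\<^sup>2" by (simp add: power2_eq_square)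
    have "(\<kappa>\<^sup>2 / 15) * (1 + \<bar>s\<bar> + \<bar>t\<bar>)\<^sup>2 \<le> (\<kappa>\<^sup>2 / 15) * 15"
      using T False by (intro mult_left_mono) auto
    then show ?thesis using 1 by linarith
  qed
qed

text \<open>\<open>\<omega>\<close> has a bounded transform, and the root that multiplies
  \<open>U\<close> grows linearly in both variables. As 15 < 16, its modulus is at least \<kappa> /
  4 times 1 + \<bar>s\<bar> + \<bar>t\<bar>.\<close>

lemma U_decay:
  obtains C where "C \<ge> 0" "\<And>s t. norm (part UNIV (Complex s \<kappa>, Complex t (- \<kappa>))) \<le> C / (1 + \<bar>s\<bar> + \<bar>t\<bar>)"
proof -
  obtain B where B: "B \<ge> 0" "\<And>z w. Im z \<ge> - \<kappa> \<Longrightarrow> Im w \<ge> - \<kappa> \<Longrightarrow> norm (fourier \<omega> (z, w)) \<le> B"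
    using W_bounded[of \<kappa> \<kappa>] kap by auto
  show ?thesis
  proof
    show "B * (4 / \<kappa>) \<ge> 0" using B kap by simp
    fix s t
    let ?z = "Complex s \<kappa>" and ?w = "Complex t (- \<kappa>)"
    let ?b = "inner_root k ?z" and ?r = "k\<^sup>2 - (Complex s \<kappa>)\<^sup>2 - (Complex t (- \<kappa>))\<^sup>2"
    let ?p = "csqrt (?b + ?w) * csqrt (?b - ?w)"
    have "norm (?p\<^sup>2) = norm ?r"
    proof -
      have "?p\<^sup>2 = ?b\<^sup>2 - ?w\<^sup>2"
        unfolding power_mult_distrib power2_csqrt by (simp add: power2_eq_square algebra_simps)
      then show ?thesis by (simp add: inner_root_square)
    qed
    moreover have "(\<kappa> / 4 * (1 + \<bar>s\<bar> + \<bar>t\<bar>))\<^sup>2 \<le> (\<kappa>\<^sup>2 / 15) * (1 + \<bar>s\<bar> + \<bar>t\<bar>)\<^sup>2"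
      unfolding power_mult_distrib power_divide by (intro mult_right_mono divide_left_mono) auto
    ultimately have "(\<kappa> / 4 * (1 + \<bar>s\<bar> + \<bar>t\<bar>))\<^sup>2 \<le> (norm ?p)\<^sup>2"
      using abs_radicand_lower_bound[of s t] by (simp add: norm_power)
    then have p: "\<kappa> / 4 * (1 + \<bar>s\<bar> + \<bar>t\<bar>) \<le> norm ?p" by (rule power2_le_imp_le) auto
    have pos: "0 < \<kappa> / 4 * (1 + \<bar>s\<bar> + \<bar>t\<bar>)" using kap by (simp add: add_pos_nonneg)
    have "norm (fourier \<omega> (?z, ?w)) = norm ?p * norm (part UNIV (?z, ?w))"
      by (subst functional_eq_strip) (use kap in \<open>auto simp: norm_mult\<close>)
    moreover have "norm (fourier \<omega> (?z, ?w)) \<le> B" using kap by (intro B) auto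
    ultimately have "norm ?p * norm (part UNIV (?z, ?w)) \<le> B" by simp
    moreover have "\<kappa> / 4 * (1 + \<bar>s\<bar> + \<bar>t\<bar>) * norm (part UNIV (?z, ?w)) \<le> norm ?p * norm (part UNIV (?z, ?w))"
      by (rule mult_right_mono[OF p]) auto
    ultimately have "norm (part UNIV (?z, ?w)) * (\<kappa> / 4 * (1 + \<bar>s\<bar> + \<bar>t\<bar>)) \<le> B"
      by (simp only: mult.commute)
    then have "norm (part UNIV (?z, ?w)) \<le> B / (\<kappa> / 4 * (1 + \<bar>s\<bar> + \<bar>t\<bar>))"
      using pos by (simp only: pos_le_divide_eq)
    then show "norm (part UNIV (?z, ?w)) \<le> B * (4 / \<kappa>) / (1 + \<bar>s\<bar> + \<bar>t\<bar>)"
      by simp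
  qed
qed

section \<open>The left transform as a Cauchy integral in the first variable\<close>

lemma one_le_half_growth: "1 \<le> (1 + norm (z::complex)) powr (1/2)"
  by (intro ge_one_powr_ge_zero) auto

lemma part_UNIV_line_measurable: "(\<lambda>s. part UNIV (Complex s \<kappa>, Complex t (- \<kappa>))) \<in> borel_measurable borel"
proof (rule borel_measurable_continuous_onI)
  have "continuous_on {\<xi>. \<bar>Im (fst \<xi>)\<bar> \<le> 2 * \<kappa> \<and> \<bar>Im (snd \<xi>)\<bar> \<le> 2 * \<kappa>} (part UNIV)"
    by (rule part_continuous) (auto intro: tame_parts)
  then show "continuous_on UNIV (\<lambda>s. part UNIV (Complex s \<kappa>, Complex t (- \<kappa>)))"
    unfolding Complex_eq by (rule continuous_on_compose2) (use kap in \<open>auto intro!: continuous_intros\<close>)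
qed

text \<open>On the line Im = \<kappa> the transform is the sum of a left part, analytic below, and a
  right part, analytic above. With both poles under the line, closing downwards gives the values of
  the left part and closing upwards gives 0. The summands are only bounded, so this is done with
  differences of kernels; the decay of the sum then permits the limit.\<close>

lemma left_cauchy:
  fixes z :: complex and t :: real
  assumes z: "Im z < \<kappa>"
  defines "\<eta> \<equiv> Complex t (- \<kappa>)"
  shows "(LINT s|lborel. part UNIV (Complex s \<kappa>, \<eta>) / (Complex s \<kappa> - z)) = - (2 * pi * \<i> * part left_half (z, \<eta>))"
proof -
  have \<eta>: "\<bar>Im \<eta>\<bar> \<le> 2 * \<kappa>" using kap by (simp add: \<eta>_def)
  obtain C where C: "C \<ge> 0" "\<And>s t. norm (part UNIV (Complex s \<kappa>, Complex t (- \<kappa>))) \<le> C / (1 + \<bar>s\<bar> + \<bar>t\<bar>)"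
    using U_decay by blast
  have dec: "norm (part UNIV (Complex s \<kappa>, \<eta>)) \<le> C * (1 + \<bar>s\<bar>) powr (- 1)" for s
  proof -
    have "C / (1 + \<bar>s\<bar> + \<bar>t\<bar>) \<le> C / (1 + \<bar>s\<bar>)"
      using C(1) by (intro divide_left_mono) (auto intro!: mult_pos_pos add_pos_nonneg)
    then show ?thesis using C(2)[of s t] by (simp add: \<eta>_def powr_minus divide_inverse)
  qed
  have bd: "bound \<le> bound * (1 + norm (\<xi>::complex)) powr (1/2)" for \<xi>
    using mult_left_mono[OF one_le_half_growth bound_nonneg] by simp
  have eq: "(LINT s|lborel. part UNIV (Complex s \<kappa>, \<eta>) * (1 / (Complex s \<kappa> - z) - 1 / (Complex s \<kappa> - \<i> * of_real (- 1 * real n))))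
    = - (2 * pi * \<i> * (part left_half (z, \<eta>) - part left_half (- \<i> * of_nat n, \<eta>)))" for n
  proof -
    let ?a = z and ?b = "- \<i> * of_nat n :: complex"
    let ?k = "\<lambda>s. 1 / (Complex s \<kappa> - ?a) - 1 / (Complex s \<kappa> - ?b)"
    have open_half: "open {z. Im z < c}" "open {z. Im z > c}" for c
      by (intro open_Collect_less continuous_intros)+
    have L: "(\<lambda>\<xi>. part left_half (\<xi>, \<eta>)) holomorphic_on {\<xi>. Im \<xi> < 2 * \<kappa>}"
      by (intro part_holomorphic measurable_parts open_half tame_parts holomorphic_intros) (use \<eta> in auto)
    have R: "(\<lambda>\<xi>. part right_half (\<xi>, \<eta>)) holomorphic_on {\<xi>. Im \<xi> > - 2 * \<kappa>}"
      by (intro part_holomorphic measurable_parts open_half tame_parts holomorphic_intros) (use \<eta> in auto)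
    have Lb: "norm (part left_half (\<xi>, \<eta>)) \<le> bound * (1 + norm \<xi>) powr (1/2)" if "Im \<xi> \<le> \<kappa>" for \<xi>
      by (rule order_trans[OF part_bound bd]) (use that \<eta> kap in \<open>auto intro!: measurable_parts tame_parts\<close>)
    have Rb: "norm (part right_half (\<xi>, \<eta>)) \<le> bound * (1 + norm \<xi>) powr (1/2)" if "Im \<xi> \<ge> \<kappa>" for \<xi>
      by (rule order_trans[OF part_bound bd]) (use that \<eta> kap in \<open>auto intro!: measurable_parts tame_parts\<close>)
    note l = lower_half_plane_cauchy[where c = \<kappa> and C = bound and f = "\<lambda>\<xi>. part left_half (\<xi>, \<eta>)" and c' = "2 * \<kappa>", OF L _ Lb bound_nonneg, where a = z and b = "- \<i> * of_nat n"
        and I = "- (2 * pi * \<i> * (part left_half (z, \<eta>) - part left_half (- \<i> * of_nat n, \<eta>)))"]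
    note r = upper_half_plane_cauchy[where c = \<kappa> and C = bound and f = "\<lambda>\<xi>. part right_half (\<xi>, \<eta>)" and c' = "- 2 * \<kappa>", OF R _ Rb bound_nonneg, where a = z and b = "- \<i> * of_nat n" and I = 0]
    have ab: "Im ?a < \<kappa>" "Im ?b < \<kappa>" using z kap by auto
    have "(LINT s|lborel. part left_half (Complex s \<kappa>, \<eta>) * ?k s + part right_half (Complex s \<kappa>, \<eta>) * ?k s)
      = - (2 * pi * \<i> * (part left_half (?a, \<eta>) - part left_half (?b, \<eta>))) + 0"
      by (subst Bochner_Integration.integral_add) (use l r ab kap in auto)
    moreover have "part left_half (Complex s \<kappa>, \<eta>) * ?k s + part right_half (Complex s \<kappa>, \<eta>) * ?k s
        = part UNIV (Complex s \<kappa>, \<eta>) * ?k s" for s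
      by (subst part_UNIV_split) (use kap \<eta> in \<open>auto simp: distrib_right\<close>)
    ultimately show ?thesis by simp
  qed
  have "(\<lambda>n. - (2 * pi * \<i> * (part left_half (z, \<eta>) - part left_half (- \<i> * of_nat n, \<eta>)))) \<longlonglongrightarrow> - (2 * pi * \<i> * (part left_half (z, \<eta>) - 0))"
    by (intro tendsto_intros part_left_limit \<eta>)
  moreover have "(\<lambda>n. - (2 * pi * \<i> * (part left_half (z, \<eta>) - part left_half (- \<i> * of_nat n, \<eta>))))
     \<longlonglongrightarrow> (LINT s|lborel. part UNIV (Complex s \<kappa>, \<eta>) / (Complex s \<kappa> - z))"
    unfolding eq[symmetric]
    by (rule cauchy_kernel_limit(2)[OF _ dec]) (use part_UNIV_line_measurable[of t] z kap in \<open>auto simp: \<eta>_def\<close>)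
  ultimately show ?thesis using LIMSEQ_unique by fastforce
qed

text \<open>Splitting the decay \<open>1 / (1 + \<bar>s\<bar> + \<bar>t\<bar>)\<close> of \<open>U\<close> between the two variables leaves an
  absolutely convergent integral in \<open>s\<close> and, after multiplication by \<open>\<gamma>\<close>, in \<open>t\<close>.\<close>

lemma left_decay:
  obtains C where "C \<ge> 0"
    "\<And>z t. norm z \<le> R \<Longrightarrow> Im z \<le> 0 \<Longrightarrow> norm (part left_half (z, Complex t (- \<kappa>))) \<le> C * (1 + \<bar>t\<bar>) powr (- (3/4))"
proof -
  obtain C where C: "C \<ge> 0" "\<And>s t. norm (part UNIV (Complex s \<kappa>, Complex t (- \<kappa>))) \<le> C / (1 + \<bar>s\<bar> + \<bar>t\<bar>)"
    using U_decay by blast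
  define K where "K = (1 + \<bar>R\<bar>) / \<kappa> + 1"
  have K: "K > 0" using kap by (simp add: K_def add_pos_pos add_nonneg_pos)
  define I where "I = (LINT s::real|lborel. (1 + \<bar>s\<bar>) powr (- (5/4)))"
  have int: "integrable lborel (\<lambda>s::real. (1 + \<bar>s\<bar>) powr (- (5/4)))" by (rule integrable_powr_abs) simp
  show ?thesis
  proof
    have I0: "I \<ge> 0" unfolding I_def by (rule Bochner_Integration.integral_nonneg) auto
    show "C * K * I / (2 * pi) \<ge> 0" using C K I0 by simp
    fix z t assume z: "norm z \<le> R" "Im z \<le> 0"
    let ?\<eta> = "Complex t (- \<kappa>)"
    have pt: "norm (part UNIV (Complex s \<kappa>, ?\<eta>) / (Complex s \<kappa> - z)) \<le> C * K * (1 + \<bar>t\<bar>) powr (- (3/4)) * (1 + \<bar>s\<bar>) powr (- (5/4))" for s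
    proof -
      have pos: "0 < 1 + \<bar>s\<bar>" "0 < 1 + \<bar>t\<bar>" "0 < 1 + \<bar>s\<bar> + \<bar>t\<bar>" by (simp_all add: add_pos_nonneg)
      \<comment> \<open>Together with the kernel any positive exponent suffices in \<open>s\<close>.
        In \<open>t\<close> the exponent has to exceed 1/2, to outweigh the square root that
        multiplies the left transform later; 1/4 and 3/4 leave the same margin in both.\<close>
      have "(1 + \<bar>s\<bar>) powr (1/4) * (1 + \<bar>t\<bar>) powr (3/4) \<le> (1 + \<bar>s\<bar> + \<bar>t\<bar>) powr (1/4) * (1 + \<bar>s\<bar> + \<bar>t\<bar>) powr (3/4)"
        by (intro mult_mono powr_mono2) auto
      also have "\<dots> = 1 + \<bar>s\<bar> + \<bar>t\<bar>" using pos by (subst powr_add[symmetric]) simp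
      finally have "C / (1 + \<bar>s\<bar> + \<bar>t\<bar>) \<le> C / ((1 + \<bar>s\<bar>) powr (1/4) * (1 + \<bar>t\<bar>) powr (3/4))"
        using C(1) pos by (intro divide_left_mono) auto
      also have "\<dots> = C * ((1 + \<bar>s\<bar>) powr (- (1/4)) * (1 + \<bar>t\<bar>) powr (- (3/4)))"
        unfolding powr_minus_divide by simp
      finally have 1: "norm (part UNIV (Complex s \<kappa>, ?\<eta>)) \<le> C * ((1 + \<bar>s\<bar>) powr (- (1/4)) * (1 + \<bar>t\<bar>) powr (- (3/4)))"
        using C(2)[of s t] by linarith
      have "1 + \<bar>s\<bar> \<le> ((1 + \<bar>R\<bar>) / \<kappa> + 1) * norm (Complex s \<kappa> - z)"
        by (rule line_distance) (use z kap in auto)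
      moreover have "norm (Complex s \<kappa> - z) > 0" using z kap by (auto simp: complex_eq_iff)
      ultimately have "1 / norm (Complex s \<kappa> - z) \<le> K / (1 + \<bar>s\<bar>)"
        using pos unfolding K_def by (intro one_divide_le) auto
      then have 2: "1 / norm (Complex s \<kappa> - z) \<le> K * (1 + \<bar>s\<bar>) powr (- 1)"
        unfolding powr_minus_divide using pos by simp
      have "norm (part UNIV (Complex s \<kappa>, ?\<eta>) / (Complex s \<kappa> - z)) = norm (part UNIV (Complex s \<kappa>, ?\<eta>)) * (1 / norm (Complex s \<kappa> - z))"
        by (simp add: norm_divide)
      also have "\<dots> \<le> (C * ((1 + \<bar>s\<bar>) powr (- (1/4)) * (1 + \<bar>t\<bar>) powr (- (3/4)))) * (K * (1 + \<bar>s\<bar>) powr (- 1))"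
        using 1 2 C(1) by (intro mult_mono) auto
      also have "\<dots> = C * K * (1 + \<bar>t\<bar>) powr (- (3/4)) * ((1 + \<bar>s\<bar>) powr (- (1/4)) * (1 + \<bar>s\<bar>) powr (- 1))"
        by (simp add: algebra_simps)
      also have "(1 + \<bar>s\<bar>) powr (- (1/4)) * (1 + \<bar>s\<bar>) powr (- 1) = (1 + \<bar>s\<bar>) powr (- (5/4))"
        by (subst powr_add[symmetric]) simp
      finally show ?thesis .
    qed
    have intg: "integrable lborel (\<lambda>s. C * K * (1 + \<bar>t\<bar>) powr (- (3/4)) * (1 + \<bar>s\<bar>) powr (- (5/4)))"
      using int by (rule integrable_mult_right)
    have intf: "integrable lborel (\<lambda>s. part UNIV (Complex s \<kappa>, ?\<eta>) / (Complex s \<kappa> - z))"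
    proof (rule Bochner_Integration.integrable_bound[OF intg])
      have "(\<lambda>s. Complex s \<kappa> - z) \<in> borel_measurable borel"
        unfolding Complex_eq by (intro borel_measurable_continuous_onI continuous_intros)
      then show "(\<lambda>s. part UNIV (Complex s \<kappa>, ?\<eta>) / (Complex s \<kappa> - z)) \<in> borel_measurable lborel"
        using part_UNIV_line_measurable[of t] by (simp add: borel_measurable_divide)
    qed (intro AE_I2 order_trans[OF pt], simp)
    have "2 * pi * norm (part left_half (z, ?\<eta>)) = norm (- (2 * pi * \<i> * part left_half (z, ?\<eta>)))"
      by (simp add: norm_mult)
    also have "\<dots> = norm (LINT s|lborel. part UNIV (Complex s \<kappa>, ?\<eta>) / (Complex s \<kappa> - z))"
      by (subst left_cauchy) (use z kap in auto)
    also have "\<dots> \<le> (LINT s|lborel. C * K * (1 + \<bar>t\<bar>) powr (- (3/4)) * (1 + \<bar>s\<bar>) powr (- (5/4)))"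
      by (rule Bochner_Integration.integral_norm_bound_integral[OF intf intg]) (rule pt)
    also have "\<dots> = C * K * I * (1 + \<bar>t\<bar>) powr (- (3/4))" by (simp add: I_def)
    finally show "norm (part left_half (z, ?\<eta>)) \<le> C * K * I / (2 * pi) * (1 + \<bar>t\<bar>) powr (- (3/4))"
      by (simp add: field_simps)
  qed
qed

subsection \<open>The Wiener-Hopf projection\<close>

text \<open>The argument \<open>s\<close> stands for the inner root at \<open>z\<close> but is free,
  so that one integral covers both shores of the cut and the values on either side of real
  \<open>s\<close>.\<close>

definition J_integrand :: "complex \<times> complex \<times> complex \<Rightarrow> real \<Rightarrow> complex" where
  "J_integrand = (\<lambda>(z, s, w) t. csqrt (s - Complex t (- \<kappa>)) * part left_half (z, Complex t (- \<kappa>)) / (Complex t (- \<kappa>) - w))"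

text \<open>The usual factor is 1 / (2 pi i); the \<i> cancels against the one in the functional
  equation, which \<open>J_integrand\<close> omits.\<close>

definition J :: "complex \<Rightarrow> complex \<Rightarrow> complex \<Rightarrow> complex" where
  "J z s w = (LINT t|lborel. J_integrand (z, s, w) t) / (2 * pi)"

text \<open>The bound on \<open>s\<close> keeps the radicand in the upper half-plane, and the bound
  on \<open>w\<close> keeps the pole above the line of integration. Both leave room below the real
  axis, which the continuation across the boundary uses up.\<close>

definition J_domain :: "(complex \<times> complex \<times> complex) set" where
  "J_domain = {(z, s, w). Im z < 0 \<and> Im s > - \<kappa> \<and> Im w > - \<kappa>}"

lemma csqrt_growth:
  "norm (csqrt (s - Complex t (- \<kappa>))) \<le> sqrt (norm s + \<kappa> + 1) * (1 + \<bar>t\<bar>) powr (1/2)"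
proof -
  have "norm (Complex t (- \<kappa>)) \<le> \<bar>t\<bar> + \<kappa>" using cmod_le[of "Complex t (- \<kappa>)"] kap by simp
  then have "norm (s - Complex t (- \<kappa>)) \<le> norm s + (\<bar>t\<bar> + \<kappa>)"
    using norm_triangle_ineq4[of s "Complex t (- \<kappa>)"] by linarith
  also have "\<dots> \<le> (norm s + \<kappa> + 1) * (1 + \<bar>t\<bar>)"
  proof -
    have "0 \<le> norm s * \<bar>t\<bar>" "0 \<le> \<kappa> * \<bar>t\<bar>" using kap by auto
    then show ?thesis unfolding distrib_left distrib_right by linarith
  qed
  finally have "sqrt (norm (s - Complex t (- \<kappa>))) \<le> sqrt ((norm s + \<kappa> + 1) * (1 + \<bar>t\<bar>))" by simp
  then show ?thesis by (simp add: real_sqrt_mult powr_half_sqrt)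
qed

lemma part_left_continuous:
  "continuous_on {\<xi>. Im (fst \<xi>) \<le> 0 \<and> \<bar>Im (snd \<xi>)\<bar> \<le> \<kappa>} (part left_half)"
  by (rule part_continuous) (use kap in \<open>auto intro!: tame_parts measurable_parts\<close>)

text \<open>The exponents 1/2 from the root, -3/4 from \<open>left_decay\<close> and -1 from the
  kernel add up to -5/4, with constants that are uniform near the given point.\<close>

lemma J_integrand_dominated:
  assumes "p \<in> J_domain"
  shows "\<exists>V g. open V \<and> p \<in> V \<and> integrable lborel g \<and> (\<forall>q\<in>V \<inter> J_domain. \<forall>t\<in>space lborel. norm (J_integrand q t) \<le> g t)"
proof -
  obtain z0 s0 w0 where p: "p = (z0, s0, w0)" by (cases p)
  \<comment> \<open>Half the distance from \<open>w0\<close> to the line: on \<open>V\<close> the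
    pole keeps at least this distance.\<close>
  define \<delta> where "\<delta> = (Im w0 + \<kappa>) / 2"
  have \<delta>: "\<delta> > 0" using assms by (simp add: \<delta>_def p J_domain_def)
  define R where "R = 1 + norm z0 + norm s0 + norm w0"
  have R: "R \<ge> 1" by (simp add: R_def)
  obtain C where C: "C \<ge> 0"
    "\<And>z t. norm z \<le> R \<Longrightarrow> Im z \<le> 0 \<Longrightarrow> norm (part left_half (z, Complex t (- \<kappa>))) \<le> C * (1 + \<bar>t\<bar>) powr (- (3/4))"
    using left_decay by blast
  define K where "K = (1 + R) / \<delta> + 1"
  have K: "K > 0" using R \<delta> by (simp add: K_def add_pos_pos)
  define V :: "(complex \<times> complex \<times> complex) set" where "V = {(z, s, w). norm z < R \<and> norm s < R \<and> norm w < R \<and> Im w > - \<kappa> + \<delta>}"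
  define g where "g = (\<lambda>t::real. sqrt (R + \<kappa> + 1) * C * K * (1 + \<bar>t\<bar>) powr (- (5/4)))"
  have "open V"
    unfolding V_def case_prod_beta by (intro open_Collect_conj open_Collect_less continuous_intros)
  moreover have "p \<in> V"
  proof -
    have "Im w0 > - \<kappa> + \<delta>" using \<delta> by (simp add: \<delta>_def field_simps)
    then show ?thesis unfolding p V_def R_def by (simp add: add_nonneg_pos add_pos_nonneg)
  qed
  moreover have "integrable lborel g"
    unfolding g_def by (intro integrable_mult_right integrable_powr_abs) simp
  moreover have "norm (J_integrand q t) \<le> g t" if q: "q \<in> V" "q \<in> J_domain" for q t
  proof -
    obtain z s w where qq: "q = (z, s, w)" by (cases q)
    have q': "norm z < R" "norm s < R" "norm w < R" "Im w > - \<kappa> + \<delta>" "Im z < 0"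
      using q by (auto simp: qq V_def J_domain_def)
    have pos: "0 < 1 + \<bar>t\<bar>" by (simp add: add_pos_nonneg)
    have "1 + \<bar>t\<bar> \<le> ((1 + R) / \<delta> + 1) * norm (Complex t (- \<kappa>) - w)"
      by (rule line_distance) (use q' \<delta> in auto)
    moreover have "norm (Complex t (- \<kappa>) - w) > 0" using q' \<delta> by (auto simp: complex_eq_iff)
    ultimately have 1: "1 / norm (Complex t (- \<kappa>) - w) \<le> K / (1 + \<bar>t\<bar>)"
      using pos unfolding K_def by (intro one_divide_le) auto
    have "sqrt (norm s + \<kappa> + 1) \<le> sqrt (R + \<kappa> + 1)" using q' by simp
    then have 2: "norm (csqrt (s - Complex t (- \<kappa>))) \<le> sqrt (R + \<kappa> + 1) * (1 + \<bar>t\<bar>) powr (1/2)"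
      using order_trans[OF csqrt_growth mult_right_mono] by auto
    have 3: "norm (part left_half (z, Complex t (- \<kappa>))) \<le> C * (1 + \<bar>t\<bar>) powr (- (3/4))"
      using q' by (intro C) auto
    have "norm (J_integrand q t) = norm (csqrt (s - Complex t (- \<kappa>))) * norm (part left_half (z, Complex t (- \<kappa>))) * (1 / norm (Complex t (- \<kappa>) - w))"
      by (simp add: J_integrand_def qq norm_divide norm_mult del: norm_csqrt)
    also have "\<dots> \<le> (sqrt (R + \<kappa> + 1) * (1 + \<bar>t\<bar>) powr (1/2)) * (C * (1 + \<bar>t\<bar>) powr (- (3/4))) * (K / (1 + \<bar>t\<bar>))"
      using 1 2 3 C(1) R kap by (intro mult_mono mult_nonneg_nonneg) auto
    also have "K / (1 + \<bar>t\<bar>) = K * (1 + \<bar>t\<bar>) powr (- 1)"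
      unfolding powr_minus_divide using pos by simp
    also have "(sqrt (R + \<kappa> + 1) * (1 + \<bar>t\<bar>) powr (1/2)) * (C * (1 + \<bar>t\<bar>) powr (- (3/4))) * (K * (1 + \<bar>t\<bar>) powr (- 1))
       = sqrt (R + \<kappa> + 1) * C * K * ((1 + \<bar>t\<bar>) powr (1/2) * (1 + \<bar>t\<bar>) powr (- (3/4)) * (1 + \<bar>t\<bar>) powr (- 1))"
      by simp
    also have "(1 + \<bar>t\<bar>) powr (1/2) * (1 + \<bar>t\<bar>) powr (- (3/4)) * (1 + \<bar>t\<bar>) powr (- 1) = (1 + \<bar>t\<bar>) powr (- (5/4))"
      unfolding powr_add[symmetric] by simp
    finally show ?thesis by (simp add: g_def)
  qed
  ultimately show ?thesis by blast
qed

lemma J_integrand_measurable: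
  assumes "p \<in> J_domain" shows "J_integrand p \<in> borel_measurable lborel"
proof -
  obtain z s w where p: "p = (z, s, w)" by (cases p)
  have d: "Im z < 0" "Im s > - \<kappa>" "Im w > - \<kappa>" using assms by (auto simp: p J_domain_def)
  have cl: "continuous_on UNIV (\<lambda>t. Complex t (- \<kappa>))" unfolding Complex_eq by (intro continuous_intros)
  have "continuous_on UNIV (J_integrand p)"
    unfolding p J_integrand_def prod.case
  proof (intro continuous_intros cl)
    show "continuous_on UNIV (\<lambda>t. csqrt (s - Complex t (- \<kappa>)))"
      by (rule continuous_on_compose2[OF continuous_on_csqrt_upper]) (use d in \<open>auto intro!: continuous_intros cl\<close>)
    show "continuous_on UNIV (\<lambda>t. part left_half (z, Complex t (- \<kappa>)))"
      by (rule continuous_on_compose2[OF part_left_continuous]) (use d kap in \<open>auto intro!: continuous_intros cl\<close>)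
  qed (use d in \<open>auto simp: complex_eq_iff\<close>)
  then show ?thesis by (simp add: borel_measurable_continuous_onI)
qed

lemma J_continuous: "continuous_on J_domain (\<lambda>(z, s, w). J z s w)"
proof -
  have "continuous_on J_domain (\<lambda>p. LINT t|lborel. J_integrand p t)"
  proof (rule continuous_on_param_lebesgue_integral)
    show "continuous_on J_domain (\<lambda>p. J_integrand p t)" for t
      unfolding J_integrand_def case_prod_beta
    proof (intro continuous_intros)
      show "continuous_on J_domain (\<lambda>x. csqrt (fst (snd x) - Complex t (- \<kappa>)))"
        by (rule continuous_on_compose2[OF continuous_on_csqrt_upper]) (auto intro!: continuous_intros simp: J_domain_def)
      show "continuous_on J_domain (\<lambda>x. part left_half (fst x, Complex t (- \<kappa>)))"
        by (rule continuous_on_compose2[OF part_left_continuous]) (use kap in \<open>auto intro!: continuous_intros simp: J_domain_def\<close>)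
    qed (auto simp: J_domain_def complex_eq_iff)
  qed (use J_integrand_dominated J_integrand_measurable in auto)
  then show ?thesis unfolding J_def case_prod_beta by (auto intro!: continuous_intros)
qed

text \<open>Stated for holomorphic substitutions, because \<open>s\<close> will be the inner root,
  its continuation across the cut, or the coordinate itself.\<close>

lemma J_holomorphic:
  assumes S: "open S" and a: "a holomorphic_on S" and b: "b holomorphic_on S" and c: "c holomorphic_on S"
    and dom: "\<And>x. x \<in> S \<Longrightarrow> (a x, b x, c x) \<in> J_domain"
  shows "(\<lambda>x. J (a x) (b x) (c x)) holomorphic_on S"
proof -
  have d: "Im (a x) < 0" "Im (b x) > - \<kappa>" "Im (c x) > - \<kappa>" if "x \<in> S" for x
    using dom[OF that] by (auto simp: J_domain_def)
  have "(\<lambda>x. LINT t|lborel. J_integrand (a x, b x, c x) t) holomorphic_on S"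
  proof (rule holomorphic_on_param_lebesgue_integral[OF S])
    fix t :: real
    have "(\<lambda>x. csqrt (b x - Complex t (- \<kappa>))) holomorphic_on S"
      by (intro holomorphic_on_csqrt_upper holomorphic_on_diff b holomorphic_on_const) (drule d(2), simp)
    moreover have "(\<lambda>x. part left_half (a x, Complex t (- \<kappa>))) holomorphic_on S"
      by (intro part_holomorphic measurable_parts S a holomorphic_on_const tame_parts; drule d(1), insert kap, simp)
    ultimately show "(\<lambda>x. J_integrand (a x, b x, c x) t) holomorphic_on S"
      unfolding J_integrand_def prod.case
      by (intro holomorphic_on_divide holomorphic_on_mult holomorphic_on_diff c holomorphic_on_const)
         (auto simp: complex_eq_iff dest: d(3))
  next
    fix x assume x: "x \<in> S"
    show "J_integrand (a x, b x, c x) \<in> borel_measurable lborel"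
      using dom[OF x] by (rule J_integrand_measurable)
    obtain V g where V: "open V" "(a x, b x, c x) \<in> V" "integrable lborel g"
      "\<And>q t. q \<in> V \<Longrightarrow> q \<in> J_domain \<Longrightarrow> norm (J_integrand q t) \<le> g t"
      using J_integrand_dominated[OF dom[OF x]] by auto
    have "continuous_on S (\<lambda>x. (a x, b x, c x))"
      using a b c by (intro continuous_intros holomorphic_on_imp_continuous_on)
    then have "open ((\<lambda>x. (a x, b x, c x)) -` V \<inter> S)"
      using S V(1) by (simp add: continuous_on_open_vimage)
    then show "\<exists>V g. open V \<and> x \<in> V \<and> integrable lborel g \<and>
        (\<forall>q\<in>V \<inter> S. \<forall>t\<in>space lborel. norm (J_integrand (a q, b q, c q) t) \<le> g t)"
      using V x dom by (intro exI[of _ "(\<lambda>x. (a x, b x, c x)) -` V \<inter> S"] exI[of _ g]) auto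
  qed
  then show ?thesis unfolding J_def by (intro holomorphic_intros) auto
qed

end

text \<open>Here A = z + k1, E = \<eta> + k2 and S = c + c2, while \<open>l\<close> and
  \<open>q\<close> are the transforms over the left half-plane and the lower quadrant. The left side
  is P - M. The last bracket on the right vanishes in the application, because c^2 - c2^2 = -
  E.\<close>

lemma wiener_hopf_split:
  fixes A E S c c2 l q i :: complex
  shows "i * c * (l + (1 / (A * E) + q)) - i * c2 / (A * E) - (- i / (A * S) + i * c * q)
      = i * c * l + i / A * ((c - c2) / E + 1 / S)"
  by (simp add: divide_inverse algebra_simps)

context spectral_data
begin

section \<open>The continuation formula and its proof on the strip\<close>

definition ext :: "complex \<Rightarrow> complex \<Rightarrow> complex \<Rightarrow> complex" where
  "ext z s w = csqrt (s + w) * (\<i> * csqrt (s + k2) / ((z + k1) * (w + k2)) + J z s w)"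

text \<open>For fixed \<open>z\<close> the functional equation is a scalar Wiener-Hopf equation in \<open>w\<close>: dividing by
  \<open>csqrt (b + w)\<close> leaves \<open>P\<close>, analytic above, minus \<open>M\<close>, analytic below, equal to the
  contribution of \<open>x1 < 0\<close>. The pole of the quadrant term at \<open>- k2\<close> is shared out so that \<open>M\<close> has none.\<close>

lemma W_eq_ext:
  assumes z: "- 2 * \<kappa> < Im z" "Im z < 0" and w: "Im w > - \<kappa>"
  shows "fourier \<omega> (z, w) = ext z (inner_root k z) w"
proof -
  define b where "b = inner_root k z"
  have b: "Im b > 2 * \<kappa>" unfolding b_def by (rule Im_inner_root_strip) (use z kap in auto)
  define c2 where "c2 = csqrt (b + k2)"
  have c2: "Re c2 > 0" "Im c2 > 0" using csqrt_Im_pos[of "b + k2"] b kap by (auto simp: c2_def)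
  have zk: "z + k1 \<noteq> 0" using z kap by (auto simp: complex_eq_iff)
  define P where "P = (\<lambda>\<eta>. fourier \<omega> (z, \<eta>) / csqrt (b + \<eta>) - \<i> * c2 / ((z + k1) * (\<eta> + k2)))"
  \<comment> \<open>The first term is the remainder (csqrt (b - \<eta>) - c2) / (\<eta> + k2) of the
    quadrant term after rationalising: the numerator vanishes at \<eta> = - k2, and the new
    denominator has positive real part.\<close>
  define M where "M = (\<lambda>\<eta>. - \<i> / ((z + k1) * (csqrt (b - \<eta>) + c2)) + \<i> * csqrt (b - \<eta>) * part lower_quadrant (z, \<eta>))"
  define V where "V = (\<lambda>t. \<i> * csqrt (b - Complex t (- \<kappa>)) * part left_half (z, Complex t (- \<kappa>)))"
  \<comment> \<open>\<open>W_bounded\<close> is applied with - Im z as its first height, which has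
    to be below 2 \<kappa>; this confines \<open>z\<close> to the strip.\<close>
  obtain B where B: "B \<ge> 0" "\<And>\<eta>. Im \<eta> \<ge> - \<kappa> \<Longrightarrow> norm (fourier \<omega> (z, \<eta>)) \<le> B"
  proof -
    obtain B where "B \<ge> 0" "\<And>z' w. Im z' \<ge> - (- Im z) \<Longrightarrow> Im w \<ge> - \<kappa> \<Longrightarrow> norm (fourier \<omega> (z', w)) \<le> B"
      using W_bounded[of "- Im z" \<kappa>] z kap by auto
    then show ?thesis using that by auto
  qed
  have open_half: "open {z. Im z < c}" "open {z. Im z > c}" for c
    by (intro open_Collect_less continuous_intros)+

  \<comment> \<open>On Im \<eta> \<ge> - \<kappa> the bound Im b > 2 \<kappa> leaves \<kappa> for b
    + \<eta>, and Im k2 \<ge> 4 \<kappa> leaves 3 \<kappa> for \<eta> + k2.\<close>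
  define CP where "CP = B / sqrt \<kappa> + norm (c2 / (z + k1)) / (3 * \<kappa>)"
  have CP0: "CP \<ge> 0" unfolding CP_def using B kap by simp
  have P_split: "norm (P \<eta>) \<le> norm (fourier \<omega> (z, \<eta>)) / sqrt (norm (b + \<eta>)) + norm (c2 / (z + k1)) / norm (\<eta> + k2)" for \<eta>
    unfolding P_def by (rule order_trans[OF norm_triangle_ineq4]) (simp add: norm_divide norm_mult)
  have P_bound: "norm (P \<eta>) \<le> CP * (1 + norm \<eta>) powr (1/2)" if \<eta>: "Im \<eta> \<ge> - \<kappa>" for \<eta>
  proof -
    have "norm (b + \<eta>) \<ge> \<kappa>" using abs_Im_le_cmod[of "b + \<eta>"] b \<eta> by simp
    then have "norm (fourier \<omega> (z, \<eta>)) / sqrt (norm (b + \<eta>)) \<le> B / sqrt \<kappa>"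
      using B(1) B(2)[OF \<eta>] kap by (intro frac_le) auto
    moreover have "norm (\<eta> + k2) \<ge> 3 * \<kappa>" using abs_Im_le_cmod[of "\<eta> + k2"] \<eta> kap by simp
    then have "norm (c2 / (z + k1)) / norm (\<eta> + k2) \<le> norm (c2 / (z + k1)) / (3 * \<kappa>)"
      using kap by (intro frac_le) auto
    ultimately have "norm (P \<eta>) \<le> CP" using P_split[of \<eta>] unfolding CP_def by linarith
    then show ?thesis using mult_left_mono[OF one_le_half_growth[of \<eta>] CP0] by linarith
  qed
  have P_holo: "P holomorphic_on {\<eta>. Im \<eta> > - 2 * \<kappa>}"
  proof -
    have ne: "b + \<eta> \<noteq> 0" "\<eta> + k2 \<noteq> 0" if "Im \<eta> > - 2 * \<kappa>" for \<eta>
      using that b kap by (auto simp: complex_eq_iff)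
    have "(\<lambda>\<eta>. fourier \<omega> (z, \<eta>)) holomorphic_on {\<eta>. Im \<eta> > - 2 * \<kappa>}"
      by (intro W_holomorphic(2) open_half holomorphic_on_ident) (use z in \<open>auto simp: initial_domain_def\<close>)
    moreover have "(\<lambda>\<eta>. csqrt (b + \<eta>)) holomorphic_on {\<eta>. Im \<eta> > - 2 * \<kappa>}"
      by (intro holomorphic_on_csqrt_upper holomorphic_intros) (use b in auto)
    ultimately show ?thesis
      unfolding P_def
      by (intro holomorphic_on_diff holomorphic_on_divide holomorphic_on_mult holomorphic_on_add holomorphic_on_const holomorphic_on_ident)
         (use ne zk in auto)
  qed

  \<comment> \<open>The root times the merely bounded lower-quadrant transform is what makes growth
    of order 1/2 necessary in the Cauchy lemmas.\<close>
  define CM where "CM = 1 / (norm (z + k1) * Re c2) + sqrt (norm b + 1) * bound"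
  have CM0: "CM \<ge> 0" unfolding CM_def using c2 bound_nonneg by simp
  have M_bound: "norm (M \<eta>) \<le> CM * (1 + norm \<eta>) powr (1/2)" if \<eta>: "Im \<eta> \<le> - \<kappa>" for \<eta>
  proof -
    have "Re (csqrt (b - \<eta>) + c2) \<ge> Re c2" using Re_csqrt[of "b - \<eta>"] by simp
    then have "norm (csqrt (b - \<eta>) + c2) \<ge> Re c2" using complex_Re_le_cmod order_trans by blast
    then have "norm (- \<i> / ((z + k1) * (csqrt (b - \<eta>) + c2))) \<le> 1 / (norm (z + k1) * Re c2)"
      unfolding norm_divide norm_mult using c2 zk by (intro frac_le mult_left_mono) auto
    also have "\<dots> \<le> 1 / (norm (z + k1) * Re c2) * (1 + norm \<eta>) powr (1/2)"
      using mult_left_mono[OF one_le_half_growth[of \<eta>], of "1 / (norm (z + k1) * Re c2)"] c2 by simp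
    finally have 1: "norm (- \<i> / ((z + k1) * (csqrt (b - \<eta>) + c2))) \<le> \<dots>" .
    have "norm (b - \<eta>) \<le> norm b + norm \<eta>" by (rule norm_triangle_ineq4)
    also have "\<dots> \<le> (norm b + 1) * (1 + norm \<eta>)"
    proof -
      have "0 \<le> norm b * norm \<eta>" by simp
      then show ?thesis unfolding distrib_left distrib_right by simp
    qed
    finally have "sqrt (norm (b - \<eta>)) \<le> sqrt ((norm b + 1) * (1 + norm \<eta>))" by simp
    then have 2: "norm (csqrt (b - \<eta>)) \<le> sqrt (norm b + 1) * (1 + norm \<eta>) powr (1/2)"
      by (simp add: real_sqrt_mult powr_half_sqrt)
    have "norm (part lower_quadrant (z, \<eta>)) \<le> bound"
      by (rule part_bound) (use z \<eta> kap in \<open>auto intro!: measurable_parts tame_parts\<close>)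
    then have "norm (csqrt (b - \<eta>)) * norm (part lower_quadrant (z, \<eta>)) \<le> (sqrt (norm b + 1) * (1 + norm \<eta>) powr (1/2)) * bound"
      using 2 by (intro mult_mono) auto
    then have 3: "norm (\<i> * csqrt (b - \<eta>) * part lower_quadrant (z, \<eta>)) \<le> sqrt (norm b + 1) * bound * (1 + norm \<eta>) powr (1/2)"
      by (simp add: norm_mult mult_ac)
    show ?thesis
      unfolding M_def CM_def distrib_right[of "1 / (norm (z + k1) * Re c2)"] by (rule norm_triangle_mono[OF 1 3])
  qed
  have M_holo: "M holomorphic_on {\<eta>. Im \<eta> < 2 * \<kappa>}"
  proof -
    have c: "(\<lambda>\<eta>. csqrt (b - \<eta>)) holomorphic_on {\<eta>. Im \<eta> < 2 * \<kappa>}"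
      by (intro holomorphic_on_csqrt_upper holomorphic_intros) (use b in auto)
    have p: "(\<lambda>\<eta>. part lower_quadrant (z, \<eta>)) holomorphic_on {\<eta>. Im \<eta> < 2 * \<kappa>}"
      by (intro part_holomorphic measurable_parts open_half holomorphic_on_const holomorphic_on_ident tame_parts) (use z kap in auto)
    have ne: "csqrt (b - \<eta>) + c2 \<noteq> 0" for \<eta>
    proof -
      have "Re (csqrt (b - \<eta>) + c2) > 0" using Re_csqrt[of "b - \<eta>"] c2 by simp
      then show ?thesis by (metis less_irrefl zero_complex.sel(1))
    qed
    show ?thesis
      unfolding M_def
      by (intro holomorphic_on_add holomorphic_on_divide holomorphic_on_mult holomorphic_on_const c p) (use zk ne in auto)
  qed

  have split: "P (Complex t (- \<kappa>)) - M (Complex t (- \<kappa>)) = V t" for t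
  proof -
    let ?\<eta> = "Complex t (- \<kappa>)"
    define c where "c = csqrt (b - ?\<eta>)"
    have c: "Re c > 0" using csqrt_Im_pos[of "b - ?\<eta>"] b kap by (simp add: c_def)
    have ne: "c + c2 \<noteq> 0"
    proof -
      have "Re (c + c2) > 0" using c c2 by simp
      then show ?thesis by (metis less_irrefl zero_complex.sel(1))
    qed
    have ek: "?\<eta> + k2 \<noteq> 0" using kap by (auto simp: complex_eq_iff)
    have cb: "csqrt (b + ?\<eta>) \<noteq> 0" using b kap by (simp, auto simp: complex_eq_iff)
    have "fourier \<omega> (z, ?\<eta>) = \<i> * csqrt (b + ?\<eta>) * c * (part left_half (z, ?\<eta>) + (1 / ((z + k1) * (?\<eta> + k2)) + part lower_quadrant (z, ?\<eta>)))"
      unfolding c_def b_def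
      by (subst part_right_split[symmetric]; (subst part_UNIV_split[symmetric])?; (subst functional_eq_strip)?) (use z kap in auto)
    then have "fourier \<omega> (z, ?\<eta>) / csqrt (b + ?\<eta>) = \<i> * c * (part left_half (z, ?\<eta>) + (1 / ((z + k1) * (?\<eta> + k2)) + part lower_quadrant (z, ?\<eta>)))"
      using cb by simp
    then have eq: "P ?\<eta> - M ?\<eta> = V t + \<i> / (z + k1) * ((c - c2) / (?\<eta> + k2) + 1 / (c + c2))"
      unfolding P_def M_def V_def c_def[symmetric] by (simp only: wiener_hopf_split)
    have "(c - c2) * (c + c2) = c\<^sup>2 - c2\<^sup>2" by (simp add: power2_eq_square algebra_simps)
    also have "\<dots> = - (?\<eta> + k2)" by (simp add: c_def c2_def)
    finally have "(c - c2) / (?\<eta> + k2) = - 1 / (c + c2)"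
      using ne ek by (subst frac_eq_eq) auto
    then show ?thesis using eq by simp
  qed

  have V_measurable: "V \<in> borel_measurable borel"
  proof (rule borel_measurable_continuous_onI)
    have cl: "continuous_on UNIV (\<lambda>t. Complex t (- \<kappa>))" unfolding Complex_eq by (intro continuous_intros)
    show "continuous_on UNIV V"
      unfolding V_def
    proof (intro continuous_intros)
      show "continuous_on UNIV (\<lambda>t. csqrt (b - Complex t (- \<kappa>)))"
        by (rule continuous_on_compose2[OF continuous_on_csqrt_upper]) (use b kap in \<open>auto intro!: continuous_intros cl\<close>)
      show "continuous_on UNIV (\<lambda>t. part left_half (z, Complex t (- \<kappa>)))"
        by (rule continuous_on_compose2[OF part_left_continuous]) (use z kap in \<open>auto intro!: continuous_intros cl\<close>)
    qed
  qed
  obtain C where C: "C \<ge> 0"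
    "\<And>z' t. norm z' \<le> norm z \<Longrightarrow> Im z' \<le> 0 \<Longrightarrow> norm (part left_half (z', Complex t (- \<kappa>))) \<le> C * (1 + \<bar>t\<bar>) powr (- (3/4))"
    using left_decay by blast
  have V_decay: "norm (V t) \<le> sqrt (norm b + \<kappa> + 1) * C * (1 + \<bar>t\<bar>) powr (- (1/4))" for t
  proof -
    have "norm (V t) = norm (csqrt (b - Complex t (- \<kappa>))) * norm (part left_half (z, Complex t (- \<kappa>)))"
      by (simp add: V_def norm_mult)
    also have "\<dots> \<le> (sqrt (norm b + \<kappa> + 1) * (1 + \<bar>t\<bar>) powr (1/2)) * (C * (1 + \<bar>t\<bar>) powr (- (3/4)))"
      using z kap by (intro mult_mono csqrt_growth C(2)) auto
    also have "\<dots> = sqrt (norm b + \<kappa> + 1) * C * ((1 + \<bar>t\<bar>) powr (1/2) * (1 + \<bar>t\<bar>) powr (- (3/4)))" by simp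
    also have "(1 + \<bar>t\<bar>) powr (1/2) * (1 + \<bar>t\<bar>) powr (- (3/4)) = (1 + \<bar>t\<bar>) powr (- (1/4))"
      unfolding powr_add[symmetric] by simp
    finally show ?thesis .
  qed
  let ?c = "- \<kappa>"
  \<comment> \<open>Both poles lie above the line, so \<open>P\<close> contributes its values there
    and \<open>M\<close>, closed downwards, contributes nothing.\<close>
  have eq: "(LINT t|lborel. V t * (1 / (Complex t ?c - w) - 1 / (Complex t ?c - \<i> * of_real (1 * real n))))
      = 2 * pi * \<i> * (P w - P (\<i> * of_real (1 * real n)))" for n
  proof -
    let ?b = "\<i> * of_real (1 * real n)"
    let ?k = "\<lambda>t. 1 / (Complex t ?c - w) - 1 / (Complex t ?c - ?b)"
    have ab: "Im w > ?c" "Im ?b > ?c" using w kap by auto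
    note p = upper_half_plane_cauchy[where c = ?c and f = P and a = w and b = ?b and I = "2 * pi * \<i> * (P w - P ?b)", OF P_holo _ P_bound CP0]
    note m = lower_half_plane_cauchy[where c = ?c and f = M and a = w and b = ?b and I = 0, OF M_holo _ M_bound CM0]
    have "(LINT t|lborel. P (Complex t ?c) * ?k t - M (Complex t ?c) * ?k t) = 2 * pi * \<i> * (P w - P ?b) - 0"
      by (subst Bochner_Integration.integral_diff) (use p m ab kap in auto)
    then show ?thesis by (simp flip: split add: left_diff_distrib)
  qed
  \<comment> \<open>The numerator of the first term of \<open>P\<close> is bounded while its root
    grows, and the second term decays like 1 / n. The value at the second pole therefore drops out
    and \<open>P w\<close> alone remains.\<close>
  have P_lim: "(\<lambda>n. P (\<i> * of_real (1 * real n))) \<longlonglongrightarrow> 0"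
  proof (rule Lim_null_comparison)
    show "\<forall>\<^sub>F n in sequentially. norm (P (\<i> * of_real (1 * real n))) \<le> B / sqrt (real n) + norm (c2 / (z + k1)) / real n"
      using eventually_gt_at_top[of 0]
    proof eventually_elim
      case (elim n)
      let ?\<eta> = "\<i> * of_real (1 * real n)"
      have "norm (b + ?\<eta>) \<ge> real n" using abs_Im_le_cmod[of "b + ?\<eta>"] b kap by simp
      then have "norm (fourier \<omega> (z, ?\<eta>)) / sqrt (norm (b + ?\<eta>)) \<le> B / sqrt (real n)"
        using B(1) B(2)[of ?\<eta>] kap elim by (intro frac_le) auto
      moreover have "norm (?\<eta> + k2) \<ge> real n" using abs_Im_le_cmod[of "?\<eta> + k2"] kap by simp
      then have "norm (c2 / (z + k1)) / norm (?\<eta> + k2) \<le> norm (c2 / (z + k1)) / real n"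
        using elim by (intro frac_le) auto
      ultimately show ?case using P_split[of ?\<eta>] by linarith
    qed
    have "(\<lambda>n. 1 / sqrt (real n)) \<longlonglongrightarrow> 0" "(\<lambda>n. 1 / real n) \<longlonglongrightarrow> 0"
      by real_asymp+
    from tendsto_add[OF tendsto_mult_right_zero[OF this(1), of B] tendsto_mult_right_zero[OF this(2), of "norm (c2 / (z + k1))"]]
    show "(\<lambda>n. B / sqrt (real n) + norm (c2 / (z + k1)) / real n) \<longlonglongrightarrow> 0" by simp
  qed
  have "(\<lambda>n. 2 * pi * \<i> * (P w - P (\<i> * of_real (1 * real n)))) \<longlonglongrightarrow> 2 * pi * \<i> * (P w - 0)"
    by (intro tendsto_intros P_lim)
  then have lim: "(\<lambda>n. 2 * pi * \<i> * (P w - P (\<i> * of_real (1 * real n)))) \<longlonglongrightarrow> 2 * pi * \<i> * P w"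
    by simp
  have "(\<lambda>n. 2 * pi * \<i> * (P w - P (\<i> * of_real (1 * real n)))) \<longlonglongrightarrow> (LINT t|lborel. V t / (Complex t ?c - w))"
    unfolding eq[symmetric]
    by (rule cauchy_kernel_limit(2)[where s = 1, OF V_measurable V_decay]) (use w kap in auto)
  then have 1: "(LINT t|lborel. V t / (Complex t ?c - w)) = 2 * pi * \<i> * P w"
    using lim by (rule LIMSEQ_unique)
  have "V t / (Complex t ?c - w) = \<i> * J_integrand (z, b, w) t" for t
    by (simp add: V_def J_integrand_def)
  then have "(LINT t|lborel. V t / (Complex t ?c - w)) = \<i> * (2 * pi * J z b w)"
    by (simp add: J_def)
  then have JP: "J z b w = P w" using 1 by simp
  have "csqrt (b + w) \<noteq> 0" using b w kap by (simp, auto simp: complex_eq_iff)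
  then show ?thesis
    unfolding ext_def b_def[symmetric] JP P_def c2_def by simp
qed

end

subsection \<open>The continuation and its boundary behaviour\<close>

lemma holo2_on_subset: "holo2_on f S \<Longrightarrow> T \<subseteq> S \<Longrightarrow> holo2_on f T"
  by (auto simp: holo2_on_def)

lemma holo2_on_Un: "holo2_on f (S \<union> T) \<longleftrightarrow> holo2_on f S \<and> holo2_on f T"
  by (auto simp: holo2_on_def)

lemma open_H_minus: "open (H_minus k)"
proof -
  have "H_minus k = {z. Im z < 0} \<inter> (\<lambda>z. k\<^sup>2 - z\<^sup>2) -` (- \<real>\<^sub>\<ge>\<^sub>0)"
    by (auto simp: H_minus_iff inner_root_def Im_sqrt_up_pos_iff)
  moreover have "open ((\<lambda>z. k\<^sup>2 - z\<^sup>2) -` (- \<real>\<^sub>\<ge>\<^sub>0))"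
    by (intro open_vimage continuous_intros) auto
  ultimately show ?thesis by (auto simp: open_halfspace_Im_lt)
qed

text \<open>The symmetry of s^2 + z^2 = k^2 recovers \<open>z\<close> from its inner root; this
  makes \<open>s\<close> a coordinate near the tip of the cut.\<close>

lemma inner_root_retract:
  assumes "Im z < 0" shows "- sqrt_up (k\<^sup>2 - (inner_root k z)\<^sup>2) = z"
proof -
  have "sqrt_up (k\<^sup>2 - (inner_root k z)\<^sup>2) = - z"
    by (rule sqrt_up_unique) (use assms in \<open>auto simp: inner_root_square\<close>)
  then show ?thesis by simp
qed

lemma csqrt_diff:
  assumes "Im x > 0" "Im y > 0"
  shows "csqrt x + csqrt y \<noteq> 0" "csqrt x - csqrt y = (x - y) / (csqrt x + csqrt y)"
proof -
  have "Re (csqrt x + csqrt y) > 0" using csqrt_Im_pos(1)[OF assms(1)] csqrt_Im_pos(1)[OF assms(2)] by simp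
  then show ne: "csqrt x + csqrt y \<noteq> 0" by (metis less_irrefl zero_complex.sel(1))
  have "(csqrt x - csqrt y) * (csqrt x + csqrt y) = (csqrt x)\<^sup>2 - (csqrt y)\<^sup>2"
    by (simp add: power2_eq_square algebra_simps)
  then show "csqrt x - csqrt y = (x - y) / (csqrt x + csqrt y)"
    using ne by (simp add: eq_divide_eq)
qed

lemma continuous_on_csqrt_upper':
  "continuous_on A f \<Longrightarrow> (\<And>x. x \<in> A \<Longrightarrow> Im (f x) \<ge> 0) \<Longrightarrow> continuous_on A (\<lambda>x. csqrt (f x))"
  by (rule continuous_on_compose2[OF continuous_on_csqrt_upper]) auto

text \<open>Here A = z + k1 and B = w + k2; \<open>x\<close> and \<open>y\<close> are the two roots
  at \<open>z\<close>, \<open>x0\<close> and \<open>y0\<close> those at the pole, and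
  \<open>j\<close> is the value of \<open>J\<close>. The singularity is gathered in the quotient (x
  y - x0 y0) / A.\<close>

lemma pole_split:
  fixes A B x y x0 y0 j i :: complex
  shows "x * (i * y / (A * B) + j) - 1 / A * (i * x0 * y0 / B) = i / B * ((x * y - x0 * y0) / A) + x * j"
  by (simp add: divide_inverse algebra_simps)

lemma continuous_on_holomorphic_fst:
  assumes "f holomorphic_on Z" "fst ` T \<subseteq> Z"
  shows "continuous_on T (\<lambda>p. f (fst p))"
  by (rule continuous_on_compose2[OF holomorphic_on_imp_continuous_on[OF assms(1)] continuous_on_fst[OF continuous_on_id] assms(2)])

context spectral_data
begin

lemma continuous_on_J [continuous_intros]:
  assumes "continuous_on A f" "continuous_on A g" "continuous_on A h"
    and "\<And>x. x \<in> A \<Longrightarrow> Im (f x) < 0" "\<And>x. x \<in> A \<Longrightarrow> Im (g x) > - \<kappa>" "\<And>x. x \<in> A \<Longrightarrow> Im (h x) > - \<kappa>"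
  shows "continuous_on A (\<lambda>x. J (f x) (g x) (h x))"
proof -
  have "continuous_on A (\<lambda>x. (\<lambda>(z, s, w). J z s w) (f x, g x, h x))"
    by (rule continuous_on_compose2[OF J_continuous])
       (use assms in \<open>auto intro!: continuous_on_Pair simp: J_domain_def\<close>)
  then show ?thesis by simp
qed

text \<open>The pole is an interior point of the cut half-plane because \<open>k1\<close> avoids the
  reflected cut; as the inner root is even, its value there is
  \<open>inner_root k k1\<close>.\<close>

lemma minus_k1: "- k1 \<in> H_minus k" "Im (inner_root k k1) > 0" "- k1 \<notin> h_minus k"
proof -
  show nin: "- k1 \<notin> h_minus k" using k1_cut by (simp add: minus_h_plus)
  then show "- k1 \<in> H_minus k" using kap by (simp add: H_minus_def)
  then show "Im (inner_root k k1) > 0" by (simp add: H_minus_iff inner_root_even)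
qed

lemma radicand_tau: "k\<^sup>2 - (of_real \<tau>)\<^sup>2 \<notin> \<real>\<^sub>\<ge>\<^sub>0"
proof -
  have "Im (k\<^sup>2 - (of_real \<tau>)\<^sup>2) = \<epsilon>" unfolding k by (simp add: power2_eq_square)
  then show ?thesis using eps by (auto simp: complex_nonneg_Reals_iff)
qed

lemma P_point_props: "Im (- sqrt_up (k\<^sup>2 - (of_real \<tau>)\<^sup>2)) < 0" "- sqrt_up (k\<^sup>2 - (of_real \<tau>)\<^sup>2) \<noteq> - k1"
proof -
  show "Im (- sqrt_up (k\<^sup>2 - (of_real \<tau>)\<^sup>2)) < 0"
    using radicand_tau[of \<tau>] by (simp add: Im_sqrt_up_pos_iff)
  have "- sqrt_up (k\<^sup>2 - (of_real \<tau>)\<^sup>2) \<in> h_minus k" by (auto simp: h_minus_def)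
  then show "- sqrt_up (k\<^sup>2 - (of_real \<tau>)\<^sup>2) \<noteq> - k1" using minus_k1(3) by auto
qed

section \<open>The continued function and its pole\<close>

definition continuation :: "complex \<times> complex \<Rightarrow> complex" where
  "continuation = (\<lambda>(z, w). if (z, w) \<in> initial_domain \<kappa> then fourier \<omega> (z, w) else ext z (inner_root k z) w)"

lemma continuation_initial: "\<xi> \<in> initial_domain \<kappa> \<Longrightarrow> continuation \<xi> = fourier \<omega> \<xi>"
  by (cases \<xi>) (simp add: continuation_def)

text \<open>On the overlap with the initial domain the two branches of the case distinction agree by
  \<open>W_eq_ext\<close>.\<close>

lemma continuation_ext:
  assumes "Im z < 0" "Im w > - \<kappa>"
  shows "continuation (z, w) = ext z (inner_root k z) w"
proof (cases "(z, w) \<in> initial_domain \<kappa>")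
  case True
  then have "- 2 * \<kappa> < Im z" by (simp add: initial_domain_def)
  then show ?thesis using True W_eq_ext[OF _ assms] by (simp add: continuation_def)
qed (simp add: continuation_def)

text \<open>The requirement Im (b z + w) > 0 concerns the sum only. One of the two arguments may dip
  below the real axis while the other compensates, and this is how each boundary element outside the
  corner gets a full polydisc.\<close>

lemma ext_holo2:
  assumes Z: "open Z" and Y: "open Y" and a: "a holomorphic_on Z" and b: "b holomorphic_on Z"
    and Za: "\<And>z. z \<in> Z \<Longrightarrow> Im (a z) < 0" "\<And>z. z \<in> Z \<Longrightarrow> a z \<noteq> - k1" "\<And>z. z \<in> Z \<Longrightarrow> Im (b z) > - \<kappa>"
    and Yw: "\<And>w. w \<in> Y \<Longrightarrow> Im w > - \<kappa>"
    and ZY: "\<And>z w. z \<in> Z \<Longrightarrow> w \<in> Y \<Longrightarrow> Im (b z + w) > 0"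
  shows "holo2_on (\<lambda>(z, w). ext (a z) (b z) w) (Z \<times> Y)"
proof (rule holo2_on_separately)
  have ne: "a z + k1 \<noteq> 0" if "z \<in> Z" for z using Za(2)[OF that] by (metis add_eq_0_iff2)
  have ne2: "w + k2 \<noteq> 0" if "w \<in> Y" for w using Yw[OF that] kap by (auto simp: complex_eq_iff)
  have ib: "Im (b z + k2) > 0" if "z \<in> Z" for z using Za(3)[OF that] kap by simp
  show "open (Z \<times> Y)" using Z Y by (rule open_Times)
  have ca: "continuous_on (Z \<times> Y) (\<lambda>p. a (fst p))" and cb: "continuous_on (Z \<times> Y) (\<lambda>p. b (fst p))"
    by (rule continuous_on_holomorphic_fst[OF a] continuous_on_holomorphic_fst[OF b], force)+
  show "continuous_on (Z \<times> Y) (\<lambda>(z, w). ext (a z) (b z) w)"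
    unfolding ext_def case_prod_beta
  proof (intro continuous_intros ca continuous_on_csqrt_upper' cb)
    fix x assume "x \<in> Z \<times> Y"
    then have x: "fst x \<in> Z" "snd x \<in> Y" by auto
    show "Im (b (fst x) + snd x) \<ge> 0" using ZY[OF x] by simp
    show "Im (b (fst x) + k2) \<ge> 0" using ib[OF x(1)] by simp
    show "Im (a (fst x)) < 0" "Im (b (fst x)) > - \<kappa>" "Im (snd x) > - \<kappa>" using Za Yw x by auto
  next
    show "\<forall>x\<in>Z \<times> Y. (a (fst x) + k1) * (snd x + k2) \<noteq> 0" using ne ne2 by auto
  qed
  fix z w assume "(z, w) \<in> Z \<times> Y"
  then have zw: "z \<in> Z" "w \<in> Y" by auto
  have "(\<lambda>x. ext (a x) (b x) w) holomorphic_on Z"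
    unfolding ext_def
    by (intro holomorphic_on_mult holomorphic_on_add holomorphic_on_divide holomorphic_on_csqrt_upper
          holomorphic_on_const a b J_holomorphic Z)
       (use ne ne2 ib ZY Za Yw zw in \<open>auto simp: J_domain_def\<close>)
  then show "(\<lambda>x. case (x, w) of (z, w) \<Rightarrow> ext (a z) (b z) w) field_differentiable at z"
    using zw Z by (auto dest: holomorphic_on_imp_differentiable_at)
  have "(\<lambda>y. ext (a z) (b z) y) holomorphic_on Y"
    unfolding ext_def
    by (intro holomorphic_on_mult holomorphic_on_add holomorphic_on_divide holomorphic_on_csqrt_upper
          holomorphic_on_const holomorphic_on_ident J_holomorphic Y)
       (use ne ne2 ib ZY Za Yw zw in \<open>auto simp: J_domain_def\<close>)
  then show "(\<lambda>y. case (z, y) of (z, w) \<Rightarrow> ext (a z) (b z) w) field_differentiable at w"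
    using zw Y by (auto dest: holomorphic_on_imp_differentiable_at)
qed

lemma ext_inner_holo2:
  assumes "open Z" "open Y" "Z \<subseteq> H_minus k - {- k1}" "\<And>w. w \<in> Y \<Longrightarrow> Im w > - \<kappa>"
    and "\<And>z w. z \<in> Z \<Longrightarrow> w \<in> Y \<Longrightarrow> Im (inner_root k z + w) > 0"
  shows "holo2_on (\<lambda>(z, w). ext z (inner_root k z) w) (Z \<times> Y)"
proof (rule ext_holo2[OF assms(1,2) holomorphic_on_ident])
  have i: "Im (inner_root k z) > 0" "Im z < 0" "z \<noteq> - k1" if "z \<in> Z" for z
    using assms(3) that by (auto simp: H_minus_iff)
  show "inner_root k holomorphic_on Z" by (intro holomorphic_on_inner_root holomorphic_on_ident i)
  show "Im z < 0" "z \<noteq> - k1" "Im (inner_root k z) > - \<kappa>" if "z \<in> Z" for z using i[OF that] kap by auto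
qed (use assms in auto)

lemma continuation_holo2:
  "holo2_on continuation (initial_domain \<kappa> \<union> (H_minus k - {- k1}) \<times> H_hat_plus)"
  unfolding holo2_on_Un
proof
  have "open (initial_domain \<kappa>)"
    unfolding initial_domain_def case_prod_beta by (intro open_Collect_conj open_Collect_less continuous_intros)
  then show "holo2_on continuation (initial_domain \<kappa>)"
    by (rule holo2_on_transform[OF omega_holo]) (simp add: continuation_initial)
  have o: "open (H_minus k - {- k1})" "open H_hat_plus"
    by (auto simp: H_hat_plus_def open_halfspace_Im_gt intro!: open_Diff open_H_minus)
  have "holo2_on (\<lambda>(z, w). ext z (inner_root k z) w) ((H_minus k - {- k1}) \<times> H_hat_plus)"
    by (rule ext_inner_holo2[OF o]) (use kap in \<open>auto simp: H_hat_plus_def H_minus_iff\<close>)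
  then show "holo2_on continuation ((H_minus k - {- k1}) \<times> H_hat_plus)"
    by (rule holo2_on_transform) (use o kap in \<open>auto intro!: open_Times continuation_ext[symmetric] simp: H_hat_plus_def H_minus_iff\<close>)
qed

text \<open>The product of the two roots differs from its value at the pole by a multiple of z + k1:
  one has b^2 - b0^2 = (k1 - z) (z + k1), and the differences of \<open>b\<close>, of the roots of b
  + w and of the roots of b + k2 are rationalised by sums that do not vanish. The remainder is
  continuous through z = - k1, hence bounded with \<open>w\<close> varying as well.\<close>

lemma continuation_pole:
  assumes q: "q \<in> H_hat_plus"
  shows "(\<lambda>(z, w). continuation (z, w) - 1 / (z + k1) * (\<i> * gamma_fun k k1 w * gamma_fun k k1 k2 / (w + k2)))
          \<in> O[at (- k1, q) within {(z, w). z \<noteq> - k1}](\<lambda>(z, w). (z + k1) ^ 0)"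
proof -
  define b0 where "b0 = inner_root k k1"
  have b0: "Im b0 > 0" using minus_k1 by (simp add: b0_def)
  define T where "T = H_minus k \<times> H_hat_plus"
  have T: "open T" "(- k1, q) \<in> T"
    using q minus_k1 by (auto simp: T_def H_hat_plus_def open_halfspace_Im_gt intro!: open_Times open_H_minus)
  \<comment> \<open>The remainder after cancelling z + k1; it is defined and continuous on all of
    \<open>T\<close>, including z = - k1.\<close>
  define R where "R = (\<lambda>p. \<i> / (snd p + k2) * ((k1 - fst p) / (inner_root k (fst p) + b0)) *
      (csqrt (inner_root k (fst p) + k2) / (csqrt (inner_root k (fst p) + snd p) + csqrt (b0 + snd p)) +
       csqrt (b0 + snd p) / (csqrt (inner_root k (fst p) + k2) + csqrt (b0 + k2)))
      + csqrt (inner_root k (fst p) + snd p) * J (fst p) (inner_root k (fst p)) (snd p))"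
  have T': "Im (inner_root k (fst p)) > 0" "Im (fst p) < 0" "Im (snd p) > 0" if "p \<in> T" for p
    using that by (auto simp: T_def H_minus_iff H_hat_plus_def)
  have ci: "continuous_on T (\<lambda>p. inner_root k (fst p))"
  proof -
    have "inner_root k holomorphic_on H_minus k"
      by (intro holomorphic_on_inner_root holomorphic_on_ident) (simp add: H_minus_iff)
    then show ?thesis by (rule continuous_on_holomorphic_fst) (auto simp: T_def)
  qed
  have "continuous_on T R"
    unfolding R_def
  proof (intro continuous_intros ci continuous_on_csqrt_upper' ballI)
    fix p assume p: "p \<in> T"
    show "snd p + k2 \<noteq> 0" using T'[OF p] kap by (auto simp: complex_eq_iff)
    show "inner_root k (fst p) + b0 \<noteq> 0" using T'[OF p] b0 by (auto simp: complex_eq_iff)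
    show "csqrt (inner_root k (fst p) + snd p) + csqrt (b0 + snd p) \<noteq> 0"
      by (rule csqrt_diff) (use T'[OF p] b0 in auto)
    show "csqrt (inner_root k (fst p) + k2) + csqrt (b0 + k2) \<noteq> 0"
      by (rule csqrt_diff) (use T'[OF p] b0 kap in auto)
  qed (use T' b0 kap in \<open>force dest: T'\<close>)+
  then have "isCont R (- k1, q)" using T by (simp add: continuous_on_eq_continuous_at)
  then have "(R \<longlongrightarrow> R (- k1, q)) (at (- k1, q))" by (simp add: isCont_def)
  then have ev: "\<forall>\<^sub>F p in at (- k1, q). dist (R p) (R (- k1, q)) < 1" by (rule tendstoD) simp
  have evT: "\<forall>\<^sub>F p in at (- k1, q). p \<in> T" using T by (simp add: eventually_at_in_open')
  have main: "continuation (z, w) - 1 / (z + k1) * (\<i> * gamma_fun k k1 w * gamma_fun k k1 k2 / (w + k2)) = R (z, w)"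
    if "(z, w) \<in> T" "z \<noteq> - k1" for z w
  proof -
    define b where "b = inner_root k z"
    have b: "Im b > 0" "Im z < 0" "Im w > 0" using T'[OF that(1)] by (auto simp: b_def)
    have zk: "z + k1 \<noteq> 0" using that(2) by (metis add_eq_0_iff2)
    have bb: "b + b0 \<noteq> 0" using b b0 by (auto simp: complex_eq_iff)
    define x y x0 y0 where "x = csqrt (b + w)" and "y = csqrt (b + k2)" and "x0 = csqrt (b0 + w)" and "y0 = csqrt (b0 + k2)"
    have "(b - b0) * (b + b0) = b\<^sup>2 - b0\<^sup>2" by (simp add: power2_eq_square algebra_simps)
    also have "\<dots> = (k1 - z) * (z + k1)"
      unfolding b_def b0_def inner_root_square by (simp add: power2_eq_square algebra_simps)
    finally have d: "b - b0 = (k1 - z) / (b + b0) * (z + k1)" using bb by (simp add: field_simps)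
    have xx: "x - x0 = (k1 - z) / (b + b0) * (z + k1) / (x + x0)"
      unfolding x_def x0_def by (subst csqrt_diff(2)) (use b b0 d in auto)
    have yy: "y - y0 = (k1 - z) / (b + b0) * (z + k1) / (y + y0)"
      unfolding y_def y0_def by (subst csqrt_diff(2)) (use b b0 kap d in auto)
    have "x * y - x0 * y0 = (x - x0) * y + x0 * (y - y0)" by (simp add: algebra_simps)
    also have "\<dots> = (z + k1) * ((k1 - z) / (b + b0) * (y / (x + x0) + x0 / (y + y0)))"
      unfolding xx yy by (simp add: divide_inverse algebra_simps)
    finally have *: "(x * y - x0 * y0) / (z + k1) = (k1 - z) / (b + b0) * (y / (x + x0) + x0 / (y + y0))"
      using zk by simp
    have "continuation (z, w) = x * (\<i> * y / ((z + k1) * (w + k2)) + J z b w)"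
      by (subst continuation_ext) (use b kap in \<open>auto simp: ext_def b_def x_def y_def\<close>)
    then have "continuation (z, w) - 1 / (z + k1) * (\<i> * gamma_fun k k1 w * gamma_fun k k1 k2 / (w + k2))
       = \<i> / (w + k2) * ((x * y - x0 * y0) / (z + k1)) + x * J z b w"
      unfolding gamma_fun_def b0_def[symmetric] x0_def[symmetric] y0_def[symmetric] by (simp only: pole_split)
    then show ?thesis unfolding * R_def by (simp add: b_def b0_def x_def y_def x0_def y0_def mult.assoc)
  qed
  show ?thesis
  proof (rule bigoI[where c = "norm (R (- k1, q)) + 1"])
    have "\<forall>\<^sub>F p in at (- k1, q) within {(z, w). z \<noteq> - k1}. p \<in> T \<and> dist (R p) (R (- k1, q)) < 1 \<and> fst p \<noteq> - k1"
    proof (intro eventually_conj)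
      show "\<forall>\<^sub>F p in at (- k1, q) within {(z, w). z \<noteq> - k1}. fst p \<noteq> - k1"
        by (auto simp: eventually_at_filter intro!: always_eventually)
    qed (use evT ev in \<open>auto elim: filter_leD[OF at_le[OF subset_UNIV]]\<close>)
    then show "\<forall>\<^sub>F p in at (- k1, q) within {(z, w). z \<noteq> - k1}.
      norm (case p of (z, w) \<Rightarrow> continuation (z, w) - 1 / (z + k1) * (\<i> * gamma_fun k k1 w * gamma_fun k k1 k2 / (w + k2)))
        \<le> (norm (R (- k1, q)) + 1) * norm (case p of (z, w) \<Rightarrow> (z + k1) ^ 0)"
    proof eventually_elim
      case (elim p)
      obtain z w where p: "p = (z, w)" by (cases p)
      have "norm (R p) \<le> norm (R (- k1, q)) + 1"
        using elim norm_triangle_sub[of "R p" "R (- k1, q)"] by (simp add: dist_norm)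
      then show ?case using main[of z w] elim by (simp add: p)
    qed
  qed
qed

section \<open>Boundary elements of analyticity\<close>

lemma analytic_real_boundary:
  assumes b: "b \<in> lift k \<real>" and q: "q \<in> H_hat_plus"
  shows "analytic_at_boundary k continuation b q"
proof -
  obtain p where p: "b = (p, inner_root k p)" "Im p = 0" using b by (auto simp: lift_def complex_is_Real_iff)
  \<comment> \<open>Imaginary parts drop by less than \<kappa> in these balls, and the initial
    domain reaches down to - 2 \<kappa>; no new formula enters over the real axis.\<close>
  have sub: "ball p \<kappa> \<times> ball q \<kappa> \<subseteq> initial_domain \<kappa>"
  proof
    fix x assume "x \<in> ball p \<kappa> \<times> ball q \<kappa>"
    then have "norm (p - fst x) < \<kappa>" "norm (q - snd x) < \<kappa>" by (auto simp: dist_norm)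
    then have "\<bar>Im (p - fst x)\<bar> < \<kappa>" "\<bar>Im (q - snd x)\<bar> < \<kappa>"
      using abs_Im_le_cmod le_less_trans by blast+
    then show "x \<in> initial_domain \<kappa>"
      using p(2) q kap by (cases x) (auto simp: initial_domain_def H_hat_plus_def)
  qed
  have eq: "continuation (z, w) = fourier \<omega> (z, w)" if "z \<in> ball p \<kappa>" "w \<in> ball q \<kappa>" for z w
    using sub that continuation_initial by blast
  show ?thesis
    unfolding analytic_at_boundary_def p(1) prod.case
    using kap(1) holo2_on_subset[OF omega_holo sub] eq
    by (intro exI[of _ \<kappa>] exI[of _ "fourier \<omega>"] conjI ballI impI) auto
qed

lemma ball_Im:
  assumes "w \<in> ball q r" shows "Im w > Im q - r" "Im w < Im q + r"
proof -
  have "\<bar>Im (q - w)\<bar> < r" using assms abs_Im_le_cmod[of "q - w"] by (simp add: dist_norm)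
  then show "Im w > Im q - r" "Im w < Im q + r" by auto
qed

text \<open>Near a point of the cut other than the tip k^2 - z^2 is close to \<tau>^2 > 0, off the
  cut of \<open>csqrt\<close>, so sgn \<tau> times the principal root continues the inner root
  across the cut from the chosen shore. Beyond the cut its imaginary part becomes negative, which Im
  w > Im q / 2 compensates.\<close>

lemma analytic_cut_boundary:
  assumes b: "b \<in> P_contour k - {P_point k 0}" and q: "q \<in> H_hat_plus"
  shows "analytic_at_boundary k continuation b q"
proof -
  obtain \<tau> :: real where \<tau>: "b = P_point k \<tau>" "\<tau> \<noteq> 0" using b by (auto simp: P_contour_def)
  define p where "p = - sqrt_up (k\<^sup>2 - (of_real \<tau>)\<^sup>2)"
  have bp: "b = (p, of_real \<tau>)" by (simp add: \<tau> P_point_def p_def)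
  have p: "Im p < 0" "p \<noteq> - k1" using P_point_props[of \<tau>] by (simp_all add: p_def)
  have p2: "k\<^sup>2 - p\<^sup>2 = of_real (\<tau>\<^sup>2)" by (simp add: p_def)
  \<comment> \<open>How far the continued root may fall below the real axis: \<kappa> is the limit
    set by \<open>J\<close>, Im q / 2 the limit set by the root of s + w.\<close>
  define m where "m = min \<kappa> (Im q / 2)"
  have m: "m > 0" using kap q by (simp add: m_def H_hat_plus_def)
  define \<beta> where "\<beta> = (\<lambda>z. of_real (sgn \<tau>) * csqrt (k\<^sup>2 - z\<^sup>2))"
  have \<beta>p: "\<beta> p = of_real \<tau>"
    unfolding \<beta>_def p2 by (simp add: csqrt_of_real mult_sgn_abs flip: of_real_mult)
  define Z1 where "Z1 = {z. Im z < 0} \<inter> - {- k1} \<inter> {z. Re (k\<^sup>2 - z\<^sup>2) > 0}"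
  have Z1: "open Z1"
    unfolding Z1_def by (intro open_Int open_Collect_less continuous_intros)
  have hol: "\<beta> holomorphic_on Z1"
    unfolding \<beta>_def by (intro holomorphic_intros holomorphic_on_csqrt') (auto simp: Z1_def complex_nonpos_Reals_iff)
  define Z where "Z = Z1 \<inter> \<beta> -` {s. Im s > - m}"
  have Z: "open Z"
    unfolding Z_def
    by (intro continuous_open_preimage holomorphic_on_imp_continuous_on[OF hol] Z1 open_halfspace_Im_gt)
  have "p \<in> Z"
  proof -
    have "Re (k\<^sup>2 - p\<^sup>2) = \<tau>\<^sup>2" unfolding p2 by (rule Re_complex_of_real)
    then have "Re (k\<^sup>2 - p\<^sup>2) > 0" using \<tau>(2) by simp
    then show ?thesis unfolding Z_def Z1_def using p \<beta>p m by simp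
  qed
  then obtain r where r: "r > 0" "ball p r \<subseteq> Z" using Z open_contains_ball by blast
  \<comment> \<open>A radius of at most \<bar>\<tau>\<bar> makes the real part of the inner root
    share the sign of \<tau>, which identifies it with \<beta>.\<close>
  define \<rho> where "\<rho> = min r (min (Im q / 2) \<bar>\<tau>\<bar>)"
  have \<rho>: "\<rho> > 0" "\<rho> \<le> r" "\<rho> \<le> Im q / 2" "\<rho> \<le> \<bar>\<tau>\<bar>"
    using r q \<tau> by (auto simp: \<rho>_def H_hat_plus_def)
  have sub: "ball p \<rho> \<subseteq> Z" using r \<rho> by auto
  have w: "Im w > Im q / 2" if "w \<in> ball q \<rho>" for w using ball_Im[OF that] \<rho> by linarith
  have zin: "Im z < 0 \<and> z \<noteq> - k1 \<and> Im (\<beta> z) > - m" if "z \<in> ball p \<rho>" for z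
    using sub that by (auto simp: Z_def Z1_def)
  have q0: "Im q > 0" using q by (simp add: H_hat_plus_def)
  have "holo2_on (\<lambda>(z, w). ext z (\<beta> z) w) (ball p \<rho> \<times> ball q \<rho>)"
  proof (rule ext_holo2)
    show "\<beta> holomorphic_on ball p \<rho>" by (rule holomorphic_on_subset[OF hol]) (use sub in \<open>auto simp: Z_def\<close>)
    show "Im (\<beta> z) > - \<kappa>" if "z \<in> ball p \<rho>" for z using zin[OF that] by (auto simp: m_def)
    show "Im (\<beta> z + w) > 0" if "z \<in> ball p \<rho>" "w \<in> ball q \<rho>" for z w
      using zin[OF that(1)] w[OF that(2)] by (auto simp: m_def)
    show "Im w > - \<kappa>" if "w \<in> ball q \<rho>" for w using w[OF that] q0 kap by linarith
  qed (use zin in auto)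
  moreover have "continuation (z, w) = ext z (\<beta> z) w"
    if z: "z \<in> H_minus k \<inter> ball p \<rho>" and "w \<in> H_hat_plus \<inter> ball q \<rho>" and d: "dist (inner_root k z) (of_real \<tau>) < \<rho>" for z w
  proof -
    let ?i = "inner_root k z"
    have "\<bar>Re ?i - \<tau>\<bar> < \<bar>\<tau>\<bar>" using d abs_Re_le_cmod[of "?i - of_real \<tau>"] \<rho> by (simp add: dist_norm)
    then have pos: "sgn \<tau> * Re ?i > 0" using \<tau>(2) by (auto simp: sgn_if abs_if split: if_splits)
    have "csqrt (k\<^sup>2 - z\<^sup>2) = of_real (sgn \<tau>) * ?i"
    proof (rule csqrt_unique)
      have "(of_real (sgn \<tau>) :: complex)\<^sup>2 = 1" using \<tau>(2) by (auto simp: sgn_if power2_eq_square)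
      then show "(of_real (sgn \<tau>) * ?i)\<^sup>2 = k\<^sup>2 - z\<^sup>2" by (simp add: power_mult_distrib inner_root_square)
    qed (use pos in simp)
    then have "\<beta> z = of_real (sgn \<tau> * sgn \<tau>) * ?i" by (simp only: \<beta>_def of_real_mult mult.assoc)
    also have "sgn \<tau> * sgn \<tau> = 1" using \<tau>(2) by (auto simp: sgn_if)
    finally have "\<beta> z = ?i" by simp
    then show ?thesis
      using that kap by (subst continuation_ext) (auto simp: H_minus_iff H_hat_plus_def)
  qed
  ultimately show ?thesis
    unfolding analytic_at_boundary_def bp prod.case using \<rho>(1)
    by (intro exI[of _ \<rho>] conjI exI[of _ "\<lambda>(z, w). ext z (\<beta> z) w"]) auto
qed

text \<open>With \<open>s\<close> as the coordinate, \<open>z\<close> is the holomorphic function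
  \<zeta> of \<open>s\<close> near 0, because k^2 is off the half-line [0, \<infinity>); no choice
  of shore remains.\<close>

lemma analytic_tip:
  assumes q: "q \<in> H_hat_plus"
  shows "analytic_at_tip k continuation q"
proof -
  have q0: "Im q > 0" using q by (simp add: H_hat_plus_def)
  define \<zeta> where "\<zeta> = (\<lambda>s. - sqrt_up (k\<^sup>2 - s\<^sup>2))"
  define Z1 where "Z1 = (\<lambda>s. k\<^sup>2 - s\<^sup>2) -` (- \<real>\<^sub>\<ge>\<^sub>0)"
  have Z1: "open Z1" unfolding Z1_def by (intro open_vimage continuous_intros) auto
  have hol: "\<zeta> holomorphic_on Z1"
    unfolding \<zeta>_def by (intro holomorphic_intros) (auto simp: Z1_def)
  define Z where "Z = Z1 \<inter> \<zeta> -` (- {- k1})"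
  have Z: "open Z"
    unfolding Z_def
    by (intro continuous_open_preimage holomorphic_on_imp_continuous_on[OF hol] Z1 open_Compl closed_singleton)
  have "0 \<in> Z"
    using radicand_tau[of 0] P_point_props(2)[of 0] by (simp add: Z_def Z1_def \<zeta>_def)
  then obtain r where r: "r > 0" "ball 0 r \<subseteq> Z" using Z open_contains_ball by blast
  define \<rho> where "\<rho> = min r (min (Im q / 2) \<kappa>)"
  have \<rho>: "\<rho> > 0" "\<rho> \<le> r" "\<rho> \<le> Im q / 2" "\<rho> \<le> \<kappa>"
    using r q0 kap by (auto simp: \<rho>_def)
  have zin: "Im (\<zeta> s) < 0" "\<zeta> s \<noteq> - k1" if "s \<in> ball 0 \<rho>" for s
  proof -
    have "s \<in> Z" using that r \<rho> by auto
    then show "Im (\<zeta> s) < 0" "\<zeta> s \<noteq> - k1" by (auto simp: Z_def Z1_def \<zeta>_def Im_sqrt_up_pos_iff)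
  qed
  have w: "Im w > Im q / 2" if "w \<in> ball q \<rho>" for w using ball_Im[OF that] \<rho> by linarith
  have "holo2_on (\<lambda>(s, w). ext (\<zeta> s) s w) (ball 0 \<rho> \<times> ball q \<rho>)"
  proof (rule ext_holo2)
    show "\<zeta> holomorphic_on ball 0 \<rho>" by (rule holomorphic_on_subset[OF hol]) (use r \<rho> in \<open>auto simp: Z_def\<close>)
    show "Im s > - \<kappa>" if "s \<in> ball 0 \<rho>" for s using ball_Im(1)[OF that] \<rho> by simp
    show "Im (s + w) > 0" if "s \<in> ball 0 \<rho>" "w \<in> ball q \<rho>" for s w
      using ball_Im(1)[OF that(1)] w[OF that(2)] \<rho> by simp
    show "Im w > - \<kappa>" if "w \<in> ball q \<rho>" for w using w[OF that] q0 kap by linarith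
  qed (use zin in \<open>auto intro: holomorphic_on_ident\<close>)
  moreover have "continuation (z, w) = ext (\<zeta> (inner_root k z)) (inner_root k z) w"
    if "z \<in> H_minus k" "w \<in> H_hat_plus" for z w
    using that kap unfolding \<zeta>_def
    by (subst inner_root_retract) (auto intro!: continuation_ext simp: H_minus_iff H_hat_plus_def)
  ultimately show ?thesis
    unfolding analytic_at_tip_def using \<rho>(1)
    by (intro exI[of _ \<rho>] conjI exI[of _ "\<lambda>(s, w). ext (\<zeta> s) s w"]) auto
qed

text \<open>In the interior of the cut half-plane the inner root has positive imaginary part, which
  allows \<open>w\<close> to pass below the real axis.\<close>

lemma analytic_lower_boundary:
  assumes b: "b \<in> lift k (H_minus k - {- k1})" and q: "q \<in> \<real>"
  shows "analytic_at_boundary k continuation b q"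
proof -
  obtain p where p: "b = (p, inner_root k p)" "p \<in> H_minus k" "p \<noteq> - k1" using b by (auto simp: lift_def)
  \<comment> \<open>Half the height of the root at \<open>p\<close>: the root stays above
    \<open>m\<close> near \<open>p\<close>, and \<open>w\<close> may fall to - m.\<close>
  define m where "m = Im (inner_root k p) / 2"
  have m: "m > 0" using p by (simp add: m_def H_minus_iff)
  have q0: "Im q = 0" using q by (simp add: complex_is_Real_iff)
  define Z where "Z = (H_minus k - {- k1}) \<inter> inner_root k -` {s. Im s > m}"
  have Z1: "open (H_minus k - {- k1})" by (simp add: open_Diff open_H_minus)
  have hol: "inner_root k holomorphic_on (H_minus k - {- k1})"
    by (intro holomorphic_on_inner_root holomorphic_on_ident) (simp add: H_minus_iff)
  have Z: "open Z"
    unfolding Z_def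
    by (intro continuous_open_preimage holomorphic_on_imp_continuous_on[OF hol] Z1 open_halfspace_Im_gt)
  have "p \<in> Z" using p m by (simp add: Z_def m_def)
  then obtain r where r: "r > 0" "ball p r \<subseteq> Z" using Z open_contains_ball by blast
  define \<rho> where "\<rho> = min r (min m \<kappa>)"
  have \<rho>: "\<rho> > 0" "\<rho> \<le> r" "\<rho> \<le> m" "\<rho> \<le> \<kappa>" using r m kap by (auto simp: \<rho>_def)
  have sub: "ball p \<rho> \<subseteq> Z" using r \<rho> by auto
  have "holo2_on (\<lambda>(z, w). ext z (inner_root k z) w) (ball p \<rho> \<times> ball q \<rho>)"
  proof (rule ext_inner_holo2)
    show "ball p \<rho> \<subseteq> H_minus k - {- k1}" using sub by (auto simp: Z_def)
    show "Im w > - \<kappa>" if "w \<in> ball q \<rho>" for w using ball_Im(1)[OF that] q0 \<rho> by simp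
    show "Im (inner_root k z + w) > 0" if "z \<in> ball p \<rho>" "w \<in> ball q \<rho>" for z w
      using subsetD[OF sub that(1)] ball_Im(1)[OF that(2)] q0 \<rho> by (simp add: Z_def)
  qed auto
  moreover have "continuation (z, w) = ext z (inner_root k z) w"
    if "z \<in> H_minus k" "w \<in> H_hat_plus" for z w
    using that kap by (intro continuation_ext) (auto simp: H_minus_iff H_hat_plus_def)
  ultimately show ?thesis
    unfolding analytic_at_boundary_def p(1) prod.case using \<rho>(1)
    by (intro exI[of _ \<rho>] conjI exI[of _ "\<lambda>(z, w). ext z (inner_root k z) w"]) auto
qed

section \<open>Continuity where the cut meets the real axis\<close>

definition closed_side :: "((complex \<times> complex) \<times> complex) set" where
  "closed_side = {((z, s), w). Im z < 0 \<and> z \<noteq> - k1 \<and> Im s \<ge> 0 \<and> Im w \<ge> 0}"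

definition ext' :: "(complex \<times> complex) \<times> complex \<Rightarrow> complex" where
  "ext' = (\<lambda>((z, s), w). ext z s w)"

text \<open>When \<open>s\<close> and \<open>w\<close> are both real, s + w may hit the branch point
  or the negative axis. The principal root is still continuous there from the closed upper
  half-plane, while \<open>J\<close> stays analytic. No relation between \<open>z\<close> and
  \<open>s\<close> is used, so all arguments vary independently.\<close>

lemma ext_continuous: "continuous_on closed_side ext'"
  unfolding ext'_def ext_def case_prod_beta
proof (intro continuous_intros continuous_on_csqrt_upper' ballI)
  fix x :: "(complex \<times> complex) \<times> complex" assume x: "x \<in> closed_side"
  then have x': "Im (fst (fst x)) < 0" "fst (fst x) \<noteq> - k1" "Im (snd (fst x)) \<ge> 0" "Im (snd x) \<ge> 0"
    by (auto simp: closed_side_def)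
  show "Im (fst (fst x)) < 0" "Im (snd (fst x)) > - \<kappa>" "Im (snd x) > - \<kappa>" using x' kap by auto
  show "Im (snd (fst x) + snd x) \<ge> 0" "Im (snd (fst x) + k2) \<ge> 0" using x' kap by auto
  have "snd x + k2 \<noteq> 0" using x' kap by (auto simp: complex_eq_iff)
  moreover have "fst (fst x) + k1 \<noteq> 0" using x'(2) by (metis add_eq_0_iff2)
  ultimately show "(fst (fst x) + k1) * (snd x + k2) \<noteq> 0" by simp
qed

text \<open>Moving \<open>s\<close> and \<open>w\<close> up by \<open>\<i> r\<close> leads from any point of the closed domain into its interior.\<close>

lemma closed_side_islimpt:
  assumes x: "((z, s), w) \<in> closed_side" and z: "z = - sqrt_up (k\<^sup>2 - s\<^sup>2)"
  shows "((z, s), w) islimpt lift k (H_minus k - {- k1}) \<times> H_hat_plus"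
  unfolding islimpt_def
proof (intro allI impI)
  fix T assume T: "((z, s), w) \<in> T" "open T"
  have x': "Im z < 0" "z \<noteq> - k1" "Im s \<ge> 0" "Im w \<ge> 0" using x by (auto simp: closed_side_def)
  \<comment> \<open>The base point has to move along with \<open>s\<close>: f r becomes the point
    whose inner root is s + \<i> r.\<close>
  define f where "f = (\<lambda>r::real. - sqrt_up (k\<^sup>2 - (s + \<i> * of_real r)\<^sup>2))"
  define h where "h = (\<lambda>r::real. ((f r, s + \<i> * of_real r), w + \<i> * of_real r))"
  have nn: "k\<^sup>2 - s\<^sup>2 \<notin> \<real>\<^sub>\<ge>\<^sub>0" using x'(1) by (simp add: z Im_sqrt_up_pos_iff)
  have "isCont sqrt_up (k\<^sup>2 - s\<^sup>2)"
  proof -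
    have "(\<lambda>v. sqrt_up v) holomorphic_on - \<real>\<^sub>\<ge>\<^sub>0" by (intro holomorphic_on_sqrt_up holomorphic_on_ident) auto
    then have "continuous_on (- \<real>\<^sub>\<ge>\<^sub>0) sqrt_up" by (rule holomorphic_on_imp_continuous_on)
    then show ?thesis using nn by (simp add: continuous_on_eq_continuous_at open_Compl)
  qed
  then have f: "(f \<longlongrightarrow> z) (at_right 0)"
    unfolding f_def z
    by (intro tendsto_minus isCont_tendsto_compose[of _ sqrt_up]) (auto intro!: tendsto_eq_intros)
  have h: "(h \<longlongrightarrow> ((z, s), w)) (at_right 0)"
    unfolding h_def by (intro tendsto_Pair f) (auto intro!: tendsto_eq_intros)
  have ev: "\<forall>\<^sub>F r in at_right 0. h r \<in> T" using topological_tendstoD[OF h T(2,1)] .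
  have "\<forall>\<^sub>F r in at_right 0. f r \<in> {v. Im v < 0} \<inter> - {- k1}"
    by (rule topological_tendstoD[OF f]) (use x' in \<open>auto simp: open_halfspace_Im_lt\<close>)
  then have "\<forall>\<^sub>F r in at_right 0. h r \<in> T \<and> f r \<in> {v. Im v < 0} \<inter> - {- k1} \<and> r > 0"
    using ev eventually_at_right_less[of 0] by (intro eventually_conj)
  then obtain r where r: "h r \<in> T" "Im (f r) < 0" "f r \<noteq> - k1" "r > 0"
    using eventually_happens'[OF trivial_limit_at_right_real] by fastforce
  have "inner_root k (f r) = s + \<i> * of_real r"
    unfolding inner_root_def by (rule sqrt_up_unique) (use r x' in \<open>auto simp: f_def\<close>)
  moreover from this have "f r \<in> H_minus k" using r x' by (simp add: H_minus_iff)
  ultimately have "h r \<in> lift k (H_minus k - {- k1}) \<times> H_hat_plus"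
    using r x' by (auto simp: h_def lift_def H_hat_plus_def intro!: image_eqI[of _ _ "f r"])
  moreover have "h r \<noteq> ((z, s), w)" using r by (auto simp: h_def)
  ultimately show "\<exists>y\<in>lift k (H_minus k - {- k1}) \<times> H_hat_plus. y \<in> T \<and> y \<noteq> ((z, s), w)"
    using r by (intro bexI[of _ "h r"]) auto
qed

text \<open>The continuous function \<open>ext'\<close> supplies the limit from inside the domain.
  For \<open>Lim\<close> to have this value the limit must be unique, which is where
  \<open>closed_side_islimpt\<close> enters.\<close>

lemma extended_value_eq:
  assumes x: "((z, s), w) \<in> closed_side" and z: "z = - sqrt_up (k\<^sup>2 - s\<^sup>2)"
  shows "extended_value k (- k1) continuation ((z, s), w) = ext' ((z, s), w)"
proof -
  define D where "D = lift k (H_minus k - {- k1}) \<times> H_hat_plus"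
  have D: "p \<in> closed_side \<and> (case p of ((z, \<sigma>), w) \<Rightarrow> continuation (z, w)) = ext' p" if "p \<in> D" for p
  proof -
    obtain z' w' where p: "p = ((z', inner_root k z'), w')" "z' \<in> H_minus k" "z' \<noteq> - k1" "w' \<in> H_hat_plus"
      using \<open>p \<in> D\<close> by (auto simp: D_def lift_def)
    then show ?thesis
      using continuation_ext[of z' w'] kap by (auto simp: ext'_def closed_side_def H_minus_iff H_hat_plus_def)
  qed
  have "(ext' \<longlongrightarrow> ext' ((z, s), w)) (at ((z, s), w) within closed_side)"
    using ext_continuous x by (simp add: continuous_on_def)
  then have "(ext' \<longlongrightarrow> ext' ((z, s), w)) (at ((z, s), w) within D)"
    by (rule tendsto_within_subset) (use D in auto)
  then have "((\<lambda>((z, \<sigma>), w). continuation (z, w)) \<longlongrightarrow> ext' ((z, s), w)) (at ((z, s), w) within D)"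
    by (rule Lim_transform_eventually) (use D in \<open>auto simp: eventually_at_filter intro!: always_eventually\<close>)
  then show ?thesis
    unfolding extended_value_def D_def[symmetric]
    by (rule tendsto_Lim[rotated]) (use closed_side_islimpt[OF assms] in \<open>simp add: D_def trivial_limit_within\<close>)
qed

text \<open>A path that ends on the cut eventually has Im z < 0, so its tail avoids the boundary
  over the real axis of the first variable and runs in \<open>closed_side\<close>, where one
  continuous function gives all extended values.\<close>

lemma continuous_cut_boundary:
  assumes b: "b \<in> P_contour k" and q: "q \<in> \<real>"
  shows "continuous_at_boundary k (- k1) continuation b q"
  unfolding continuous_at_boundary_def
proof (intro exI allI impI)
  fix g :: "real \<Rightarrow> (complex \<times> complex) \<times> complex"
  let ?A = "lift k (H_minus k - {- k1}) \<times> H_hat_plus \<union> boundary_H_minus k \<times> H_hat_plus \<union> lift k (H_minus k - {- k1}) \<times> \<real>"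
  assume g: "path g \<and> pathfinish g = (b, q) \<and> g ` {0..<1} \<subseteq> ?A"
  obtain \<tau> :: real where \<tau>: "b = P_point k \<tau>" using b by (auto simp: P_contour_def)
  have bq: "(b, q) \<in> closed_side"
    using P_point_props[of \<tau>] q by (auto simp: closed_side_def \<tau> P_point_def complex_is_Real_iff)
  have lim: "(g \<longlongrightarrow> (b, q)) (at_left 1)"
  proof -
    have "(g \<longlongrightarrow> g 1) (at 1 within {0..1})" using g by (auto simp: path_def continuous_on_def)
    then have "(g \<longlongrightarrow> (b, q)) (at 1 within {0..1})" using g by (simp add: pathfinish_def)
    then show ?thesis by (simp add: at_within_Icc_at_left)
  qed
  \<comment> \<open>For Im z < 0 a point of \<open>boundary_H_minus\<close> lies on
    \<open>P_contour\<close>, since lifted reals have Im z = 0. In every case \<open>z\<close> is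
    determined by \<open>s\<close>, as \<open>extended_value_eq\<close> requires.\<close>
  have good: "x \<in> closed_side \<and> extended_value k (- k1) continuation x = ext' x"
    if x: "x \<in> ?A" "Im (fst (fst x)) < 0" for x
  proof -
    obtain z s w where xx: "x = ((z, s), w)" by (metis prod.collapse)
    have zs: "z \<noteq> - k1 \<and> Im s \<ge> 0 \<and> z = - sqrt_up (k\<^sup>2 - s\<^sup>2)"
    proof (cases "(z, s) \<in> P_contour k")
      case True
      then show ?thesis using P_point_props(2) by (auto simp: P_contour_def P_point_def)
    next
      case False
      then have "(z, s) \<in> lift k (H_minus k - {- k1})"
        using x by (auto simp: xx boundary_H_minus_def lift_def complex_is_Real_iff)
      then show ?thesis using inner_root_retract[of z k] by (auto simp: lift_def H_minus_iff)
    qed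
    then have "z \<noteq> - k1" "Im s \<ge> 0" by auto
    moreover have "Im w \<ge> 0" using x by (auto simp: xx H_hat_plus_def complex_is_Real_iff)
    ultimately have "x \<in> closed_side" using x(2) unfolding xx closed_side_def by simp
    then show ?thesis using extended_value_eq zs unfolding xx by blast
  qed
  have "((\<lambda>t. Im (fst (fst (g t)))) \<longlongrightarrow> Im (fst (fst (b, q)))) (at_left 1)"
    by (intro tendsto_intros lim)
  then have "\<forall>\<^sub>F t in at_left 1. Im (fst (fst (g t))) < 0"
    by (rule order_tendstoD) (use bq in \<open>auto simp: closed_side_def\<close>)
  moreover have "\<forall>\<^sub>F t in at_left 1. t \<in> {0<..<1::real}"
    by (rule eventually_at_left_real) simp
  ultimately have ev: "\<forall>\<^sub>F t in at_left 1. g t \<in> closed_side \<and> extended_value k (- k1) continuation (g t) = ext' (g t)"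
  proof eventually_elim
    case (elim t)
    then have "g t \<in> g ` {0..<1}" by simp
    then have "g t \<in> ?A" using g by blast
    then show ?case using elim(1) by (rule good)
  qed
  have "((\<lambda>t. ext' (g t)) \<longlongrightarrow> ext' (b, q)) (at_left 1)"
    by (rule continuous_on_tendsto_compose[OF ext_continuous lim bq]) (rule eventually_mono[OF ev], simp)
  then show "((\<lambda>t. extended_value k (- k1) continuation (g t)) \<longlongrightarrow> ext' (b, q)) (at_left 1)"
    by (rule Lim_transform_eventually) (rule eventually_mono[OF ev], simp)
qed

end

subsection \<open>The quarter-plane problem\<close>

lemma trace0_eq:
  assumes "continuous_on {(x1, x2, x3). x3 \<ge> 0} u"
  shows "trace0 u (x1, x2) = u (x1, x2, 0)"
proof -
  have "continuous_on {0..} (\<lambda>t. u (x1, x2, t))"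
    by (rule continuous_on_compose2[OF assms]) (auto intro!: continuous_intros)
  then have "((\<lambda>t. u (x1, x2, t)) \<longlongrightarrow> u (x1, x2, 0)) (at 0 within {0..})"
    by (auto simp: continuous_on_def)
  then have "((\<lambda>t. u (x1, x2, t)) \<longlongrightarrow> u (x1, x2, 0)) (at_right 0)"
    by (rule tendsto_within_subset) auto
  then show ?thesis unfolding trace0_def prod.case by (rule tendsto_Lim[rotated]) simp
qed

lemma continuous_on_trace0:
  assumes "continuous_on {(x1, x2, x3). x3 \<ge> 0} u"
  shows "continuous_on UNIV (trace0 u)"
proof -
  have "trace0 u = (\<lambda>x. u (fst x, snd x, 0))" using trace0_eq[OF assms] by (simp add: fun_eq_iff)
  moreover have "continuous_on UNIV (\<lambda>x. u (fst x, snd x, 0))"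
    by (rule continuous_on_compose2[OF assms]) (auto intro!: continuous_intros)
  ultimately show ?thesis by simp
qed

lemma closed_quarter_plane: "closed quarter_plane"
  unfolding quarter_plane_def case_prod_beta by (intro closed_Collect_conj closed_Collect_eq closed_Collect_le continuous_intros)

text \<open>\<open>normal_trace0\<close> is a limit of derivatives, whereas the Neumann condition is
  a derivative at x3 = 0. Off the closed quarter-plane \<open>u\<close> is of class C^2 across x3 =
  0, so the two agree.\<close>

lemma normal_trace0_eq_0:
  assumes C2: "Ck_on 2 (- quarter_plane) u" and x: "x1 < 0 \<or> x2 < 0"
    and d0: "((\<lambda>x3. u (x1, x2, x3)) has_vector_derivative 0) (at 0)"
  shows "normal_trace0 u (x1, x2) = 0"
proof -
  let ?v = "(0, 0, 1) :: real \<times> real \<times> real"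
  have op: "open (- quarter_plane)" using closed_quarter_plane by (rule open_Compl)
  have mem: "(x1, x2, t) \<in> - quarter_plane" for t using x by (auto simp: quarter_plane_def)
  have "?v \<in> Basis" by (simp add: Basis_prod_def)
  then have u: "u differentiable_on - quarter_plane" and pu: "partial ?v u differentiable_on - quarter_plane"
    using C2 unfolding numeral_2_eq_2 by auto
  have der: "((\<lambda>t. u (x1, x2, t)) has_vector_derivative partial ?v u (x1, x2, t)) (at t)" for t
  proof -
    have "u differentiable at (x1, x2, t)" using u op mem by (simp add: differentiable_on_eq_differentiable_at)
    then have "(u has_derivative frechet_derivative u (at (x1, x2, t))) (at (x1, x2, t))"
      by (simp add: frechet_derivative_works)
    moreover have "((\<lambda>t. (x1, x2, t)) has_derivative (\<lambda>h. (0, 0, h))) (at t)"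
      by (intro has_derivative_Pair has_derivative_const has_derivative_ident)
    ultimately have *: "((\<lambda>t. u (x1, x2, t)) has_derivative (\<lambda>h. frechet_derivative u (at (x1, x2, t)) (0, 0, h))) (at t)"
      by (rule has_derivative_compose[rotated])
    interpret linear "frechet_derivative u (at (x1, x2, t))"
      using \<open>u differentiable at (x1, x2, t)\<close> by (rule linear_frechet_derivative)
    have "frechet_derivative u (at (x1, x2, t)) (0, 0, h) = h *\<^sub>R partial ?v u (x1, x2, t)" for h
      unfolding partial_def scale[symmetric] by simp
    then show ?thesis using * by (simp add: has_vector_derivative_def)
  qed
  have "partial ?v u (x1, x2, 0) = 0" using vector_derivative_unique_at[OF der[of 0] d0] .
  moreover have "continuous_on (- quarter_plane) (partial ?v u)" using pu by (rule differentiable_imp_continuous_on)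
  then have "continuous_on UNIV (\<lambda>t. partial ?v u (x1, x2, t))"
    by (rule continuous_on_compose2) (use mem in \<open>auto intro!: continuous_intros\<close>)
  then have "((\<lambda>t. partial ?v u (x1, x2, t)) \<longlongrightarrow> partial ?v u (x1, x2, 0)) (at 0)"
    by (simp add: continuous_on_def)
  ultimately have "((\<lambda>t. partial ?v u (x1, x2, t)) \<longlongrightarrow> 0) (at_right 0)"
    by (simp add: filterlim_at_split)
  moreover have "vector_derivative (\<lambda>t. u (x1, x2, t)) (at t) = partial ?v u (x1, x2, t)" for t
    using der by (rule vector_derivative_at)
  ultimately show ?thesis
    unfolding normal_trace0_def prod.case by (auto intro!: tendsto_Lim)
qed

text \<open>As 2/3 < 1 / sqrt 2, the norm is at least (2/3) (\<bar>x1\<bar> + \<bar>x2\<bar>), and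
  the decay rate 4 \<kappa> becomes (8/3) \<kappa> in each variable. The weight takes 2 \<kappa> of
  it and (2/3) \<kappa> is left for integrability.\<close>

lemma exponential_weight_integrable:
  fixes f :: "real \<times> real \<Rightarrow> complex"
  assumes \<kappa>: "\<kappa> > 0" and cont: "continuous_on UNIV f"
    and ev: "\<forall>\<^sub>F (x1, x2) in at_infinity. norm (f (x1, x2)) < C * exp (- 4 * \<kappa> * sqrt (x1^2 + x2^2))"
  shows "integrable lborel (\<lambda>x. norm (f x) * exp (2 * \<kappa> * (\<bar>fst x\<bar> + \<bar>snd x\<bar>)))"
proof -
  have ns: "norm x = sqrt ((fst x)\<^sup>2 + (snd x)\<^sup>2)" for x :: "real \<times> real" by (simp add: norm_prod_def)
  obtain B where B: "\<And>x. norm x \<ge> B \<Longrightarrow> norm (f x) < C * exp (- 4 * \<kappa> * norm x)"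
    using ev unfolding eventually_at_infinity case_prod_beta ns prod.collapse by blast
  have "compact (f ` cball 0 B)" by (intro compact_continuous_image continuous_on_subset[OF cont]) auto
  then obtain M where "\<forall>y\<in>f ` cball 0 B. norm y \<le> M" using compact_imp_bounded bounded_iff by metis
  then have M: "norm (f x) \<le> M" if "norm x \<le> B" for x using that by auto
  \<comment> \<open>Extends the bound near infinity to all points: inside the ball of radius
    \<open>B\<close> the factor exp (4 \<kappa> B) offsets the decaying exponential.\<close>
  define D where "D = \<bar>C\<bar> + \<bar>M\<bar> * exp (4 * \<kappa> * B)"
  have dec: "norm (f x) \<le> D * exp (- 4 * \<kappa> * norm x)" for x
  proof (cases "norm x \<ge> B")
    case True
    have "C \<le> D" unfolding D_def using abs_ge_self[of C] by (simp add: add_increasing2)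
    then have "C * exp (- 4 * \<kappa> * norm x) \<le> D * exp (- 4 * \<kappa> * norm x)" by (intro mult_right_mono) auto
    then show ?thesis using B[OF True] by linarith
  next
    case False
    have "exp (4 * \<kappa> * norm x) \<le> exp (4 * \<kappa> * B)" using False \<kappa> by simp
    then have "\<bar>M\<bar> * exp (4 * \<kappa> * norm x) \<le> D" unfolding D_def by (intro add_increasing mult_left_mono) auto
    then have "\<bar>M\<bar> * exp (4 * \<kappa> * norm x) * exp (- 4 * \<kappa> * norm x) \<le> D * exp (- 4 * \<kappa> * norm x)"
      by (intro mult_right_mono) auto
    then have "\<bar>M\<bar> \<le> D * exp (- 4 * \<kappa> * norm x)" by (simp add: mult.assoc flip: exp_add)
    moreover have "norm (f x) \<le> \<bar>M\<bar>" using M[of x] False by (simp add: order_trans[OF _ abs_ge_self])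
    ultimately show ?thesis by linarith
  qed
  have D: "D \<ge> 0" by (simp add: D_def)
  let ?c = "2 / 3 * \<kappa>"
  have 1: "integrable lborel (\<lambda>x::real. exp (- ?c * \<bar>x\<bar>))" by (rule integrable_exp_abs) (use \<kappa> in simp)
  have 2: "integrable lborel (\<lambda>x. D * (exp (- ?c * \<bar>fst x\<bar>) * exp (- ?c * \<bar>snd x\<bar>)))"
    by (intro integrable_mult_right integral_lborel_product(1) 1)
  show ?thesis
  proof (rule Bochner_Integration.integrable_bound[OF 2])
    have "continuous_on UNIV (\<lambda>x. norm (f x) * exp (2 * \<kappa> * (\<bar>fst x\<bar> + \<bar>snd x\<bar>)))"
      by (intro continuous_intros cont)
    then show "(\<lambda>x. norm (f x) * exp (2 * \<kappa> * (\<bar>fst x\<bar> + \<bar>snd x\<bar>))) \<in> borel_measurable lborel"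
      by (simp add: borel_measurable_continuous_onI)
    have "norm (f x) * exp (2 * \<kappa> * (\<bar>fst x\<bar> + \<bar>snd x\<bar>)) \<le> D * (exp (- ?c * \<bar>fst x\<bar>) * exp (- ?c * \<bar>snd x\<bar>))" for x
    proof -
      let ?s = "\<bar>fst x\<bar> + \<bar>snd x\<bar>"
      have "0 \<le> (\<bar>fst x\<bar> - \<bar>snd x\<bar>)\<^sup>2" by simp
      then have "?s\<^sup>2 \<le> 2 * (fst x)\<^sup>2 + 2 * (snd x)\<^sup>2" by (simp add: power2_eq_square algebra_simps)
      moreover have "(2 / 3 * ?s)\<^sup>2 = 4 / 9 * ?s\<^sup>2" unfolding power_mult_distrib power_divide by simp
      moreover have "(norm x)\<^sup>2 = (fst x)\<^sup>2 + (snd x)\<^sup>2" by (simp add: ns)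
      moreover have "0 \<le> (norm x)\<^sup>2" by simp
      ultimately have "(2 / 3 * ?s)\<^sup>2 \<le> (norm x)\<^sup>2" by linarith
      then have "2 / 3 * ?s \<le> norm x" by (rule power2_le_imp_le) simp
      then have "4 * \<kappa> * (2 / 3 * ?s) \<le> 4 * \<kappa> * norm x" using \<kappa> by (intro mult_left_mono) auto
      moreover have "4 * \<kappa> * (2 / 3 * ?s) = 2 * \<kappa> * ?s + ?c * \<bar>fst x\<bar> + ?c * \<bar>snd x\<bar>" by (simp add: algebra_simps)
      ultimately have e: "- 4 * \<kappa> * norm x + 2 * \<kappa> * ?s \<le> - ?c * \<bar>fst x\<bar> + - ?c * \<bar>snd x\<bar>" by linarith
      have "norm (f x) * exp (2 * \<kappa> * ?s) \<le> D * exp (- 4 * \<kappa> * norm x) * exp (2 * \<kappa> * ?s)"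
        using dec by (intro mult_right_mono) auto
      also have "\<dots> = D * exp (- 4 * \<kappa> * norm x + 2 * \<kappa> * ?s)" by (simp only: exp_add mult.assoc)
      also have "\<dots> \<le> D * exp (- ?c * \<bar>fst x\<bar> + - ?c * \<bar>snd x\<bar>)" using e D by (intro mult_left_mono) auto
      finally show ?thesis by (simp only: exp_add)
    qed
    then show "AE x in lborel. norm (norm (f x) * exp (2 * \<kappa> * (\<bar>fst x\<bar> + \<bar>snd x\<bar>))) \<le> norm (D * (exp (- ?c * \<bar>fst x\<bar>) * exp (- ?c * \<bar>snd x\<bar>)))"
      using D by (intro AE_I2) (simp add: abs_mult)
  qed
qed

lemma spectral_data_quarter_plane:
  assumes eps: "0 < \<epsilon>" "\<epsilon> < 1" and k: "k^2 = 1 + \<i> * of_real \<epsilon>" and Im: "0 < Im k1" "0 < Im k2"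
    and cut: "k1 \<notin> h_plus k" and qp: "quarter_plane_problem k k1 k2 u"
    and dec: "exponential_decay (kappa \<epsilon> k1 k2) u" and ia: "initially_analytic (kappa \<epsilon> k1 k2) u"
    and fe: "functional_equation k u"
  shows "spectral_data \<epsilon> (kappa \<epsilon> k1 k2) k k1 k2 (trace0 u) (normal_trace0 u)"
proof
  let ?\<kappa> = "kappa \<epsilon> k1 k2"
  show "0 < ?\<kappa>" "8 * ?\<kappa> \<le> \<epsilon>" "4 * ?\<kappa> \<le> Im k1" "4 * ?\<kappa> \<le> Im k2"
    using eps Im by (auto simp: kappa_def)
  have cont: "continuous_on {(x1, x2, x3). x3 \<ge> 0} u" using qp by (simp add: quarter_plane_problem_def)
  have c0: "continuous_on UNIV (trace0 u)" by (rule continuous_on_trace0[OF cont])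
  show "trace0 u \<in> borel_measurable borel" by (rule borel_measurable_continuous_onI[OF c0])
  obtain C where C: "\<forall>\<^sub>F (x1, x2) in at_infinity. norm (trace0 u (x1, x2)) < C * exp (- 4 * ?\<kappa> * sqrt (x1^2 + x2^2))"
    using dec unfolding exponential_decay_def by blast
  show "integrable lborel (\<lambda>x. norm (trace0 u x) * exp (2 * ?\<kappa> * (\<bar>fst x\<bar> + \<bar>snd x\<bar>)))"
    by (rule exponential_weight_integrable[OF \<open>0 < ?\<kappa>\<close> c0 C])
  show "trace0 u (x1, x2) = - exp (\<i> * (k1 * of_real x1 + k2 * of_real x2))" if "x1 > 0" "x2 > 0" for x1 x2
    using qp that by (simp add: trace0_eq[OF cont] quarter_plane_problem_def)
  show "normal_trace0 u (x1, x2) = 0" if "x1 < 0 \<or> x2 < 0" for x1 x2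
    using qp that by (intro normal_trace0_eq_0) (auto simp: quarter_plane_problem_def)
  show "integrable lborel (fourier_integrand (normal_trace0 u) \<xi>)" if "\<xi> \<in> initial_domain ?\<kappa>" for \<xi>
    using ia that by (simp add: initially_analytic_def)
  show "holo2_on (fourier (normal_trace0 u)) (initial_domain ?\<kappa>)"
    using ia by (simp add: initially_analytic_def spectral_W_def)
  show "spectral_K k s t * fourier (normal_trace0 u) (of_real s, of_real t) = \<i> * fourier (trace0 u) (of_real s, of_real t)" for s t
    using fe by (simp add: functional_equation_def spectral_W_def spectral_U_def)
qed (fact eps k cut)+

theorem theorem3p3:
  fixes a1 a2 :: real
  assumes "a1 > 0" and "a2 > 0"
  shows "\<exists>\<delta>>0. \<forall>(\<epsilon>::real) k k1 k2 (u :: real \<times> real \<times> real \<Rightarrow> complex).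
    0 < \<epsilon> \<and> \<epsilon> < \<delta> \<and> k^2 = 1 + \<i> * of_real \<epsilon> \<and> Re k > 0 \<and>
    Re k1 = a1 \<and> 0 < Im k1 \<and> Im k1 < \<delta> \<and>
    Re k2 = a2 \<and> 0 < Im k2 \<and> Im k2 < \<delta> \<and>
    k1 \<notin> h_plus k \<and>
    quarter_plane_problem k k1 k2 u \<and>
    exponential_decay (kappa \<epsilon> k1 k2) u \<and>
    initially_analytic (kappa \<epsilon> k1 k2) u \<and>
    functional_equation k u \<and>
    three_quarter_based (spectral_U' k1 k2 u) \<and>
    growth_conditions (spectral_W u)
    \<longrightarrow> (\<exists>W :: complex \<times> complex \<Rightarrow> complex.
      (\<forall>\<xi>\<in>initial_domain (kappa \<epsilon> k1 k2). W \<xi> = spectral_W u \<xi>) \<and>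
      holo2_on W (initial_domain (kappa \<epsilon> k1 k2) \<union> (H_minus k - {- k1}) \<times> H_hat_plus) \<and>
      (\<forall>q\<in>H_hat_plus.
        (\<lambda>(\<xi>1, \<xi>2). W (\<xi>1, \<xi>2)
            - 1 / (\<xi>1 + k1) * (\<i> * gamma_fun k k1 \<xi>2 * gamma_fun k k1 k2 / (\<xi>2 + k2)))
          \<in> O[at (- k1, q) within {(\<xi>1, \<xi>2). \<xi>1 \<noteq> - k1}](\<lambda>(\<xi>1, \<xi>2). (\<xi>1 + k1) ^ 0)) \<and>
      (\<forall>b\<in>lift k \<real>. \<forall>q\<in>H_hat_plus. analytic_at_boundary k W b q) \<and>
      (\<forall>b\<in>P_contour k - {P_point k 0}. \<forall>q\<in>H_hat_plus. analytic_at_boundary k W b q) \<and>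
      (\<forall>q\<in>H_hat_plus. analytic_at_tip k W q) \<and>
      (\<forall>b\<in>lift k (H_minus k - {- k1}). \<forall>q\<in>\<real>. analytic_at_boundary k W b q) \<and>
      (\<forall>b\<in>P_contour k. \<forall>q\<in>\<real>. continuous_at_boundary k (- k1) W b q))"
\<comment> \<open>The witness 1 is the bound on \<epsilon> in \<open>inner_root_strip\<close>; it
  also gives \<kappa> \<le> 1/8 in \<open>abs_radicand_lower_bound\<close>.\<close>
proof (intro exI[of _ "1::real"] conjI allI impI)
  fix \<epsilon> :: real and k k1 k2 :: complex and u :: "real \<times> real \<times> real \<Rightarrow> complex"
  assume *: "0 < \<epsilon> \<and> \<epsilon> < 1 \<and> k^2 = 1 + \<i> * of_real \<epsilon> \<and> Re k > 0 \<and>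
    Re k1 = a1 \<and> 0 < Im k1 \<and> Im k1 < 1 \<and> Re k2 = a2 \<and> 0 < Im k2 \<and> Im k2 < 1 \<and>
    k1 \<notin> h_plus k \<and> quarter_plane_problem k k1 k2 u \<and> exponential_decay (kappa \<epsilon> k1 k2) u \<and>
    initially_analytic (kappa \<epsilon> k1 k2) u \<and> functional_equation k u \<and>
    three_quarter_based (spectral_U' k1 k2 u) \<and> growth_conditions (spectral_W u)"
  interpret spectral_data \<epsilon> "kappa \<epsilon> k1 k2" k k1 k2 "trace0 u" "normal_trace0 u"
    by (rule spectral_data_quarter_plane) (use * in auto)
  show "\<exists>W :: complex \<times> complex \<Rightarrow> complex.
      (\<forall>\<xi>\<in>initial_domain (kappa \<epsilon> k1 k2). W \<xi> = spectral_W u \<xi>) \<and>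
      holo2_on W (initial_domain (kappa \<epsilon> k1 k2) \<union> (H_minus k - {- k1}) \<times> H_hat_plus) \<and>
      (\<forall>q\<in>H_hat_plus.
        (\<lambda>(\<xi>1, \<xi>2). W (\<xi>1, \<xi>2)
            - 1 / (\<xi>1 + k1) * (\<i> * gamma_fun k k1 \<xi>2 * gamma_fun k k1 k2 / (\<xi>2 + k2)))
          \<in> O[at (- k1, q) within {(\<xi>1, \<xi>2). \<xi>1 \<noteq> - k1}](\<lambda>(\<xi>1, \<xi>2). (\<xi>1 + k1) ^ 0)) \<and>
      (\<forall>b\<in>lift k \<real>. \<forall>q\<in>H_hat_plus. analytic_at_boundary k W b q) \<and>
      (\<forall>b\<in>P_contour k - {P_point k 0}. \<forall>q\<in>H_hat_plus. analytic_at_boundary k W b q) \<and>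
      (\<forall>q\<in>H_hat_plus. analytic_at_tip k W q) \<and>
      (\<forall>b\<in>lift k (H_minus k - {- k1}). \<forall>q\<in>\<real>. analytic_at_boundary k W b q) \<and>
      (\<forall>b\<in>P_contour k. \<forall>q\<in>\<real>. continuous_at_boundary k (- k1) W b q)"
    by (intro exI[of _ continuation] conjI ballI;
        (rule continuation_holo2 | erule continuation_pole | erule analytic_tip | erule (1) analytic_real_boundary
         | erule (1) analytic_cut_boundary | erule (1) analytic_lower_boundary | erule (1) continuous_cut_boundary
         | simp add: continuation_initial spectral_W_def))
qed simp

end
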